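(* Let $\hat h\in\mathbb{C}[[z]]$ be a formal power series solution of a linear $q$-difference equation with coefficients in $\mathbb{C}(z)$. There exist $\kappa_1,\dots,\kappa_r\in\mathbb{Q}_{>0}$, $n,K\in\mathbb{N}^*$ and a finite set $\Sigma\subset\mathbb{C}^*/q^{n^{-1}\mathbb{Z}}$ such that for all $\lambda\in(\mathbb{C}^*/q^{n^{-1}\mathbb{Z}})\setminus\Sigma$, the composition $$S_q^{[\lambda]}(\hat h):=\mathcal{L}_{\kappa_r,n}^{[\lambda]}\circ\mathcal{L}_{\kappa_{r-1},K}^{[\lambda]}\circ\dots\circ\mathcal{L}_{\kappa_1,K}^{[\lambda]}\circ\hat{\mathcal{B}}_{\kappa_1}\circ\dots\circ\hat{\mathcal{B}}_{\kappa_r}(\hat h)$$ is well defined, is meromorphic on $\mathbb{C}^*$, and is a solution of the same equation as $\hat h$. Moreover, $S_q^{[\lambda]}(\hat h)$ is asymptotic to $\hat h$ (that is, $S_q^{[\lambda]}(\hat h)\sim^{[\lambda]}_{\mu,n}\hat h$ for some $\mu\in\mathbb{Q}_{>0}$), and for $|z|$ close to $0$ its poles have order at most $1$ and are contained in the $q^{1/n}$-spiral $-\lambda q^{n^{-1}\mathbb{Z}}$.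
   Context: Here $q\in\mathbb{C}$ is fixed with $|q|>1$, $\mathbb{N}=\{0,1,2,\dots\}$, $\mathbb{N}^*=\mathbb{N}\setminus\{0\}$. A logarithm $\log(q)$ is fixed and $q^\alpha:=e^{\alpha\log q}$ for $\alpha\in\mathbb{C}$. For $\alpha\in\mathbb{Q}$, $\sigma_q^{\alpha}$ sends $y(z)$ to $y(q^\alpha z)$. For $K\in\mathbb{N}^*$, $q^{K^{-1}\mathbb{Z}}=\{q^{\ell}:\ell\in K^{-1}\mathbb{Z}\}$. A linear $q$-difference equation with coefficients in $\mathbb{C}(z)$ is an equation $\sum_{i=0}^m a_i\,\sigma_q^i(y)=a$ with $a_i,a\in\mathbb{C}(z)$, the $a_i$ not all zero. For $p\in\mathbb{C}$, $|p|>1$, $\Theta_p(z):=\sum_{\ell\in\mathbb{Z}}p^{-\ell(\ell+1)/2}z^\ell$. $\mathcal{M}(\mathbb{C}^* )$ is the field of meromorphic functions on $\mathbb{C}^*$ and $\mathcal{M}(\mathbb{C}^*,0)$ is the field of functions meromorphic on some punctured neighborhood of $0$ in $\mathbb{C}^*$; two analytic functions are considered equal if their analytic continuations coincide, and a convergent power series is viewed as an element of $\mathcal{M}(\mathbb{C}^*,0)$. $q$-Borel transformation of order $\mu\in\mathbb{Q}_{>0}$: $\hat{\mathcal B}_\mu:\mathbb{C}[[z]]\to\mathbb{C}[[\zeta]]$, $\sum_{\ell\in\mathbb{N}} a_\ell z^\ell\mapsto\sum_{\ell\in\mathbb{N}} a_\ell q^{-\ell(\ell-1)/(2\mu)}\zeta^\ell$.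 Let $(\mu,K)\in\mathbb{Q}_{>0}\times\mathbb{N}^*$ with $K\in\mu\mathbb{N}^*$ and $\lambda\in\mathbb{C}^*/q^{K^{-1}\mathbb{Z}}$. $\mathbb{H}^{[\lambda]}_{\mu,K}$ is the set of $f\in\mathcal{M}(\mathbb{C}^*,0)$ for which there exist $\varepsilon>0$ and a connected domain $\Omega\subset\mathbb{C}$ with $\bigcup_{\ell\in K^{-1}\mathbb{Z}}\{z\in\mathbb{C}^*:|z-\lambda q^\ell|<\varepsilon|q^\ell\lambda|\}\subset\Omega$ such that $f$ can be continued to an analytic function on $\Omega$ satisfying, for some constants $L,M>0$, $|f(z)|<L\,|\Theta_{|q|^{1/\mu}}(M|z|)|$ for all $z\in\Omega$. The $q$-Laplace transformation of order $\mu$ is $\mathcal{L}^{[\lambda]}_{\mu,K}:\mathbb{H}^{[\lambda]}_{\mu,K}\to\mathcal{M}(\mathbb{C}^*,0)$, $$\mathcal{L}^{[\lambda]}_{\mu,K}(f)(z)=\frac{\mu}{K}\sum_{\ell\in K^{-1}\mathbb{Z}}\frac{f(q^\ell\lambda)}{\Theta_{q^{1/\mu}}\left(q^{\frac1\mu+\ell}\lambda/z\right)}.$$ A composition of these maps is well defined at $\hat h$ if at each stage the function to which a $q$-Laplace transformation is applied belongs to its domain. Here $K/n\in\mathbb{N}^*$, and $\lambda\in\mathbb{C}^*/q^{n^{-1}\mathbb{Z}}$ is identified with its image in $\mathbb{C}^*/q^{K^{-1}\mathbb{Z}}$. Asymptotics: for $f\in\mathcal{M}(\mathbb{C}^*,0)$,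 $\hat f=\sum_i\hat f_iz^i\in\mathbb{C}[[z]]$, one writes $f\sim^{[\lambda]}_{\mu,K}\hat f$ if for all sufficiently small $\varepsilon,R>0$ there exist $L,M>0$ such that for all $k\in\mathbb{N}$ and all $z\in\{z\in\mathbb{C}^*:|z|<R\}\setminus\bigcup_{\ell\in K^{-1}\mathbb{Z}}\{z\in\mathbb{C}^*:|z+q^\ell\lambda|<\varepsilon|q^\ell\lambda|\}$ one has $\left|f(z)-\sum_{i=0}^{k-1}\hat f_iz^i\right|<LM^k|q|^{\frac{k(k-1)}{2\mu}}|z|^k$. *)

theory Defs
  imports
    "HOL-Complex_Analysis.Complex_Analysis"
    "HOL-Complex_Analysis.Meromorphic"
    "HOL-Computational_Algebra.Computational_Algebra"
    "HOL-Computational_Algebra.Field_as_Ring"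
begin

(* Throughout, lq is the fixed logarithm of q, so that q = exp lq. *)

definition qpow :: "complex \<Rightarrow> complex \<Rightarrow> complex" where
  "qpow lq \<alpha> = exp (\<alpha> * lq)"

definition frac_ints :: "nat \<Rightarrow> real set" where
  "frac_ints K = {of_int j / of_nat K | j :: int. True}"

(* The exponent l * (l + 1) is even, so div is exact.  Only meaningful for z \<noteq> 0. *)
definition q_theta :: "complex \<Rightarrow> complex \<Rightarrow> complex" where
  "q_theta p z = (\<Sum>\<^sub>\<infinity>l\<in>(UNIV :: int set). p powi (- (l * (l + 1) div 2)) * z powi l)"

(* (- {0}) // spiral_rel lq K is the quotient group of the nonzero complex numbers
   by the powers of q with exponents in (1/K) \<int>. *)
definition spiral_rel :: "complex \<Rightarrow> nat \<Rightarrow> (complex \<times> complex) set" where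
  "spiral_rel lq K =
     {(x, y). x \<noteq> 0 \<and> y \<noteq> 0 \<and> (\<exists>l\<in>frac_ints K. y = qpow lq (of_real l) * x)}"


(* Rational functions, as elements of the fraction field of the polynomial ring; they act on
   formal power series through their Laurent expansion at 0.  As a function, ratfun_eval r has
   the junk value 0 at the poles of r. *)

definition ratfun_fls :: "complex poly fract \<Rightarrow> complex fls" where
  "ratfun_fls r = (case quot_of_fract r of (n, d) \<Rightarrow>
     fps_to_fls (fps_of_poly n) / fps_to_fls (fps_of_poly d))"

definition ratfun_eval :: "complex poly fract \<Rightarrow> complex \<Rightarrow> complex" where
  "ratfun_eval r z = (case quot_of_fract r of (n, d) \<Rightarrow> poly n z / poly d z)"

definition qdiff_formal_solution ::
  "complex \<Rightarrow> nat \<Rightarrow> (nat \<Rightarrow> complex poly fract) \<Rightarrow> complex poly fract \<Rightarrow> complex fps \<Rightarrow> bool" where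
  "qdiff_formal_solution q m a b h \<longleftrightarrow>
     (\<Sum>i\<le>m. ratfun_fls (a i) * fps_to_fls (fps_compose h (fps_const (q ^ i) * fps_X)))
       = ratfun_fls b"

(* An identity between meromorphic functions, hence required off a discrete set only. *)
definition qdiff_meromorphic_solution ::
  "complex \<Rightarrow> nat \<Rightarrow> (nat \<Rightarrow> complex poly fract) \<Rightarrow> complex poly fract \<Rightarrow> (complex \<Rightarrow> complex) \<Rightarrow> bool" where
  "qdiff_meromorphic_solution q m a b y \<longleftrightarrow>
     (\<forall>\<^sub>\<approx>z\<in>-{0}. (\<Sum>i\<le>m. ratfun_eval (a i) z * y (q ^ i * z)) = ratfun_eval b z)"


(* The field of functions meromorphic on some punctured neighbourhood of 0.  Its elements are
   represented by arbitrary functions on the complex plane; two of them represent the same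
   element iff they are related by meromorphic_germ_eq, so the values away from 0 and on a
   discrete subset of a punctured neighbourhood of 0 are irrelevant. *)

definition meromorphic_germs :: "(complex \<Rightarrow> complex) set" where
  "meromorphic_germs = {f. \<exists>r>0. f meromorphic_on (ball 0 r - {0})}"

definition meromorphic_germ_eq :: "(complex \<Rightarrow> complex) \<Rightarrow> (complex \<Rightarrow> complex) \<Rightarrow> bool" where
  "meromorphic_germ_eq f g \<longleftrightarrow> (\<exists>r>0. \<forall>\<^sub>\<approx>z\<in>ball 0 r - {0}. f z = g z)"


definition q_borel :: "complex \<Rightarrow> real \<Rightarrow> complex fps \<Rightarrow> complex fps" where
  "q_borel lq \<mu> h =
     Abs_fps (\<lambda>l. fps_nth h l * qpow lq (- (of_nat l * (of_nat l - 1) / (2 * of_real \<mu>))))"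

(* F is an analytic continuation of the germ f to a domain as in the definition of the
   source of the q-Laplace transformation.  The origin may belong to \<Omega>, but the theta function
   is not defined there, so the growth condition is imposed on \<Omega> - {0}; at the single point 0
   it would be satisfied by any F after enlarging L. *)
definition q_laplace_continuation ::
  "complex \<Rightarrow> complex \<Rightarrow> real \<Rightarrow> nat \<Rightarrow> (complex \<Rightarrow> complex) \<Rightarrow> (complex \<Rightarrow> complex) \<Rightarrow> bool" where
  "q_laplace_continuation lq lam \<mu> K f F \<longleftrightarrow>
     (\<exists>\<epsilon>>0. \<exists>\<Omega>. open \<Omega> \<and> connected \<Omega> \<and>
        (\<Union>l\<in>frac_ints K. {z. z \<noteq> 0 \<and>
            norm (z - lam * qpow lq (of_real l)) < \<epsilon> * norm (qpow lq (of_real l) * lam)}) \<subseteq> \<Omega> \<and>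
        F analytic_on \<Omega> \<and>
        (\<exists>r>0. \<forall>\<^sub>\<approx>z\<in>\<Omega> \<inter> (ball 0 r - {0}). f z = F z) \<and>
        (\<exists>L>0. \<exists>M>0. \<forall>z\<in>\<Omega> - {0}.
           norm (F z) < L * norm (q_theta (of_real (norm (exp lq) powr (1 / \<mu>)))
                                          (of_real (M * norm z)))))"

definition q_laplace_dom ::
  "complex \<Rightarrow> complex \<Rightarrow> real \<Rightarrow> nat \<Rightarrow> (complex \<Rightarrow> complex) set" where
  "q_laplace_dom lq lam \<mu> K =
     {f \<in> meromorphic_germs. \<exists>F. q_laplace_continuation lq lam \<mu> K f F}"

(* The values of f on the spiral of lam are those of its continuation.  The continuation is
   unique on this spiral whenever f has a single-valued meromorphic continuation to the nonzero
   complex numbers, as is the case for solutions of linear q-difference equations. *)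
definition q_laplace ::
  "complex \<Rightarrow> complex \<Rightarrow> real \<Rightarrow> nat \<Rightarrow> (complex \<Rightarrow> complex) \<Rightarrow> complex \<Rightarrow> complex" where
  "q_laplace lq lam \<mu> K f =
     (let F = (SOME F. q_laplace_continuation lq lam \<mu> K f F) in
      (\<lambda>z. of_real \<mu> / of_nat K *
        (\<Sum>\<^sub>\<infinity>l\<in>frac_ints K.
           F (qpow lq (of_real l) * lam) /
           q_theta (qpow lq (of_real (1 / \<mu>)))
                   (qpow lq (of_real (1 / \<mu> + l)) * lam / z))))"

(* A list of pairs (\<mu>, K) describes a composition of q-Laplace transformations of order \<mu>
   along (1/K) \<int>, the head of the list being applied first. *)

primrec q_laplaces ::
  "complex \<Rightarrow> complex \<Rightarrow> (real \<times> nat) list \<Rightarrow> (complex \<Rightarrow> complex) \<Rightarrow> complex \<Rightarrow> complex" where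
  "q_laplaces lq lam [] f = f"
| "q_laplaces lq lam (s # ss) f = q_laplaces lq lam ss (q_laplace lq lam (fst s) (snd s) f)"

primrec q_laplaces_defined ::
  "complex \<Rightarrow> complex \<Rightarrow> (real \<times> nat) list \<Rightarrow> (complex \<Rightarrow> complex) \<Rightarrow> bool" where
  "q_laplaces_defined lq lam [] f \<longleftrightarrow> True"
| "q_laplaces_defined lq lam (s # ss) f \<longleftrightarrow>
     f \<in> q_laplace_dom lq lam (fst s) (snd s) \<and>
     q_laplaces_defined lq lam ss (q_laplace lq lam (fst s) (snd s) f)"

definition q_sum_stages :: "real list \<Rightarrow> nat \<Rightarrow> nat \<Rightarrow> (real \<times> nat) list" where
  "q_sum_stages \<kappa>s n K = map (\<lambda>\<kappa>. (\<kappa>, K)) (butlast \<kappa>s) @ [(last \<kappa>s, n)]"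

(* For \<kappa>s = [\<kappa>_1, ..., \<kappa>_r] the transformation of order \<kappa>_r is applied first. *)
definition q_borels :: "complex \<Rightarrow> real list \<Rightarrow> complex fps \<Rightarrow> complex fps" where
  "q_borels lq \<kappa>s h = foldr (q_borel lq) \<kappa>s h"

definition q_borel_sum ::
  "complex \<Rightarrow> real list \<Rightarrow> nat \<Rightarrow> nat \<Rightarrow> complex \<Rightarrow> complex fps \<Rightarrow> complex \<Rightarrow> complex" where
  "q_borel_sum lq \<kappa>s n K lam h =
     q_laplaces lq lam (q_sum_stages \<kappa>s n K) (eval_fps (q_borels lq \<kappa>s h))"

definition q_borel_summable ::
  "complex \<Rightarrow> real list \<Rightarrow> nat \<Rightarrow> nat \<Rightarrow> complex \<Rightarrow> complex fps \<Rightarrow> bool" where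
  "q_borel_summable lq \<kappa>s n K lam h \<longleftrightarrow>
     fps_conv_radius (q_borels lq \<kappa>s h) > 0 \<and>
     q_laplaces_defined lq lam (q_sum_stages \<kappa>s n K) (eval_fps (q_borels lq \<kappa>s h))"

(* This uses all values of f on the given region, so f has to be a representative
   without artificial values at removable singularities. *)
definition q_asymptotic ::
  "complex \<Rightarrow> complex \<Rightarrow> real \<Rightarrow> nat \<Rightarrow> (complex \<Rightarrow> complex) \<Rightarrow> complex fps \<Rightarrow> bool" where
  "q_asymptotic lq lam \<mu> K f h \<longleftrightarrow>
     (\<exists>\<epsilon>0>0. \<exists>R0>0. \<forall>\<epsilon> R. 0 < \<epsilon> \<and> \<epsilon> < \<epsilon>0 \<and> 0 < R \<and> R < R0 \<longrightarrow>
        (\<exists>L>0. \<exists>M>0. \<forall>k. \<forall>z \<in> {z. z \<noteq> 0 \<and> norm z < R} -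
             (\<Union>l\<in>frac_ints K. {z. z \<noteq> 0 \<and>
                norm (z + qpow lq (of_real l) * lam) < \<epsilon> * norm (qpow lq (of_real l) * lam)}).
           norm (f z - (\<Sum>i<k. fps_nth h i * z ^ i))
             < L * M ^ k * norm (exp lq) powr (real k * (real k - 1) / (2 * \<mu>)) * norm z ^ k))"

end

theory Submission
  imports Defs
begin

text \<open>
  Let the denominators be cleared, let deg bound the degrees in z of the coefficients, and put
  N = deg!, p = q^(1/N).  All orders \<kappa> are chosen equal to N, and n = K = N.  In base p, the Borel
  transformation of order N divides the coefficient of z^l by p^(l choose 2), and the q-Laplace
  transformation is \<Sum> f (p^l \<lambda>) \<theta>_l w^l / \<Theta>(w) with w = z / \<lambda>, where \<Theta> = \<Sum> \<theta>_l w^l is the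
  theta function of base p.  Write \<sigma> for z \<mapsto> p z.  The equation is a sum of monomials z^d \<sigma>^e, and
  the Borel transformation takes such a monomial to a multiple of z^d \<sigma>^(e - d).  After T > N m
  transformations the monomials of least degree carry the highest shift, and then the power series
  converges (power_series_coeff_bound).

  It remains to undo the T transformations by q-Laplace transformations.  Each of these transforms
  the equation backwards (laplace_equation), so at every level there is a solution near 0, and its
  equation continues it to the punctured plane (qdiff_extension).  The continuation is holomorphic
  away from the spirals p^Z s, where s = - \<lambda> or s is a root of the coefficient of the highest shift.
  If \<lambda> avoids the latter, the next transformation can be applied provided that the continuation
  grows at most like M^n |p|^(n choose 2) along z = p^n y.  This holds if every monomial whose degree
  exceeds that of the leading monomial of the highest shift by d has a shift that is lower by at
  least d (qdiff_growth, qop_growth).  It is the reason for the choice of N: at level 0 the shifts are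
  multiples of deg!, so the difference of two shifts is a multiple of the difference of the degrees,
  and this persists at all levels (level_degree_condition).  The exceptional set consists of the
  spirals through the non-zero roots of the highest coefficients at the levels 1, ..., T.

  The asymptotic expansion is carried along.  Each solution is a quotient V / \<Theta> near 0, where
  V - \<Theta> \<Sum>_{i<k} c_i z^i is bounded by L M^k |p|^(s (k choose 2)) |z|^k times the theta function of
  base |p| at |w|, and a q-Laplace transformation raises s by 1 (laplace_asymptotic, level_step).
  At the end, the lower bound for |\<Theta>| away from its zeros (theta_lower_bound) gives the expansion
  of order N / T.  By Jacobi's triple product the zeros of \<Theta> are simple and lie on -p^Z (theta_zero,
  theta_zero_simple); therefore the poles of V / \<Theta> near 0 are simple and lie on - \<lambda> p^Z.
\<close>

section \<open>The theta function\<close>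

text \<open>The extension of n choose 2 to negative integers.\<close>
definition tri :: "int \<Rightarrow> int" where
  "tri k = k * (k - 1) div 2"

lemma two_tri: "2 * tri k = k * (k - 1)"
  unfolding tri_def by simp

lemma tri_add: "tri (a + b) = tri a + tri b + a * b"
proof -
  have "2 * tri (a + b) = 2 * (tri a + tri b + a * b)"
    unfolding distrib_left two_tri by (simp add: algebra_simps)
  thus ?thesis by simp
qed

lemma tri_simps [simp]: "tri 1 = 0" "tri 2 = 1"
  by (simp_all add: tri_def)

lemma tri_minus: "tri (- k) = tri (k + 1)"
proof -
  have "2 * tri (- k) = 2 * tri (k + 1)"
    unfolding two_tri by (simp add: algebra_simps)
  thus ?thesis by simp
qed

lemma tri_of_nat: "tri (int n) = int (n choose 2)"
  by (cases n) (auto simp: tri_def choose_two algebra_simps zdiv_int)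

definition theta_coeff :: "'a::field \<Rightarrow> int \<Rightarrow> 'a" where
  "theta_coeff p l = p powi (- tri (l + 1))"

text \<open>Besides the theta function of the complex variable, the proof uses its real counterpart with
  parameter |p| as a majorant; hence the general type.\<close>
definition theta :: "'a::{real_normed_field,banach} \<Rightarrow> 'a \<Rightarrow> 'a" where
  "theta p z = (\<Sum>\<^sub>\<infinity>l. theta_coeff p l * z powi l)"

lemma q_theta_eq_theta: "q_theta p z = theta p z"
  unfolding q_theta_def theta_def theta_coeff_def tri_def by (simp add: mult.commute)

lemma theta_coeff_nz [simp]: "p \<noteq> 0 \<Longrightarrow> theta_coeff p l \<noteq> 0"
  by (simp add: theta_coeff_def)

lemma theta_coeff_0 [simp]: "theta_coeff p 0 = 1"
  by (simp add: theta_coeff_def)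

lemma theta_coeff_add:
  assumes "p \<noteq> 0"
  shows "theta_coeff p (l + k) = theta_coeff p l * theta_coeff p k * p powi (- (l * k))"
proof -
  have "- tri (l + k + 1) = - tri (l + 1) + (- tri (k + 1)) + (- (l * k))"
    using tri_add[of "l + 1" k] tri_add[of 1 k] by (simp add: algebra_simps)
  hence "theta_coeff p (l + k) = p powi (- tri (l + 1) + (- tri (k + 1)) + (- (l * k)))"
    unfolding theta_coeff_def by (rule arg_cong)
  also have "\<dots> = theta_coeff p l * theta_coeff p k * p powi (- (l * k))"
    unfolding theta_coeff_def using assms by (subst power_int_add, simp)+ simp
  finally show ?thesis .
qed

lemma theta_coeff_reflect: "theta_coeff p (- 1 - l) = theta_coeff p l"
  using tri_minus[of l] by (simp add: theta_coeff_def)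

lemma norm_theta_coeff:
  "norm (theta_coeff p l) = theta_coeff (norm (p::'a::real_normed_field)) l"
  by (simp add: theta_coeff_def norm_power_int)

lemma theta_coeff_pos: "p > 0 \<Longrightarrow> theta_coeff (p::real) l > 0"
  by (simp add: theta_coeff_def)

lemma bij_betw_int_nonneg: "bij_betw int UNIV {0..}"
  by (rule bij_betwI[where g = nat]) auto

lemma bij_betw_int_neg: "bij_betw (\<lambda>n. - 1 - int n) UNIV {..<0}"
  by (rule bij_betwI[where g = "\<lambda>l. nat (- 1 - l)"]) auto

lemma has_sum_intI:
  fixes f :: "int \<Rightarrow> 'a :: {topological_comm_monoid_add, t2_space}"
  assumes "((\<lambda>n. f (int n)) has_sum a) UNIV" "((\<lambda>n. f (- 1 - int n)) has_sum b) UNIV"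
  shows "(f has_sum (a + b)) UNIV"
proof -
  have "(f has_sum a) {0..}"
    using has_sum_reindex_bij_betw[OF bij_betw_int_nonneg, of f a] assms(1) by simp
  moreover have "(f has_sum b) {..<0}"
    using has_sum_reindex_bij_betw[OF bij_betw_int_neg, of f b] assms(2) by simp
  ultimately have "(f has_sum (a + b)) ({0..} \<union> {..<0})"
    by (intro has_sum_Un_disjoint) auto
  moreover have "{0..} \<union> {..<0} = (UNIV :: int set)" by auto
  ultimately show ?thesis by simp
qed

lemma summable_on_intI:
  fixes f :: "int \<Rightarrow> 'a :: {topological_comm_monoid_add, t2_space}"
  assumes "(\<lambda>n. f (int n)) summable_on UNIV" "(\<lambda>n. f (- 1 - int n)) summable_on UNIV"
  shows "f summable_on UNIV"
  using assms has_sum_intI[of f] unfolding summable_on_def by blast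

lemma
  fixes f :: "int \<Rightarrow> 'a :: banach"
  assumes "f summable_on UNIV"
  shows summable_on_int_nonneg: "(\<lambda>n. f (int n)) summable_on UNIV"
    and summable_on_int_neg: "(\<lambda>n. f (- 1 - int n)) summable_on UNIV"
    and infsum_int_split:
      "infsum f UNIV = (\<Sum>\<^sub>\<infinity>n. f (int n)) + (\<Sum>\<^sub>\<infinity>n. f (- 1 - int n))"
proof -
  have "f summable_on {0..}" "f summable_on {..<0}"
    using assms summable_on_subset_banach by blast+
  thus *: "(\<lambda>n. f (int n)) summable_on UNIV" "(\<lambda>n. f (- 1 - int n)) summable_on UNIV"
    using summable_on_reindex_bij_betw[OF bij_betw_int_nonneg, of f]
      summable_on_reindex_bij_betw[OF bij_betw_int_neg, of f] by auto
  show "infsum f UNIV = (\<Sum>\<^sub>\<infinity>n. f (int n)) + (\<Sum>\<^sub>\<infinity>n. f (- 1 - int n))"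
    by (rule infsumI, rule has_sum_intI) (use * in auto)
qed

lemma infsum_int_eqI:
  fixes f :: "int \<Rightarrow> 'a :: banach"
  assumes "f summable_on UNIV" "(\<lambda>n. f (int n)) sums a" "(\<lambda>n. f (- 1 - int n)) sums b"
  shows "infsum f UNIV = a + b"
proof -
  have "(\<lambda>n. f (int n)) sums (\<Sum>\<^sub>\<infinity>n. f (int n))"
    by (intro has_sum_imp_sums has_sum_infsum summable_on_int_nonneg assms)
  moreover have "(\<lambda>n. f (- 1 - int n)) sums (\<Sum>\<^sub>\<infinity>n. f (- 1 - int n))"
    by (intro has_sum_imp_sums has_sum_infsum summable_on_int_neg assms)
  ultimately show ?thesis
    using infsum_int_split[OF assms(1)] assms(2,3) sums_unique2 by metis
qed

lemma theta_summable_real_aux: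
  assumes "P > (1::real)" "x > 0"
  shows "(\<lambda>n. theta_coeff P (int n) * x ^ n) summable_on UNIV"
proof -
  let ?f = "\<lambda>n. theta_coeff P (int n) * x ^ n"
  have step: "?f (Suc n) = ?f n * (x * P powi (- int n - 1))" for n
  proof -
    have "theta_coeff P 1 = P powi (-1)" by (simp add: theta_coeff_def)
    moreover have "theta_coeff P (int n + 1) = theta_coeff P (int n) * theta_coeff P 1 * P powi (- int n)"
      using theta_coeff_add[of P "int n" 1] assms by simp
    moreover have "P powi (- int n - 1) = P powi (- int n) * P powi (-1)"
      using assms by (simp add: power_int_diff field_simps)
    ultimately show ?thesis by (simp add: algebra_simps)
  qed
  have "(\<lambda>n. x * inverse (P ^ Suc n)) \<longlonglongrightarrow> x * 0"
    using assms by (intro tendsto_mult tendsto_const LIMSEQ_Suc LIMSEQ_inverse_realpow_zero) auto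
  hence "\<forall>\<^sub>F n in sequentially. x * inverse (P ^ Suc n) < 1 / 2"
    by (intro order_tendstoD) auto
  then obtain N where N: "\<And>n. n \<ge> N \<Longrightarrow> x * inverse (P ^ Suc n) < 1 / 2"
    by (auto simp: eventually_sequentially)
  have "summable ?f"
  proof (rule summable_ratio_test[of "1/2" N])
    fix n assume "n \<ge> N"
    have e: "P powi (- int n - 1) = inverse (P ^ Suc n)"
      by (metis add.commute minus_add_distrib of_nat_Suc plus_1_eq_Suc power_int_minus power_int_of_nat uminus_add_conv_diff)
    have pos: "?f n > 0" using assms theta_coeff_pos[of P] by simp
    have "?f n * (x * P powi (- int n - 1)) \<le> ?f n * (1 / 2)"
      unfolding e using N[OF \<open>n \<ge> N\<close>] pos by (intro mult_left_mono) auto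
    moreover have pos': "?f (Suc n) > 0" using assms theta_coeff_pos[of P] by simp
    ultimately show "norm (?f (Suc n)) \<le> 1 / 2 * norm (?f n)"
      unfolding real_norm_def abs_of_pos[OF pos] abs_of_pos[OF pos'] step
      by (simp only: mult.commute)
  qed auto
  thus ?thesis
    by (intro summable_nonneg_imp_summable_on)
       (use assms theta_coeff_pos[of P] in \<open>auto intro!: mult_nonneg_nonneg less_imp_le\<close>)
qed

lemma theta_summable_real:
  assumes "P > (1::real)" "x > 0"
  shows "(\<lambda>l. theta_coeff P l * x powi l) summable_on UNIV"
proof (rule summable_on_intI)
  show "(\<lambda>n. theta_coeff P (int n) * x powi int n) summable_on UNIV"
    using theta_summable_real_aux[OF assms] by simp
  have "(\<lambda>n. theta_coeff P (int n) * (1 / x) ^ n * (1 / x)) summable_on UNIV"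
    using theta_summable_real_aux[of P "1/x"] assms by (intro summable_on_cmult_left) auto
  also have "(\<lambda>n. theta_coeff P (int n) * (1 / x) ^ n * (1 / x)) =
      (\<lambda>n. theta_coeff P (- 1 - int n) * x powi (- 1 - int n))"
    unfolding theta_coeff_reflect
    using assms by (auto simp: fun_eq_iff power_int_diff field_simps)
  finally show "\<dots> summable_on UNIV" .
qed

lemma theta_abs_summable:
  fixes p w :: "'a::{real_normed_field}"
  assumes "norm p > 1" "w \<noteq> 0"
  shows "(\<lambda>l. norm (theta_coeff p l * w powi l)) summable_on UNIV"
  using theta_summable_real[of "norm p" "norm w"] assms
  by (simp add: norm_mult norm_power_int norm_theta_coeff)

lemma theta_summable:
  fixes p w :: "'a::{real_normed_field,banach}"
  assumes "norm p > 1" "w \<noteq> 0"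
  shows "(\<lambda>l. theta_coeff p l * w powi l) summable_on UNIV"
  using theta_abs_summable[OF assms] by (rule abs_summable_summable)

lemma infsum_int_shift:
  "(\<Sum>\<^sub>\<infinity>l::int. f l) = (\<Sum>\<^sub>\<infinity>l. f (l + k))"
  by (rule infsum_reindex_bij_witness[of _ "\<lambda>l. l + k" "\<lambda>l. l - k"]) auto

text \<open>Quasi-periodicity: shifting the summation index by k turns theta (p^k w) into theta w up to the
  factor p^(k choose 2) w^k.  All comparisons of the growth of a function along a spiral with the
  growth of theta come from this identity.\<close>
lemma theta_shift:
  fixes p w :: "'a::{real_normed_field,banach}"
  assumes "norm p > 1" "w \<noteq> 0"
  shows "theta p (p powi k * w) = p powi tri k * w powi k * theta p w"
proof -
  have p: "p \<noteq> 0" using assms by auto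
  have "theta p (p powi k * w) = (\<Sum>\<^sub>\<infinity>l. theta_coeff p (l + k) * (p powi k * w) powi (l + k))"
    unfolding theta_def by (rule infsum_int_shift)
  also have "(\<lambda>l. theta_coeff p (l + k) * (p powi k * w) powi (l + k)) =
     (\<lambda>l. (p powi tri k * w powi k) * (theta_coeff p l * w powi l))"
  proof
    fix l
    have "- tri (k + 1) + (- (l * k)) + k * (l + k) = tri k"
      using tri_add[of k 1] two_tri[of k] by (simp add: algebra_simps)
    hence "p powi (tri k) = theta_coeff p k * p powi (- (l * k)) * p powi (k * (l + k))"
      unfolding theta_coeff_def using p by (metis power_int_add)
    thus "theta_coeff p (l + k) * (p powi k * w) powi (l + k) =
      (p powi tri k * w powi k) * (theta_coeff p l * w powi l)"
      using p assms(2) by (simp add: theta_coeff_add power_int_mult_distrib power_int_add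
          flip: power_int_mult)
  qed
  finally show ?thesis by (simp add: theta_def infsum_cmult_right')
qed

lemma theta_inverse:
  fixes p w :: "'a::{real_normed_field,banach}"
  assumes "norm p > 1" "w \<noteq> 0"
  shows "theta p (1 / w) = w * theta p w"
proof -
  have "theta p (1 / w) = (\<Sum>\<^sub>\<infinity>l. theta_coeff p (-1-l) * (1 / w) powi (-1-l))"
    unfolding theta_def
    by (rule infsum_reindex_bij_witness[of _ "\<lambda>l. -1-l" "\<lambda>l. -1-l"]) auto
  also have "(\<lambda>l. theta_coeff p (-1-l) * (1 / w) powi (-1-l)) =
      (\<lambda>l. w * (theta_coeff p l * w powi l))"
    unfolding theta_coeff_reflect using assms
    by (auto simp: fun_eq_iff power_int_diff field_simps)
  finally show ?thesis by (simp add: theta_def infsum_cmult_right')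
qed

lemma norm_theta_le:
  fixes p w :: "'a::{real_normed_field,banach}"
  assumes "norm p > 1" "w \<noteq> 0"
  shows "norm (theta p w) \<le> theta (norm p) (norm w)"
  unfolding theta_def using norm_infsum_bound[OF theta_abs_summable[OF assms]]
  by (simp add: norm_mult norm_power_int norm_theta_coeff)

lemma theta_of_real:
  assumes "P > (1::real)" "x > 0"
  shows "theta (of_real P) (of_real x :: 'a::{real_normed_field,banach}) = of_real (theta P x)"
proof -
  have "((\<lambda>l. theta_coeff P l * x powi l) has_sum theta P x) UNIV"
    using theta_summable_real[OF assms] by (simp add: theta_def)
  hence "((\<lambda>l. of_real (theta_coeff P l * x powi l)) has_sum (of_real (theta P x) :: 'a)) UNIV"
    by (rule has_sum_of_real)
  thus ?thesis unfolding theta_def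
    by (intro infsumI) (simp add: theta_coeff_def)
qed

text \<open>All terms of the real theta series are positive, so each of them is a lower bound.\<close>
lemma theta_real_ge_term:
  assumes "P > (1::real)" "x > 0"
  shows "theta P x \<ge> theta_coeff P l * x powi l"
proof -
  have "(\<Sum>\<^sub>\<infinity>l\<in>{l}. theta_coeff P l * x powi l) \<le> theta P x"
    unfolding theta_def
    by (rule infsum_mono2) (use assms theta_summable_real[OF assms] theta_coeff_pos[of P] in
          \<open>auto intro!: mult_nonneg_nonneg less_imp_le\<close>)
  thus ?thesis by simp
qed

lemma theta_real_ge_1: "P > (1::real) \<Longrightarrow> x > 0 \<Longrightarrow> theta P x \<ge> 1"
  using theta_real_ge_term[of P x 0] by simp

text \<open>The real theta function is not monotone, but each power x^l is bounded by its values at the two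
  ends of an interval.\<close>
lemma theta_real_le:
  assumes P: "P > (1::real)" and x: "a > 0" "a \<le> x" "x \<le> b"
  shows "theta P x \<le> theta P a + theta P b"
proof -
  have "theta P a + theta P b = (\<Sum>\<^sub>\<infinity>l. theta_coeff P l * a powi l + theta_coeff P l * b powi l)"
    unfolding theta_def
    by (rule infsum_add[symmetric]) (use assms theta_summable_real in auto)
  moreover have "theta P x \<le> (\<Sum>\<^sub>\<infinity>l. theta_coeff P l * a powi l + theta_coeff P l * b powi l)"
    unfolding theta_def
  proof (rule infsum_mono)
    fix l
    have "x powi l \<le> a powi l + b powi l"
    proof (cases "l \<ge> 0")
      case True
      hence "x powi l \<le> b powi l" using x by (intro power_int_mono) auto
      thus ?thesis using x by (simp add: add_increasing)
    next
      case False
      hence "x powi l \<le> a powi l" using x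
        by (simp add: power_int_def frac_le power_mono le_imp_inverse_le flip: power_inverse)
      thus ?thesis using x by (simp add: add_increasing2)
    qed
    thus "theta_coeff P l * x powi l \<le> theta_coeff P l * a powi l + theta_coeff P l * b powi l"
      using P theta_coeff_pos[of P l] by (simp add: mult_left_mono flip: distrib_left)
  qed (use assms theta_summable_real in \<open>auto intro!: summable_on_add\<close>)
  ultimately show ?thesis by simp
qed

section \<open>Laurent series\<close>

text \<open>A two-sided series that converges absolutely for 0 < |w| < R is the sum of a power series in w
  with radius of convergence at least R and a power series in 1/w with infinite radius.\<close>
lemma
  fixes u :: "int \<Rightarrow> complex"
  assumes R: "R > 0"
  assumes sum: "\<And>x. 0 < x \<Longrightarrow> x < R \<Longrightarrow> (\<lambda>l. norm (u l) * x powi l) summable_on UNIV"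
  shows laurent_regular_part_holomorphic: "(\<lambda>w. \<Sum>n. u (int n) * w ^ n) holomorphic_on ball 0 R"
    and laurent_principal_part_holomorphic: "(\<lambda>w. \<Sum>n. u (- 1 - int n) * w ^ n) holomorphic_on UNIV"
    and laurent_series_split: "\<And>w. w \<in> ball 0 R - {0} \<Longrightarrow> (\<Sum>\<^sub>\<infinity>l. u l * w powi l) =
      (\<Sum>n. u (int n) * w ^ n) + (\<Sum>n. u (- 1 - int n) * (1 / w) ^ n) / w"
proof -
  define A where "A = (\<lambda>w. \<Sum>n. u (int n) * w ^ n)"
  define B where "B = (\<lambda>w. \<Sum>n. u (- 1 - int n) * w ^ n)"
  have sum': "(\<lambda>l. u l * w powi l) summable_on UNIV" if "w \<noteq> 0" "norm w < R" for w
  proof -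
    have "(\<lambda>l. norm (u l * w powi l)) summable_on UNIV"
      using sum[of "norm w"] that by (simp add: norm_mult norm_power_int)
    thus ?thesis by (rule abs_summable_summable)
  qed
  have Asums: "(\<lambda>n. u (int n) * w ^ n) sums A w" if "norm w < R" for w
  proof (cases "w = 0")
    case True
    thus ?thesis by (auto simp: A_def intro!: summable_sums summable_0_powser)
  next
    case False
    from summable_on_int_nonneg[OF sum'[OF this that]] show ?thesis
      unfolding A_def by (intro summable_sums summable_on_imp_summable) auto
  qed
  have Bsums: "(\<lambda>n. u (- 1 - int n) * w ^ n) sums B w" for w
  proof (cases "w = 0")
    case True
    thus ?thesis by (auto simp: B_def intro!: summable_sums summable_0_powser)
  next
    case False
    define v where "v = (if norm w > 1 / R then w else of_real (2 / R))"
    have "norm v > 1 / R" "norm v \<ge> norm w"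
      using R by (auto simp: v_def norm_divide divide_strict_right_mono)
         (meson divide_right_mono less_imp_le linorder_not_le one_le_numeral order_trans)
    moreover from this R have "norm v > 0"
      by (meson divide_pos_pos less_trans zero_less_one)
    ultimately have v: "v \<noteq> 0" "norm (1 / v) < R" "norm v \<ge> norm w"
      using R by (auto simp: norm_divide pos_divide_less_eq mult.commute)
    have "(\<lambda>n. u (- 1 - int n) * (1 / v) powi (- 1 - int n)) summable_on UNIV"
      using summable_on_int_neg[OF sum'[of "1 / v"]] v by auto
    hence "summable (\<lambda>n. u (- 1 - int n) * (1 / v) powi (- 1 - int n))"
      by (rule summable_on_imp_summable)
    also have "(\<lambda>n. u (- 1 - int n) * (1 / v) powi (- 1 - int n)) = (\<lambda>n. v * (u (- 1 - int n) * v ^ n))"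
      using v by (auto simp: fun_eq_iff power_int_diff field_simps)
    finally have "summable (\<lambda>n. u (- 1 - int n) * v ^ n)"
      using v(1) summable_cmult_iff[of v] by blast
    note sv = this
    show ?thesis
    proof (cases "norm w > 1 / R")
      case True
      hence "v = w" by (simp add: v_def)
      with sv show ?thesis unfolding B_def by (intro summable_sums) simp
    next
      case False
      moreover from R have "1 / R < 2 / R" by (simp add: divide_strict_right_mono)
      ultimately have "norm w < norm v" using R by (auto simp: v_def norm_divide)
      with sv show ?thesis
        unfolding B_def by (intro summable_sums) (rule powser_inside)
    qed
  qed
  have hA: "A holomorphic_on ball 0 R"
    by (rule power_series_holomorphic[where a = "\<lambda>n. u (int n)"]) (use Asums in auto)
  have hB: "B holomorphic_on UNIV"
  proof (rule holomorphic_on_subset)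
    show "B holomorphic_on (\<Union>r. ball 0 r)"
      by (intro holomorphic_on_UN_open allI power_series_holomorphic[where a = "\<lambda>n. u (- 1 - int n)"])
         (use Bsums in auto)
    show "UNIV \<subseteq> (\<Union>r::real. ball (0::complex) r)"
    proof
      fix w :: complex
      have "w \<in> ball 0 (norm w + 1)" by auto
      thus "w \<in> (\<Union>r::real. ball (0::complex) r)" by blast
    qed
  qed
  have fin: "A w + B (1 / w) / w = (\<Sum>\<^sub>\<infinity>l. u l * w powi l)" if w: "w \<in> ball 0 R - {0}" for w
  proof -
    have sw: "(\<lambda>l. u l * w powi l) summable_on UNIV" using sum'[of w] w by auto
    have eq: "(\<lambda>n. u (- 1 - int n) * w powi (- 1 - int n)) = (\<lambda>n. (u (- 1 - int n) * (1 / w) ^ n) / w)"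
      using w by (auto simp: fun_eq_iff power_int_diff field_simps)
    have 2: "(\<lambda>n. u (int n) * w powi int n) sums A w"
      using Asums[of w] w by simp
    have 3: "(\<lambda>n. u (- 1 - int n) * w powi (- 1 - int n)) sums (B (1 / w) / w)"
      unfolding eq using sums_divide[OF Bsums[of "1/w"], of w] by simp
    show ?thesis by (rule infsum_int_eqI[symmetric, OF sw 2 3])
  qed
  show "(\<lambda>w. \<Sum>n. u (int n) * w ^ n) holomorphic_on ball 0 R"
    using hA unfolding A_def .
  show "(\<lambda>w. \<Sum>n. u (- 1 - int n) * w ^ n) holomorphic_on UNIV"
    using hB unfolding B_def .
  show "(\<Sum>\<^sub>\<infinity>l. u l * w powi l) =
      (\<Sum>n. u (int n) * w ^ n) + (\<Sum>n. u (- 1 - int n) * (1 / w) ^ n) / w"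
    if "w \<in> ball 0 R - {0}" for w
    using fin[OF that] unfolding A_def B_def by (rule sym)
qed

lemma laurent_series_holomorphic:
  fixes u :: "int \<Rightarrow> complex"
  assumes sum: "\<And>x. 0 < x \<Longrightarrow> x < R \<Longrightarrow> (\<lambda>l. norm (u l) * x powi l) summable_on UNIV"
  shows "(\<lambda>w. \<Sum>\<^sub>\<infinity>l. u l * w powi l) holomorphic_on ball 0 R - {0}"
proof (cases "R > 0")
  case False
  hence *: "ball 0 R - {0} = ({} :: complex set)" by auto
  show ?thesis by (subst *) (rule holomorphic_on_empty)
next
  case R: True
  define A where "A = (\<lambda>w. \<Sum>n. u (int n) * w ^ n)"
  define B where "B = (\<lambda>w. \<Sum>n. u (- 1 - int n) * w ^ n)"
  have hA: "A holomorphic_on ball 0 R" and hB: "B holomorphic_on UNIV"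
    unfolding A_def B_def
    by (rule laurent_regular_part_holomorphic[OF R] laurent_principal_part_holomorphic[OF R] | fact sum)+
  have "(\<lambda>w. A w + B (1 / w) / w) holomorphic_on ball 0 R - {0}"
    by (intro holomorphic_intros holomorphic_on_subset[OF hA]
          holomorphic_on_compose_gen[OF _ hB, unfolded o_def]) auto
  thus ?thesis
    by (rule holomorphic_transform) (simp only: A_def B_def laurent_series_split[OF R sum])
qed

lemma holomorphic_on_UNIV_if_balls:
  assumes "\<And>r. r > 0 \<Longrightarrow> f holomorphic_on ball (0::complex) r"
  shows "f holomorphic_on UNIV"
proof -
  have "f field_differentiable at w" for w
    by (rule holomorphic_on_imp_differentiable_at[OF assms[of "norm w + 1"]])
       (auto intro: add_nonneg_pos)
  thus ?thesis by (simp add: holomorphic_on_def)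
qed

text \<open>If the Laurent series vanishes identically, its regular part A is entire and equals minus the
  principal part, which tends to 0 at infinity; hence A = 0 by Liouville's theorem.  Applied to
  shifted sequences this gives the uniqueness of all Laurent coefficients.\<close>
lemma laurent_constant_coeff_0:
  fixes v :: "int \<Rightarrow> complex"
  assumes sum: "\<And>x. 0 < x \<Longrightarrow> (\<lambda>l. norm (v l) * x powi l) summable_on UNIV"
    and zero: "\<And>w. w \<noteq> 0 \<Longrightarrow> (\<Sum>\<^sub>\<infinity>l. v l * w powi l) = 0"
  shows "v 0 = 0"
proof -
  define A where "A = (\<lambda>w. \<Sum>n. v (int n) * w ^ n)"
  define B where "B = (\<lambda>w. \<Sum>n. v (- 1 - int n) * w ^ n)"
  have hA: "A holomorphic_on UNIV"
    by (rule holomorphic_on_UNIV_if_balls, unfold A_def, rule laurent_regular_part_holomorphic)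
       (use sum in auto)
  have hB: "B holomorphic_on UNIV"
    unfolding B_def by (rule laurent_principal_part_holomorphic[of 1]) (use sum in auto)
  have AB: "A w = - (B (1 / w) * (1 / w))" if "w \<noteq> 0" for w
  proof -
    have "(\<Sum>\<^sub>\<infinity>l. v l * w powi l) = A w + B (1 / w) / w"
      unfolding A_def B_def
      by (rule laurent_series_split[of "norm w + 1"]) (use sum that in \<open>auto intro: add_nonneg_pos\<close>)
    thus ?thesis using zero[OF that] by (simp add: eq_neg_iff_add_eq_0)
  qed
  have inv: "((\<lambda>w. 1 / w) \<longlongrightarrow> (0::complex)) at_infinity"
    using tendsto_inverse_0 by (simp add: divide_inverse)
  have "isCont B 0"
    using holomorphic_on_imp_continuous_on[OF hB] by (simp add: continuous_on_eq_continuous_at)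
  hence "((\<lambda>w. - (B (1 / w) * (1 / w))) \<longlongrightarrow> - (B 0 * 0)) at_infinity"
    by (intro tendsto_intros isCont_tendsto_compose[of _ B] inv)
  moreover have "\<forall>\<^sub>F w in at_infinity. - (B (1 / w) * (1 / w)) = A w"
    unfolding eventually_at_infinity by (rule exI[of _ 1]) (metis AB norm_zero not_one_le_zero)
  ultimately have "(A \<longlongrightarrow> 0) at_infinity"
    by (simp add: filterlim_cong[OF refl refl])
  hence "A 0 = 0" by (rule Liouville_weak_0[OF hA])
  thus ?thesis by (simp add: A_def)
qed

lemma theta_holomorphic:
  assumes "norm p > 1"
  shows "theta p holomorphic_on - {0 :: complex}"
proof -
  have "theta p holomorphic_on (\<Union>r. ball 0 r - {0})"
  proof (rule holomorphic_on_UN_open)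
    fix r :: real
    show "theta p holomorphic_on ball 0 r - {0}"
      unfolding theta_def[abs_def]
      by (rule laurent_series_holomorphic)
         (use theta_summable_real[of "norm p"] assms in \<open>simp add: norm_theta_coeff\<close>)
  qed auto
  moreover have "-{0} = (\<Union>r. ball (0::complex) r - {0})"
  proof (intro equalityI subsetI)
    fix w :: complex assume "w \<in> -{0}"
    hence "w \<in> ball 0 (norm w + 1) - {0}" by auto
    thus "w \<in> (\<Union>r. ball (0::complex) r - {0})" by blast
  qed auto
  ultimately show ?thesis by simp
qed

lemma infsum_diff:
  fixes f g :: "'b \<Rightarrow> 'a :: banach"
  assumes "f summable_on A" "g summable_on A"
  shows "(\<Sum>\<^sub>\<infinity>x\<in>A. f x - g x) = infsum f A - infsum g A"
proof -
  have "(\<lambda>x. - g x) summable_on A" using assms(2) summable_on_uminus by blast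
  from infsum_add[OF assms(1) this] show ?thesis by (simp add: infsum_uminus)
qed

lemma
  fixes u v :: "int \<Rightarrow> complex"
  assumes u: "\<And>x. 0 < x \<Longrightarrow> (\<lambda>l. norm (u l) * x powi l) summable_on UNIV"
    and v: "\<And>x. 0 < x \<Longrightarrow> (\<lambda>l. norm (v l) * x powi l) summable_on UNIV"
  defines "g \<equiv> \<lambda>l. \<Sum>\<^sub>\<infinity>k. u (l - k) * v k"
  shows laurent_product_summable: "0 < x \<Longrightarrow> (\<lambda>l. norm (g l) * x powi l) summable_on UNIV"
    and laurent_product_eq: "w \<noteq> 0 \<Longrightarrow>
      (\<Sum>\<^sub>\<infinity>l. u l * w powi l) * (\<Sum>\<^sub>\<infinity>l. v l * w powi l) = (\<Sum>\<^sub>\<infinity>l. g l * w powi l)"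
proof -
  define F where "F = (\<lambda>w (j, k). (u j * w powi j) * (v k * w powi k))"
  define F' where "F' = (\<lambda>w (l, k). (u (l - k) * w powi (l - k)) * (v k * w powi k))"
  have bij: "bij_betw (\<lambda>(l, k). (l - k, k)) (UNIV \<times> UNIV) (UNIV \<times> (UNIV :: int set))"
    by (rule bij_betwI[of _ _ _ "\<lambda>(l, k). (l + k, k)"]) auto
  have F_F': "F w (case z of (l, k) \<Rightarrow> (l - k, k)) = F' w z" for w z
    by (auto simp: F_def F'_def split: prod.splits)
  have un: "(\<lambda>l. norm (u l * w powi l)) summable_on UNIV" if "w \<noteq> 0" for w
    using u[of "norm w"] that by (simp add: norm_mult norm_power_int)
  have vn: "(\<lambda>l. norm (v l * w powi l)) summable_on UNIV" if "w \<noteq> 0" for w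
    using v[of "norm w"] that by (simp add: norm_mult norm_power_int)
  have absF: "(\<lambda>z. norm (F w z)) summable_on UNIV \<times> UNIV" if "w \<noteq> 0" for w
  proof (subst Infinite_Sum.abs_summable_on_Sigma_iff, intro conjI ballI)
    fix j :: int
    show "(\<lambda>k. norm (F w (j, k))) summable_on UNIV"
      unfolding F_def by (simp add: norm_mult[of "u j * w powi j"] summable_on_cmult_right vn[OF that])
    have "(\<lambda>j. norm (u j * w powi j) * (\<Sum>\<^sub>\<infinity>k. norm (v k * w powi k))) summable_on UNIV"
      by (intro summable_on_cmult_left un that)
    also have "(\<lambda>j. norm (u j * w powi j) * (\<Sum>\<^sub>\<infinity>k. norm (v k * w powi k))) =
        (\<lambda>j. norm (\<Sum>\<^sub>\<infinity>k. norm (F w (j, k))))"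
      unfolding F_def prod.case
      by (simp add: norm_mult[of "u _ * w powi _"] infsum_cmult_right' abs_mult infsum_nonneg)
    finally show "(\<lambda>j. norm (\<Sum>\<^sub>\<infinity>k. norm (F w (j, k)))) summable_on UNIV" .
  qed
  have absF': "(\<lambda>z. norm (F' w z)) summable_on UNIV \<times> UNIV" if "w \<noteq> 0" for w
    using summable_on_reindex_bij_betw[OF bij, of "\<lambda>z. norm (F w z)"] absF[OF that]
    unfolding F_F' by simp
  have F'_eq: "F' w (l, k) = (u (l - k) * v k) * w powi l" if "w \<noteq> 0" for w l k
    unfolding F'_def using that by (simp add: power_int_diff)
  have inner: "(\<Sum>\<^sub>\<infinity>k. F' w (l, k)) = g l * w powi l" if "w \<noteq> 0" for w l
    unfolding g_def F'_eq[OF that] by (rule infsum_cmult_left')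
  {
    fix w :: complex assume w: "w \<noteq> 0"
    have s1: "F w summable_on UNIV \<times> UNIV" using absF[OF w] by (rule abs_summable_summable)
    have s2: "F' w summable_on UNIV \<times> UNIV" using absF'[OF w] by (rule abs_summable_summable)
    have "infsum (F w) (UNIV \<times> UNIV) = (\<Sum>\<^sub>\<infinity>j. \<Sum>\<^sub>\<infinity>k. F w (j, k))"
      using infsum_Sigma_banach[OF s1] by simp
    also have "\<dots> = (\<Sum>\<^sub>\<infinity>l. u l * w powi l) * (\<Sum>\<^sub>\<infinity>l. v l * w powi l)"
      unfolding F_def prod.case by (simp add: infsum_cmult_right' infsum_cmult_left')
    finally have 1: "infsum (F w) (UNIV \<times> UNIV) = (\<Sum>\<^sub>\<infinity>l. u l * w powi l) * (\<Sum>\<^sub>\<infinity>l. v l * w powi l)" .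
    have "infsum (F' w) (UNIV \<times> UNIV) = (\<Sum>\<^sub>\<infinity>j. \<Sum>\<^sub>\<infinity>k. F' w (j, k))"
      using infsum_Sigma_banach[OF s2] by simp
    also have "\<dots> = (\<Sum>\<^sub>\<infinity>l. g l * w powi l)" by (simp add: inner[OF w])
    finally have 2: "infsum (F' w) (UNIV \<times> UNIV) = (\<Sum>\<^sub>\<infinity>l. g l * w powi l)" .
    have "infsum (F' w) (UNIV \<times> UNIV) = infsum (F w) (UNIV \<times> UNIV)"
      using infsum_reindex_bij_betw[OF bij, of "F w"] unfolding F_F' by simp
    with 1 2 show "(\<Sum>\<^sub>\<infinity>l. u l * w powi l) * (\<Sum>\<^sub>\<infinity>l. v l * w powi l) = (\<Sum>\<^sub>\<infinity>l. g l * w powi l)"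
      by simp
  }
  {
    fix x :: real assume x: "x > 0"
    hence w: "complex_of_real x \<noteq> 0" by simp
    note A = Infinite_Sum.abs_summable_on_Sigma_iff[THEN iffD1, OF absF'[OF w]]
    have "(\<lambda>l. norm (g l * of_real x powi l)) summable_on UNIV"
    proof (rule Infinite_Sum.abs_summable_on_comparison_test)
      show "(\<lambda>l. norm (\<Sum>\<^sub>\<infinity>k. norm (F' (of_real x) (l, k)))) summable_on UNIV"
        using A by blast
      fix l :: int
      have "norm (\<Sum>\<^sub>\<infinity>k. F' (of_real x) (l, k)) \<le> (\<Sum>\<^sub>\<infinity>k. norm (F' (of_real x) (l, k)))"
        using A by (intro norm_infsum_bound) auto
      thus "norm (g l * of_real x powi l) \<le> norm (\<Sum>\<^sub>\<infinity>k. norm (F' (of_real x) (l, k)))"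
        unfolding inner[OF w] by simp
    qed
    thus "(\<lambda>l. norm (g l) * x powi l) summable_on UNIV"
      using x by (simp add: norm_mult norm_power_int)
  }
qed

section \<open>Triple product and zeros of the theta function\<close>

primrec euler_coeff :: "complex \<Rightarrow> nat \<Rightarrow> complex" where
  "euler_coeff p 0 = 1"
| "euler_coeff p (Suc n) = euler_coeff p n * (1 / p ^ n) / (1 - 1 / p ^ Suc n)"

text \<open>Euler's expansion of the infinite product of the factors 1 + x / p^k, k \<ge> 0.  Both the
  functional equation and the zeros of the product can be read off the series.\<close>
definition euler_fun :: "complex \<Rightarrow> complex \<Rightarrow> complex" where
  "euler_fun p x = (\<Sum>n. euler_coeff p n * x ^ n)"

lemma power_neq_1:
  assumes "norm p > 1" "n > 0"
  shows "p ^ n \<noteq> (1 :: complex)"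
  using assms by (metis less_irrefl norm_one norm_power one_less_power)

lemma tendsto_divide_powers:
  assumes "norm (p :: complex) > 1"
  shows "(\<lambda>n. x / p ^ n) \<longlonglongrightarrow> 0"
proof -
  have "1 / norm p < 1" using assms by (subst divide_less_eq_1_pos) auto
  hence "norm (1 / p) < 1" by (simp add: norm_divide)
  from tendsto_mult_right_zero[OF LIMSEQ_power_zero[OF this], of x] show ?thesis
    by (simp add: power_one_over)
qed

lemma euler_summable:
  assumes p: "norm p > 1"
  shows "summable (\<lambda>n. norm (euler_coeff p n * x ^ n))"
proof -
  let ?f = "\<lambda>n. norm (euler_coeff p n * x ^ n)"
  have "(\<lambda>n. norm x * norm ((1 / p ^ n) / (1 - 1 / p ^ Suc n))) \<longlonglongrightarrow> norm x * norm ((0::complex) / (1 - 0))"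
  proof (intro tendsto_intros)
    show "(\<lambda>n. 1 / p ^ n) \<longlonglongrightarrow> 0"
      by (rule tendsto_divide_powers[OF p])
    from LIMSEQ_Suc[OF this] show "(\<lambda>n. 1 / p ^ Suc n) \<longlonglongrightarrow> 0" .
  qed auto
  hence "\<forall>\<^sub>F n in sequentially. norm x * norm ((1 / p ^ n) / (1 - 1 / p ^ Suc n)) < 1 / 2"
    by (intro order_tendstoD) auto
  then obtain N where N: "\<And>n. n \<ge> N \<Longrightarrow> norm x * norm ((1 / p ^ n) / (1 - 1 / p ^ Suc n)) < 1 / 2"
    by (auto simp: eventually_sequentially)
  show ?thesis
  proof (rule summable_ratio_test[of "1/2" N])
    fix n assume "n \<ge> N"
    have "?f (Suc n) = ?f n * (norm x * norm ((1 / p ^ n) / (1 - 1 / p ^ Suc n)))"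
      by (simp add: norm_mult norm_divide)
    also have "\<dots> \<le> ?f n * (1 / 2)"
      using N[OF \<open>n \<ge> N\<close>] by (intro mult_left_mono) auto
    finally show "norm (?f (Suc n)) \<le> 1 / 2 * norm (?f n)" by simp
  qed auto
qed

lemma euler_sums:
  assumes "norm p > 1"
  shows "(\<lambda>n. euler_coeff p n * x ^ n) sums euler_fun p x"
  unfolding euler_fun_def using summable_norm_cancel[OF euler_summable[OF assms]]
  by (rule summable_sums)

lemma euler_0 [simp]: "euler_fun p 0 = 1"
  unfolding euler_fun_def by simp

lemma euler_fun_eq:
  assumes p: "norm p > 1"
  shows "euler_fun p x = (1 + x) * euler_fun p (x / p)"
proof -
  let ?c = "euler_coeff p"
  have 1: "(\<lambda>n. ?c n * (1 / p ^ n) * x ^ n) sums euler_fun p (x / p)"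
    using euler_sums[OF p, of "x / p"] by (simp add: power_divide)
  have "(\<lambda>n. ?c n * x ^ n - ?c n * (1 / p ^ n) * x ^ n) sums (euler_fun p x - euler_fun p (x / p))"
    by (intro sums_diff euler_sums p 1)
  hence "(\<lambda>n. ?c (Suc n) * x ^ Suc n - ?c (Suc n) * (1 / p ^ Suc n) * x ^ Suc n) sums (euler_fun p x - euler_fun p (x / p))"
    using sums_Suc_iff[of "\<lambda>n. ?c n * x ^ n - ?c n * (1 / p ^ n) * x ^ n"] by simp
  also have "(\<lambda>n. ?c (Suc n) * x ^ Suc n - ?c (Suc n) * (1 / p ^ Suc n) * x ^ Suc n) =
      (\<lambda>n. ?c (Suc n) * (1 - 1 / p ^ Suc n) * x ^ Suc n)"
    by (simp only: right_diff_distrib left_diff_distrib mult_1_right)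
  also have "(\<lambda>n. ?c (Suc n) * (1 - 1 / p ^ Suc n) * x ^ Suc n) = (\<lambda>n. x * (?c n * (1 / p ^ n) * x ^ n))"
  proof
    fix n
    have "p ^ Suc n \<noteq> 1" "p \<noteq> 0" using power_neq_1[OF p, of "Suc n"] p by auto
    hence "1 - 1 / p ^ Suc n \<noteq> 0" by (simp add: field_simps)
    thus "?c (Suc n) * (1 - 1 / p ^ Suc n) * x ^ Suc n = x * (?c n * (1 / p ^ n) * x ^ n)"
      unfolding euler_coeff.simps by (simp del: power_Suc add: power_Suc[of x])
  qed
  finally have "x * euler_fun p (x / p) = euler_fun p x - euler_fun p (x / p)"
    using sums_mult[OF 1, of x] sums_unique2 by blast
  thus ?thesis by (simp add: algebra_simps)
qed

lemma euler_holomorphic: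
  assumes "norm p > 1"
  shows "euler_fun p holomorphic_on UNIV"
  by (rule holomorphic_on_UNIV_if_balls, rule power_series_holomorphic[where a = "euler_coeff p"])
     (use euler_sums[OF assms] in auto)

text \<open>If x is none of the points - p^k, the functional equation carries a zero at x to zeros at all
  points x / p^n.  These tend to 0, where the function has the value 1.\<close>
lemma euler_zero:
  assumes p: "norm p > 1" and z: "euler_fun p x = 0"
  shows "\<exists>k::nat. x = - (p ^ k)"
proof (rule ccontr)
  assume no: "\<nexists>k::nat. x = - (p ^ k)"
  have p0: "p \<noteq> 0" using p by auto
  have zero: "euler_fun p (x / p ^ n) = 0" for n
  proof (induction n)
    case (Suc n)
    have "1 + x / p ^ n \<noteq> 0"
    proof
      assume "1 + x / p ^ n = 0"
      hence "x = - (p ^ n)" using p0 by (simp add: field_simps add_eq_0_iff)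
      thus False using no by blast
    qed
    thus ?case using Suc euler_fun_eq[OF p, of "x / p ^ n"] by (simp add: mult.commute)
  qed (use z in simp)
  have "(\<lambda>n. x / p ^ n) \<longlonglongrightarrow> 0"
    by (rule tendsto_divide_powers[OF p])
  moreover have "isCont (euler_fun p) 0"
    using holomorphic_on_imp_continuous_on[OF euler_holomorphic[OF p]]
    by (simp add: continuous_on_eq_continuous_at)
  ultimately have "(\<lambda>n. euler_fun p (x / p ^ n)) \<longlonglongrightarrow> euler_fun p 0"
    by (metis isCont_tendsto_compose)
  hence "(\<lambda>n. 0) \<longlonglongrightarrow> (1::complex)" by (simp add: zero)
  thus False using LIMSEQ_unique tendsto_const zero_neq_one by blast
qed

text \<open>Jacobi's triple product up to a constant factor.  Both sides satisfy G (p w) = w G w, and this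
  equation determines the Laurent coefficients of G up to a common factor.  That factor
  does not vanish since G 1 \<noteq> 0.\<close>
lemma theta_triple_product:
  assumes p: "norm p > 1"
  obtains c where "c \<noteq> 0" "\<And>w. w \<noteq> 0 \<Longrightarrow> theta p w = c * (euler_fun p (w / p) * euler_fun p (1 / w))"
proof -
  have p0: "p \<noteq> 0" using p by auto
  define u where "u = (\<lambda>l::int. if l \<ge> 0 then euler_coeff p (nat l) / p ^ nat l else 0)"
  define v where "v = (\<lambda>l::int. if l \<le> 0 then euler_coeff p (nat (- l)) else 0)"
  define g where "g = (\<lambda>l. \<Sum>\<^sub>\<infinity>k. u (l - k) * v k)"
  define G where "G = (\<lambda>w. euler_fun p (w / p) * euler_fun p (1 / w))"
  have norm_sums: "(\<lambda>n. norm (euler_coeff p n) * y ^ n) summable_on UNIV" if "y \<ge> 0" for y :: real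
    using euler_summable[OF p, of "of_real y"] that
    by (intro summable_nonneg_imp_summable_on) (auto simp: norm_mult norm_power)
  have us: "(\<lambda>l. norm (u l) * x powi l) summable_on UNIV" if x: "x > 0" for x
  proof (rule summable_on_intI)
    show "(\<lambda>n. norm (u (int n)) * x powi int n) summable_on UNIV"
      using norm_sums[of "x / norm p"] x by (simp add: u_def norm_divide norm_power power_divide)
    show "(\<lambda>n. norm (u (-1 - int n)) * x powi (-1 - int n)) summable_on UNIV"
      by (simp add: u_def)
  qed
  have ueq: "(\<Sum>\<^sub>\<infinity>l. u l * w powi l) = euler_fun p (w / p)" if "w \<noteq> 0" for w
  proof -
    have "(\<lambda>l. norm (u l * w powi l)) summable_on UNIV"
      using us[of "norm w"] that by (simp add: norm_mult norm_power_int)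
    hence s: "(\<lambda>l. u l * w powi l) summable_on UNIV" by (rule abs_summable_summable)
    have "(\<lambda>n. u (int n) * w powi int n) sums euler_fun p (w / p)"
      using euler_sums[OF p, of "w / p"] by (simp add: u_def power_divide)
    moreover have "(\<lambda>n. u (-1 - int n) * w powi (-1 - int n)) sums 0"
      by (simp add: u_def)
    ultimately show ?thesis using infsum_int_eqI[OF s] by simp
  qed
  have vs: "(\<lambda>l. norm (v l) * x powi l) summable_on UNIV" if x: "x > 0" for x
  proof -
    have "(\<lambda>l. norm (v (- l)) * x powi (- l)) summable_on UNIV"
    proof (rule summable_on_intI)
      show "(\<lambda>n. norm (v (- int n)) * x powi (- int n)) summable_on UNIV"
        using norm_sums[of "1 / x"] x by (simp add: v_def power_int_minus divide_inverse power_inverse)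
      show "(\<lambda>n. norm (v (- (-1 - int n))) * x powi (- (-1 - int n))) summable_on UNIV"
        by (simp add: v_def)
    qed
    thus ?thesis
      using summable_on_reindex_bij_witness[of UNIV uminus uminus UNIV
          "\<lambda>l. norm (v l) * x powi l" "\<lambda>l. norm (v (- l)) * x powi (- l)"] by simp
  qed
  have veq: "(\<Sum>\<^sub>\<infinity>l. v l * w powi l) = euler_fun p (1 / w)" if "w \<noteq> 0" for w
  proof -
    have "(\<lambda>l. norm (v l * w powi l)) summable_on UNIV"
      using vs[of "norm w"] that by (simp add: norm_mult norm_power_int)
    hence "(\<lambda>l. v l * w powi l) summable_on UNIV" by (rule abs_summable_summable)
    hence s: "(\<lambda>l. v (- l) * w powi (- l)) summable_on UNIV"
      using summable_on_reindex_bij_witness[of UNIV uminus uminus UNIV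
          "\<lambda>l. v l * w powi l" "\<lambda>l. v (- l) * w powi (- l)"] by simp
    have "(\<lambda>n. v (- int n) * w powi (- int n)) sums euler_fun p (1 / w)"
      using euler_sums[OF p, of "1 / w"]
      by (simp add: v_def power_int_minus divide_inverse power_inverse)
    moreover have "(\<lambda>n. v (- (-1 - int n)) * w powi (- (-1 - int n))) sums 0"
      by (simp add: v_def)
    ultimately have "(\<Sum>\<^sub>\<infinity>l. v (- l) * w powi (- l)) = euler_fun p (1 / w)"
      using infsum_int_eqI[OF s] by simp
    thus ?thesis
      using infsum_reindex_bij_witness[of UNIV uminus uminus UNIV
          "\<lambda>l. v l * w powi l" "\<lambda>l. v (- l) * w powi (- l)"] by simp
  qed
  have gs: "(\<lambda>l. norm (g l) * x powi l) summable_on UNIV" if "x > 0" for x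
    unfolding g_def by (rule laurent_product_summable[OF us vs that])
  have geq: "(\<Sum>\<^sub>\<infinity>l. g l * w powi l) = G w" if "w \<noteq> 0" for w
  proof -
    have "G w = (\<Sum>\<^sub>\<infinity>l. (\<Sum>\<^sub>\<infinity>k. u (l - k) * v k) * w powi l)"
      using laurent_product_eq[OF us vs that] unfolding ueq[OF that] veq[OF that] G_def .
    thus ?thesis unfolding g_def by (rule sym)
  qed
  have gsum: "(\<lambda>l. g l * w powi l) summable_on UNIV" if "w \<noteq> 0" for w
  proof -
    have "(\<lambda>l. norm (g l * w powi l)) summable_on UNIV"
      using gs[of "norm w"] that by (simp add: norm_mult norm_power_int)
    thus ?thesis by (rule abs_summable_summable)
  qed
  have Gp: "G (p * w) = w * G w" if w: "w \<noteq> 0" for w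
  proof -
    have "G (p * w) = euler_fun p w * euler_fun p (1 / w / p)"
      using p0 by (simp add: G_def mult.commute)
    also have "euler_fun p w = (1 + w) * euler_fun p (w / p)" by (rule euler_fun_eq[OF p])
    also have "(1 + w) = w * (1 + 1 / w)" using w by (simp add: field_simps)
    finally have "G (p * w) = w * (euler_fun p (w / p) * ((1 + 1 / w) * euler_fun p (1 / w / p)))"
      by (simp only: mult_ac)
    also have "(1 + 1 / w) * euler_fun p (1 / w / p) = euler_fun p (1 / w)"
      by (rule euler_fun_eq[OF p, symmetric])
    finally show ?thesis by (simp add: G_def)
  qed
  have rec: "p powi l * g l = g (l - 1)" for l
  proof -
    \<comment> \<open>The Laurent coefficients of G (p w) - w G w, shifted by l.\<close>
    define e where "e = (\<lambda>k. p powi (k + l) * g (k + l) - g (k + l - 1))"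
    have "e 0 = 0"
    proof (rule laurent_constant_coeff_0)
      fix x :: real assume x: "x > 0"
      have A: "(\<lambda>k. norm (g (k + m)) * y powi k) summable_on UNIV" if y: "y > 0" for m and y :: real
      proof -
        have "(\<lambda>k. norm (g k) * y powi k) summable_on UNIV" by (rule gs[OF y])
        hence "(\<lambda>k. norm (g (k + m)) * y powi (k + m)) summable_on UNIV"
          by (subst summable_on_reindex_bij_witness[of UNIV "\<lambda>k. k - m" "\<lambda>k. k + m" UNIV
             "\<lambda>k. norm (g k) * y powi k"]) auto
        hence "(\<lambda>k. norm (g (k + m)) * y powi (k + m) * y powi (- m)) summable_on UNIV"
          by (rule summable_on_cmult_left)
        thus ?thesis using y by (simp add: power_int_add mult.assoc flip: power_int_add)
      qed
      have "(\<lambda>k. norm p powi l * (norm (g (k + l)) * (norm p * x) powi k) + norm (g (k + (l - 1))) * x powi k)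
         summable_on UNIV"
        by (intro summable_on_add summable_on_cmult_right A) (use x p0 in auto)
      thus "(\<lambda>k. norm (e k) * x powi k) summable_on UNIV"
      proof (rule summable_on_comparison_test)
        fix k :: int
        have "norm (e k) \<le> norm (p powi (k + l) * g (k + l)) + norm (g (k + l - 1))"
          unfolding e_def by (rule norm_triangle_ineq4)
        hence "norm (e k) * x powi k \<le> (norm (p powi (k + l) * g (k + l)) + norm (g (k + l - 1))) * x powi k"
          using x by (intro mult_right_mono) auto
        also have "\<dots> = norm p powi l * (norm (g (k + l)) * (norm p * x) powi k) + norm (g (k + (l - 1))) * x powi k"
          using p0 by (simp add: norm_mult norm_power_int power_int_add power_int_mult_distrib algebra_simps)
        finally show "norm (e k) * x powi k \<le> \<dots>" .
      qed (use x in auto)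
    next
      fix w :: complex assume w: "w \<noteq> 0"
      have pw: "p * w \<noteq> 0" using w p0 by simp
      have "(\<lambda>k. g k * (p * w) powi k) summable_on UNIV" by (rule gsum[OF pw])
      hence s1: "(\<lambda>k. g (k + l) * (p * w) powi (k + l)) summable_on UNIV"
        by (subst summable_on_reindex_bij_witness[of UNIV "\<lambda>k. k - l" "\<lambda>k. k + l" UNIV
             "\<lambda>k. g k * (p * w) powi k"]) auto
      have "(\<lambda>k. g k * w powi k) summable_on UNIV" by (rule gsum[OF w])
      hence s2: "(\<lambda>k. g (k + (l - 1)) * w powi (k + (l - 1))) summable_on UNIV"
        by (subst summable_on_reindex_bij_witness[of UNIV "\<lambda>k. k - (l - 1)" "\<lambda>k. k + (l - 1)" UNIV
             "\<lambda>k. g k * w powi k"]) auto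
      have i1: "(\<Sum>\<^sub>\<infinity>k. g (k + l) * (p * w) powi (k + l)) = G (p * w)"
        using infsum_int_shift[of "\<lambda>k. g k * (p * w) powi k" l] geq[OF pw] by simp
      have i2: "(\<Sum>\<^sub>\<infinity>k. g (k + (l - 1)) * w powi (k + (l - 1))) = G w"
        using infsum_int_shift[of "\<lambda>k. g k * w powi k" "l - 1"] geq[OF w] by simp
      have "(\<Sum>\<^sub>\<infinity>k. g (k + l) * (p * w) powi (k + l) - w * (g (k + (l - 1)) * w powi (k + (l - 1))))
          = G (p * w) - w * G w"
        by (subst infsum_diff) (auto intro: s1 s2 summable_on_cmult_right simp: i1 i2 infsum_cmult_right')
      also have "(\<lambda>k. g (k + l) * (p * w) powi (k + l) - w * (g (k + (l - 1)) * w powi (k + (l - 1))))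
          = (\<lambda>k. w powi l * (e k * w powi k))"
        using w p0 by (auto simp: fun_eq_iff e_def power_int_add power_int_diff power_int_mult_distrib field_simps)
      also have "(\<Sum>\<^sub>\<infinity>k. w powi l * (e k * w powi k)) = w powi l * (\<Sum>\<^sub>\<infinity>k. e k * w powi k)"
        by (rule infsum_cmult_right')
      finally show "(\<Sum>\<^sub>\<infinity>k. e k * w powi k) = 0" using Gp[OF w] w by simp
    qed
    thus ?thesis by (simp add: e_def)
  qed
  have th: "theta_coeff p l * p powi l = theta_coeff p (l - 1)" for l
    using theta_coeff_add[OF p0, of l "-1"] by (simp add: theta_coeff_def tri_def)
  have gth: "g l = g 0 * theta_coeff p l" for l
  proof (induction l rule: int_induct[where k = 0])
    case (step1 i)
    have nz: "p powi (i + 1) \<noteq> 0" using p0 by simp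
    have "g (i + 1) = g i / p powi (i + 1)"
      using rec[of "i + 1"] nz by (simp add: field_simps)
    moreover have "theta_coeff p (i + 1) = theta_coeff p i / p powi (i + 1)"
      using th[of "i + 1"] nz by (simp add: field_simps)
    ultimately show ?case using step1 by simp
  next
    case (step2 i)
    thus ?case using rec[of i] th[of i] by (simp add: mult_ac)
  qed auto
  have Gth: "G w = g 0 * theta p w" if "w \<noteq> 0" for w
  proof -
    have "G w = (\<Sum>\<^sub>\<infinity>l. g 0 * (theta_coeff p l * w powi l))"
      by (subst geq[OF that, symmetric], subst gth) (simp add: mult.assoc)
    thus ?thesis unfolding theta_def by (simp add: infsum_cmult_right')
  qed
  have "G 1 \<noteq> 0"
  proof
    assume "G 1 = 0"
    then obtain y k where y: "y = 1 / p \<or> y = 1" and k: "y = - (p ^ k)"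
      using euler_zero[OF p] unfolding G_def by (metis div_by_1 mult_eq_0_iff)
    from p have "1 / norm p \<le> 1" by (subst divide_le_eq_1_pos) auto
    with y have "norm y \<le> 1" by (auto simp: norm_divide)
    hence "k = 0" unfolding k using p
      by (metis leD norm_minus_cancel norm_power not_gr_zero one_less_power)
    with k have "y = -1" by simp
    with y have "1 / p = -1" by auto
    hence "- p = 1" using p0 by (simp add: field_simps)
    hence "norm p = 1" by (metis norm_minus_cancel norm_one)
    with p show False by simp
  qed
  hence g0: "g 0 \<noteq> 0" using Gth[of 1] by auto
  show ?thesis
    by (rule that[of "1 / g 0"]) (use g0 Gth in \<open>auto simp: G_def\<close>)
qed

lemma powi_norm_eq_1_iff:
  fixes p :: "'a::real_normed_field"
  assumes "norm p > 1"
  shows "norm (p powi k) = 1 \<longleftrightarrow> k = 0"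
proof
  assume *: "norm (p powi k) = 1"
  show "k = 0"
  proof (rule ccontr)
    assume "k \<noteq> 0"
    then consider "k > 0" | "k < 0" by linarith
    thus False
    proof cases
      case 1
      hence "norm p powi k > 1" using assms by (intro one_less_power_int) auto
      thus False using * by (simp add: norm_power_int)
    next
      case 2
      hence "norm p powi (- k) > 1" using assms by (intro one_less_power_int) auto
      thus False using * by (simp add: norm_power_int power_int_minus)
    qed
  qed
qed auto

lemma minus_powi_neq_1:
  fixes p :: complex
  assumes "norm p > 1"
  shows "- (p powi k) \<noteq> 1"
proof
  assume *: "- (p powi k) = 1"
  hence "norm (p powi k) = 1" by (metis norm_minus_cancel norm_one)
  hence "k = 0" using assms by (simp add: powi_norm_eq_1_iff)
  with * show False by simp
qed

lemma theta_zero: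
  fixes p w :: complex
  assumes p: "norm p > 1" and w: "w \<noteq> 0" "theta p w = 0"
  shows "\<exists>k::int. w = - (p powi k)"
proof -
  have p0: "p \<noteq> 0" using p by auto
  obtain c where c: "c \<noteq> 0" "theta p w = c * (euler_fun p (w / p) * euler_fun p (1 / w))"
    using theta_triple_product[OF p] w by metis
  hence "euler_fun p (w / p) = 0 \<or> euler_fun p (1 / w) = 0" using w by simp
  then consider k :: nat where "w / p = - (p ^ k)" | k :: nat where "1 / w = - (p ^ k)"
    using euler_zero[OF p] by metis
  thus ?thesis
  proof cases
    case (1 k)
    hence "w = - (p powi (int (Suc k)))" using p0
      unfolding power_int_of_nat by (simp add: field_simps)
    thus ?thesis by blast
  next
    case (2 k)
    hence "w = 1 / (- (p ^ k))" using w(1) by (metis div_by_1 divide_divide_eq_right mult_1)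
    hence "w = - (p powi (- int k))"
      by (simp add: power_int_minus divide_inverse)
    thus ?thesis by blast
  qed
qed

lemma theta_minus_1: "norm (p::complex) > 1 \<Longrightarrow> theta p (-1) = 0"
  using theta_inverse[of p "-1"] by simp

lemma theta_minus_powi: "norm (p::complex) > 1 \<Longrightarrow> theta p (- (p powi k)) = 0"
  using theta_shift[of p "-1" k] theta_minus_1[of p] by simp

lemma theta_shift_eq_0_iff:
  assumes "norm (p::complex) > 1" "w \<noteq> 0"
  shows "theta p (p powi k * w) = 0 \<longleftrightarrow> theta p w = 0"
  using theta_shift[OF assms, of k] assms by auto

lemma theta_powi_nz: 
  assumes "norm (p::complex) > 1"
  shows "theta p (p powi k) \<noteq> 0"
proof
  assume "theta p (p powi k) = 0"
  hence "theta p 1 = 0" using theta_shift_eq_0_iff[OF assms, of 1 k] by simp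
  then obtain k where "1 = - (p powi k)" using theta_zero[OF assms, of 1] by fastforce
  thus False using minus_powi_neq_1[OF assms] by metis
qed

text \<open>In the triple product the factor that vanishes at a zero can be isolated explicitly: with
  x = v / p^k it is 1 + 1/x, which has a simple zero at x = -1.\<close>
lemma theta_zero_simple:
  fixes p w :: complex
  assumes p: "norm p > 1" and w: "w \<noteq> 0" "theta p w = 0"
  shows "\<exists>d. d \<noteq> 0 \<and> (theta p has_field_derivative d) (at w)"
proof -
  have p0: "p \<noteq> 0" using p by auto
  obtain k where k: "w = - (p powi k)" using theta_zero[OF assms] by blast
  obtain c where c: "c \<noteq> 0" "\<And>w. w \<noteq> 0 \<Longrightarrow> theta p w = c * (euler_fun p (w / p) * euler_fun p (1 / w))"
    using theta_triple_product[OF p] by metis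
  \<comment> \<open>M is the product without its vanishing factor.\<close>
  define M where "M = (\<lambda>v. p powi tri k * v powi k * (c * (euler_fun p (v / p) * euler_fun p (1 / v / p))))"
  have th: "theta p v = (1 + 1 / (v / p powi k)) * M (v / p powi k)" if "v \<noteq> 0" for v
  proof -
    define x where "x = v / p powi k"
    have x: "x \<noteq> 0" "v = p powi k * x" using that p0 by (auto simp: x_def)
    have "theta p v = p powi tri k * x powi k * theta p x"
      unfolding x(2) by (rule theta_shift[OF p x(1)])
    also have "theta p x = c * (euler_fun p (x / p) * ((1 + 1 / x) * euler_fun p (1 / x / p)))"
      using c(2)[OF x(1)] euler_fun_eq[OF p, of "1 / x"] by simp
    finally show ?thesis unfolding M_def x_def[symmetric] by (simp only: mult_ac)
  qed
  have holE: "euler_fun p field_differentiable at v" for v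
    using euler_holomorphic[OF p] by (simp add: holomorphic_on_def)
  have "M holomorphic_on - {0}"
    unfolding M_def
    by (intro holomorphic_intros holomorphic_on_compose_gen[OF _ euler_holomorphic[OF p], unfolded o_def])
       (use p0 in auto)
  hence "M field_differentiable at (-1)"
    by (rule holomorphic_on_imp_differentiable_at) auto
  then obtain M' where M': "(M has_field_derivative M') (at (-1))"
    by (auto simp: field_differentiable_def)
  have E: "euler_fun p (- 1 / p) \<noteq> 0"
  proof
    assume "euler_fun p (- 1 / p) = 0"
    then obtain n :: nat where "- 1 / p = - (p ^ n)" using euler_zero[OF p] by blast
    hence "p ^ Suc n = 1" using p0 by (simp add: field_simps)
    thus False using power_neq_1[OF p, of "Suc n"] by simp
  qed
  have M1: "M (-1) \<noteq> 0" unfolding M_def using c(1) p0 E by simp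
  have d1: "((\<lambda>x. (1 + 1 / x) * M x) has_field_derivative (- M (-1))) (at (-1))"
    by (rule derivative_eq_intros M' refl | simp)+
  have wk: "w / p powi k = -1" using k p0 by simp
  have d2: "((\<lambda>v. v / p powi k) has_field_derivative (1 / p powi k)) (at w)"
    by (rule DERIV_cdivide[OF DERIV_ident])
  have "((\<lambda>v. (1 + 1 / (v / p powi k)) * M (v / p powi k)) has_field_derivative
      (- M (-1)) * (1 / p powi k)) (at w)"
    using DERIV_chain2[of "\<lambda>x. (1 + 1 / x) * M x" "- M (-1)" "\<lambda>v. v / p powi k" w, unfolded wk, OF d1 d2] .
  hence "(theta p has_field_derivative (- M (-1)) * (1 / p powi k)) (at w)"
    by (rule has_field_derivative_transform_within_open[of _ _ _ "-{0}"]) (use w th in auto)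
  moreover have "(- M (-1)) * (1 / p powi k) \<noteq> 0" using M1 p0 by simp
  ultimately show ?thesis by blast
qed

lemma annulus_representative:
  fixes p w :: complex
  assumes p: "norm p > 1" and w: "w \<noteq> 0"
  obtains k :: int where "1 \<le> norm (w / p powi k)" "norm (w / p powi k) \<le> norm p"
proof -
  have p0: "p \<noteq> 0" using p by auto
  define k where "k = \<lfloor>log (norm p) (norm w)\<rfloor>"
  have powi: "norm p powi j = norm p powr (of_int j)" for j
    using p0 by (simp add: powr_real_of_int')
  have "norm p powr (of_int k) \<le> norm w" "norm w \<le> norm p powr (of_int (k + 1))"
    using p w floor_correct[of "log (norm p) (norm w)"] unfolding k_def
    by (auto simp: powr_le_iff le_powr_iff)
  hence "norm p powi k \<le> norm w" "norm w \<le> norm p powi (k + 1)" by (simp_all only: powi)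
  moreover have "norm p powi (k + 1) = norm p * norm p powi k" using p0 by (simp add: power_int_add)
  moreover have "norm p powi k > 0" using p0 by simp
  ultimately have "1 \<le> norm (w / p powi k)" "norm (w / p powi k) \<le> norm p"
    by (auto simp: norm_divide norm_power_int field_simps)
  thus ?thesis by (rule that)
qed

text \<open>Under w \<mapsto> p w both sides of the inequality are multiplied by the same factor, and the condition of
  being far from the zeros - p^l is preserved.  So it suffices to consider a compact part of one
  annulus, where theta has no zeros.\<close>
lemma theta_lower_bound:
  fixes p :: complex
  assumes p: "norm p > 1" and eps: "\<epsilon> > 0"
  shows "\<exists>c>0. \<forall>w. w \<noteq> 0 \<longrightarrow> (\<forall>l::int. norm (w + p powi l) \<ge> \<epsilon> * norm (p powi l)) \<longrightarrow>
           norm (theta p w) \<ge> c * theta (norm p) (norm w)"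
proof -
  have p0: "p \<noteq> 0" using p by auto
  define S where "S = {w. 1 \<le> norm w \<and> norm w \<le> norm p} \<inter> (\<Inter>l. {w. \<epsilon> * norm (p powi l) \<le> norm (w + p powi l)})"
  have nz: "theta p w \<noteq> 0" if "w \<in> S" for w
  proof
    assume "theta p w = 0"
    moreover have "w \<noteq> 0" using that by (auto simp: S_def)
    ultimately obtain k where "w = - (p powi k)" using theta_zero[OF p] by blast
    moreover have "\<epsilon> * norm (p powi k) \<le> norm (w + p powi k)" using that by (auto simp: S_def)
    ultimately show False using eps p0 by (simp add: mult_le_0_iff)
  qed
  have "compact S"
    unfolding S_def
  proof (rule compact_Int_closed)
    have "{w::complex. 1 \<le> norm w \<and> norm w \<le> norm p} = cball 0 (norm p) - ball 0 1" by auto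
    thus "compact {w::complex. 1 \<le> norm w \<and> norm w \<le> norm p}" by (simp add: compact_diff)
    show "closed (\<Inter>l. {w. \<epsilon> * norm (p powi l) \<le> norm (w + p powi l)})"
      by (intro closed_INT ballI closed_Collect_le continuous_intros)
  qed
  moreover have "continuous_on S (\<lambda>w. norm (theta p w))"
    by (intro continuous_intros holomorphic_on_imp_continuous_on
          holomorphic_on_subset[OF theta_holomorphic[OF p]]) (auto simp: S_def)
  ultimately have "\<exists>m>0. \<forall>w\<in>S. norm (theta p w) \<ge> m"
  proof (cases "S = {}")
    case False
    assume "compact S" "continuous_on S (\<lambda>w. norm (theta p w))"
    from continuous_attains_inf[OF this(1) False this(2)] obtain v where
      "v \<in> S" "\<forall>w\<in>S. norm (theta p v) \<le> norm (theta p w)" by blast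
    thus ?thesis using nz[of v] by (intro exI[of _ "norm (theta p v)"]) auto
  qed (auto intro: exI[of _ 1])
  then obtain m where m: "m > 0" "\<And>w. w \<in> S \<Longrightarrow> norm (theta p w) \<ge> m" by blast
  define C where "C = theta (norm p) 1 + theta (norm p) (norm p)"
  have C: "C > 0" unfolding C_def using theta_real_ge_1[OF p, of 1] theta_real_ge_1[OF p, of "norm p"] p
    by linarith
  show ?thesis
  proof (intro exI[of _ "m / C"] conjI allI impI)
    fix w assume w: "w \<noteq> 0" and far: "\<forall>l::int. norm (w + p powi l) \<ge> \<epsilon> * norm (p powi l)"
    obtain k where k: "1 \<le> norm (w / p powi k)" "norm (w / p powi k) \<le> norm p"
      using annulus_representative[OF p w] by blast
    define v where "v = w / p powi k"
    have v: "v \<noteq> 0" "w = p powi k * v" using w p0 by (auto simp: v_def)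
    have "\<epsilon> * norm (p powi l) \<le> norm (v + p powi l)" for l
    proof -
      have "\<epsilon> * norm (p powi (k + l)) \<le> norm (w + p powi (k + l))" using far by blast
      also have "w + p powi (k + l) = p powi k * (v + p powi l)"
        using p0 by (simp add: v(2) power_int_add algebra_simps)
      finally have "norm (p powi k) * (\<epsilon> * norm (p powi l)) \<le> norm (p powi k) * norm (v + p powi l)"
        using p0 by (simp add: norm_mult power_int_add mult_ac)
      thus ?thesis using p0 by simp
    qed
    hence "v \<in> S" using k unfolding S_def v_def by auto
    hence mv: "m \<le> norm (theta p v)" by (rule m)
    have Cv: "theta (norm p) (norm v) \<le> C"
      unfolding C_def using k p by (intro theta_real_le) (auto simp: v_def)
    define r where "r = norm p powi tri k * norm v powi k"
    have r: "r > 0" unfolding r_def using p0 v by simp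
    have "norm w = norm p powi k * norm v" unfolding v(2) by (simp add: norm_mult norm_power_int)
    hence e1: "theta (norm p) (norm w) = r * theta (norm p) (norm v)"
      using theta_shift[of "norm p" "norm v" k] p v by (simp add: r_def)
    have "theta p w = p powi tri k * v powi k * theta p v"
      unfolding v(2) by (rule theta_shift[OF p v(1)])
    hence e2: "norm (theta p w) = r * norm (theta p v)"
      unfolding r_def by (simp add: norm_mult norm_power_int)
    have "m / C * theta (norm p) (norm v) \<le> m / C * C"
      using Cv m(1) C by (intro mult_left_mono) auto
    also have "\<dots> = m" using C by simp
    also have "\<dots> \<le> norm (theta p v)" by (rule mv)
    finally have "r * (m / C * theta (norm p) (norm v)) \<le> r * norm (theta p v)"
      using r by (intro mult_left_mono) auto
    thus "m / C * theta (norm p) (norm w) \<le> norm (theta p w)"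
      unfolding e1 e2 by (simp only: mult_ac)
  qed (use m C in auto)
qed

section \<open>The q-Laplace transformation along a spiral\<close>

lemma has_sum_sum_family:
  fixes f :: "'i \<Rightarrow> 'b \<Rightarrow> 'a :: {topological_comm_monoid_add}"
  assumes "finite I" "\<And>i. i \<in> I \<Longrightarrow> (f i has_sum s i) A"
  shows "((\<lambda>x. \<Sum>i\<in>I. f i x) has_sum (\<Sum>i\<in>I. s i)) A"
  using assms by (induction I rule: finite_induct) (auto intro!: has_sum_add)

lemma has_sum_diff:
  fixes f g :: "'b \<Rightarrow> 'a :: real_normed_vector"
  assumes "(f has_sum a) A" "(g has_sum b) A"
  shows "((\<lambda>x. f x - g x) has_sum (a - b)) A"
  using has_sum_add[OF assms(1), of "\<lambda>x. - g x" "- b"] assms(2) by (simp add: has_sum_uminus)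

text \<open>The numerator of the q-Laplace transform of order 1 in base p along the spiral lam p^Z: if u l is
  the value of f at p^l lam, the transform at z is laplace_num p u w / theta p w with w = z / lam.\<close>
definition laplace_num :: "complex \<Rightarrow> (int \<Rightarrow> complex) \<Rightarrow> complex \<Rightarrow> complex" where
  "laplace_num p u w = (\<Sum>\<^sub>\<infinity>l. u l * theta_coeff p l * w powi l)"

text \<open>Boundedness of the values on the spiral towards 0 and growth of order 1 towards infinity; this is
  what makes the numerator converge for small w.\<close>
definition laplace_growth :: "complex \<Rightarrow> real \<Rightarrow> real \<Rightarrow> (int \<Rightarrow> complex) \<Rightarrow> bool" where
  "laplace_growth p C M u \<longleftrightarrow> C \<ge> 0 \<and> M \<ge> 1 \<and> (\<forall>l\<le>0. norm (u l) \<le> C) \<and>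
     (\<forall>n. norm (u (int n)) \<le> C * M ^ n * norm p ^ (n choose 2))"

lemma norm_theta_coeff_of_nat: 
  fixes p :: complex
  assumes "p \<noteq> 0"
  shows "norm (theta_coeff p (int n)) = 1 / (norm p ^ (n choose 2) * norm p ^ n)"
proof -
  have "tri (int n + 1) = int (n choose 2) + int n"
    using tri_add[of "int n" 1] by (simp add: tri_of_nat)
  hence "norm (theta_coeff p (int n)) = inverse (norm p powi (int (n choose 2) + int n))"
    unfolding theta_coeff_def norm_power_int by (simp only: power_int_minus)
  also have "\<dots> = 1 / (norm p ^ (n choose 2) * norm p ^ n)"
    using assms by (simp add: power_int_add divide_inverse)
  finally show ?thesis .
qed

lemma laplace_term_bound:
  assumes p: "norm p > 1" and g: "laplace_growth p C M u"
  shows "norm (u (int n) * theta_coeff p (int n)) \<le> C * M ^ n"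
proof -
  have p0: "p \<noteq> 0" using p by auto
  have "norm (u (int n) * theta_coeff p (int n)) \<le>
      (C * M ^ n * norm p ^ (n choose 2)) * (1 / (norm p ^ (n choose 2) * norm p ^ n))"
    unfolding norm_mult norm_theta_coeff_of_nat[OF p0]
    using g by (intro mult_right_mono) (auto simp: laplace_growth_def)
  also have "\<dots> = C * M ^ n * (1 / norm p ^ n)"
    using p0 by simp
  also have "\<dots> \<le> C * M ^ n * 1"
    using g p by (intro mult_left_mono) (auto simp: laplace_growth_def divide_le_eq)
  finally show ?thesis by simp
qed

lemma laplace_abs_summable:
  assumes p: "norm p > 1" and g: "laplace_growth p C M u" and x: "0 < x" "M * x < 1"
  shows "(\<lambda>l. norm (u l * theta_coeff p l) * x powi l) summable_on UNIV"
proof (rule summable_on_intI)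
  have p0: "p \<noteq> 0" using p by auto
  have M: "M \<ge> 1" "C \<ge> 0" using g by (auto simp: laplace_growth_def)
  have "summable (\<lambda>n. C * (M * x) ^ n)"
    using M x by (intro summable_mult summable_geometric) auto
  hence "(\<lambda>n. C * (M * x) ^ n) summable_on UNIV"
    using M x by (intro summable_nonneg_imp_summable_on) auto
  thus "(\<lambda>n. norm (u (int n) * theta_coeff p (int n)) * x powi int n) summable_on UNIV"
  proof (rule summable_on_comparison_test)
    fix n
    have "norm (u (int n) * theta_coeff p (int n)) * x ^ n \<le> C * M ^ n * x ^ n"
      using laplace_term_bound[OF p g] x by (intro mult_right_mono) auto
    thus "norm (u (int n) * theta_coeff p (int n)) * x powi int n \<le> C * (M * x) ^ n"
      by (simp add: power_mult_distrib mult.assoc)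
  qed (use x in auto)
  have "(\<lambda>l. theta_coeff (norm p) l * x powi l) summable_on UNIV"
    using p x by (intro theta_summable_real) auto
  hence "(\<lambda>n. C * (theta_coeff (norm p) (- 1 - int n) * x powi (- 1 - int n))) summable_on UNIV"
    by (intro summable_on_cmult_right summable_on_int_neg)
  thus "(\<lambda>n. norm (u (- 1 - int n) * theta_coeff p (- 1 - int n)) * x powi (- 1 - int n)) summable_on UNIV"
  proof (rule summable_on_comparison_test)
    fix n
    have "norm (u (- 1 - int n)) \<le> C" using g by (auto simp: laplace_growth_def)
    hence "norm (u (- 1 - int n)) * (theta_coeff (norm p) (- 1 - int n) * x powi (- 1 - int n)) \<le>
        C * (theta_coeff (norm p) (- 1 - int n) * x powi (- 1 - int n))"
      using p0 x theta_coeff_pos[of "norm p" "-1 - int n"]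
      by (intro mult_right_mono mult_nonneg_nonneg) (auto simp: less_imp_le)
    thus "norm (u (- 1 - int n) * theta_coeff p (- 1 - int n)) * x powi (- 1 - int n) \<le>
       C * (theta_coeff (norm p) (- 1 - int n) * x powi (- 1 - int n))"
      by (simp add: norm_mult norm_theta_coeff mult.assoc)
  qed (use x in auto)
qed

lemma laplace_has_sum:
  assumes p: "norm p > 1" and g: "laplace_growth p C M u" and w: "w \<noteq> 0" "M * norm w < 1"
  shows "((\<lambda>l. u l * theta_coeff p l * w powi l) has_sum laplace_num p u w) UNIV"
proof -
  have "(\<lambda>l. norm (u l * theta_coeff p l * w powi l)) summable_on UNIV"
    using laplace_abs_summable[OF p g, of "norm w"] w by (simp add: norm_mult norm_power_int)
  hence "(\<lambda>l. u l * theta_coeff p l * w powi l) summable_on UNIV"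
    by (rule abs_summable_summable)
  thus ?thesis unfolding laplace_num_def by (rule has_sum_infsum)
qed

lemma laplace_num_holomorphic:
  assumes p: "norm p > 1" and g: "laplace_growth p C M u"
  shows "laplace_num p u holomorphic_on ball 0 (1 / M) - {0}"
  unfolding laplace_num_def[abs_def]
proof (rule laurent_series_holomorphic)
  fix x assume x: "0 < x" "x < 1 / M"
  have "M \<ge> 1" using g by (auto simp: laplace_growth_def)
  hence "M * x < 1" using x by (simp add: field_simps)
  thus "(\<lambda>l. norm (u l * theta_coeff p l) * x powi l) summable_on UNIV"
    by (rule laplace_abs_summable[OF p g x(1)])
qed

lemma theta_has_sum:
  fixes p w :: complex
  assumes "norm p > 1" "w \<noteq> 0"
  shows "((\<lambda>l. theta_coeff p l * w powi l) has_sum theta p w) UNIV"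
  unfolding theta_def by (rule has_sum_infsum[OF theta_summable[OF assms]])

lemma theta_monomial_has_sum:
  fixes p w :: complex
  assumes p: "norm p > 1" and w: "w \<noteq> 0"
  shows "((\<lambda>l. p powi (l * int j) * (theta_coeff p l * w powi l)) has_sum
           (p ^ (j choose 2) * w ^ j * theta p w)) UNIV"
proof -
  have p0: "p \<noteq> 0" using p by auto
  have "((\<lambda>l. theta_coeff p l * (p powi int j * w) powi l) has_sum theta p (p powi int j * w)) UNIV"
    using p0 w by (intro theta_has_sum[OF p]) auto
  also have "theta p (p powi int j * w) = p ^ (j choose 2) * w ^ j * theta p w"
    unfolding theta_shift[OF p w] tri_of_nat by simp
  also have "(\<lambda>l. theta_coeff p l * (p powi int j * w) powi l) =
     (\<lambda>l. p powi (l * int j) * (theta_coeff p l * w powi l))"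
  proof
    fix l
    have "(p powi int j) powi l = p powi (l * int j)"
      by (metis mult.commute power_int_mult)
    thus "theta_coeff p l * (p powi int j * w) powi l = p powi (l * int j) * (theta_coeff p l * w powi l)"
      unfolding power_int_mult_distrib by simp
  qed
  finally show ?thesis .
qed

text \<open>The values of z^j f (p^e z) on the spiral are, up to a constant factor, p^(l j) u (l + e).  By the
  quasi-periodicity of theta, inserting them into the transform gives, up to constants, w^j times
  the transform of f at p^(j + e) w.  Thus the q-Laplace transformation takes the monomial operator
  z^j sigma^e, where sigma is z \<mapsto> p z, to p^(j choose 2) z^j sigma^(j + e).\<close>
lemma laplace_shift_has_sum:
  fixes p w :: complex
  assumes p: "norm p > 1" and g: "laplace_growth p C M u"
    and w: "w \<noteq> 0" "M * norm (p powi (int j + e) * w) < 1" and nz: "theta p w \<noteq> 0"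
  shows "((\<lambda>l. p powi (l * int j) * u (l + e) * (theta_coeff p l * w powi l)) has_sum
     (p ^ (j choose 2) * w ^ j * (laplace_num p u (p powi (int j + e) * w) / theta p (p powi (int j + e) * w))
        * theta p w)) UNIV"
proof -
  have p0: "p \<noteq> 0" using p by auto
  define x where "x = p powi (int j + e) * w"
  have x: "x \<noteq> 0" using p0 w by (simp add: x_def)
  define K where "K = p powi (- (e * int j)) * theta_coeff p (- e) * w powi (- e)"
  have "((\<lambda>l. K * (u l * theta_coeff p l * x powi l)) has_sum (K * laplace_num p u x)) UNIV"
    using w by (intro has_sum_cmult_right laplace_has_sum[OF p g x]) (simp add: x_def)
  also have "(\<lambda>l. K * (u l * theta_coeff p l * x powi l)) =
      (\<lambda>l. p powi ((l - e) * int j) * u l * (theta_coeff p (l - e) * w powi (l - e)))"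
  proof
    fix l
    have 1: "theta_coeff p (l - e) = theta_coeff p l * theta_coeff p (- e) * p powi (l * e)"
      using theta_coeff_add[OF p0, of l "-e"] by simp
    have "(int j + e) * l = int j * l + l * e" by (simp add: algebra_simps)
    hence 2: "x powi l = p powi (int j * l) * p powi (l * e) * w powi l"
      unfolding x_def power_int_mult_distrib power_int_mult[symmetric]
      by (simp only: power_int_add[OF disjI1[OF p0]])
    have 3: "w powi (l - e) = w powi l * w powi (- e)"
      using power_int_add[OF disjI1[OF w(1)], of l "- e"] by simp
    have "(l - e) * int j = int j * l + (- (e * int j))" by (simp add: algebra_simps)
    hence 4: "p powi ((l - e) * int j) = p powi (int j * l) * p powi (- (e * int j))"
      by (simp only: power_int_add[OF disjI1[OF p0]])
    show "K * (u l * theta_coeff p l * x powi l) =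
       p powi ((l - e) * int j) * u l * (theta_coeff p (l - e) * w powi (l - e))"
      unfolding 1 2 3 4 K_def by (simp only: mult_ac)
  qed
  finally have "((\<lambda>l. p powi ((l - e) * int j) * u l * (theta_coeff p (l - e) * w powi (l - e))) has_sum (K * laplace_num p u x)) UNIV" .
  hence "((\<lambda>l. p powi (l * int j) * u (l + e) * (theta_coeff p l * w powi l)) has_sum (K * laplace_num p u x)) UNIV"
    by (subst has_sum_reindex_bij_witness[of UNIV "\<lambda>l. l - e" "\<lambda>l. l + e" UNIV]) auto
  moreover have "K * laplace_num p u x = p ^ (j choose 2) * w ^ j * (laplace_num p u x / theta p x) * theta p w"
  proof -
    have tx: "theta p x = p powi tri (int j + e) * w powi (int j + e) * theta p w"
      unfolding x_def by (rule theta_shift[OF p w(1)])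
    have nz': "theta p x \<noteq> 0" unfolding tx using nz p0 w by simp
    have "- tri (1 - e) = - tri e" using tri_minus[of "- e"] by (simp add: tri_minus[of "e - 1", simplified])
    hence "- (e * int j) + (- tri (1 - e)) + tri (int j + e) = int (j choose 2)"
      using tri_add[of "int j" e] by (simp add: tri_of_nat mult.commute)
    hence e1: "p powi (- (e * int j)) * theta_coeff p (- e) * p powi tri (int j + e) = p ^ (j choose 2)"
      unfolding theta_coeff_def using p0 by (metis add.commute power_int_add power_int_of_nat uminus_add_conv_diff)
    have e2: "w powi (- e) * w powi (int j + e) = w ^ j"
      using w(1) by (simp flip: power_int_add)
    have "K * theta p x = (p powi (- (e * int j)) * theta_coeff p (- e) * p powi tri (int j + e)) *
       (w powi (- e) * w powi (int j + e)) * theta p w"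
      unfolding K_def tx by (simp only: mult_ac)
    also have "\<dots> = p ^ (j choose 2) * w ^ j * theta p w" unfolding e1 e2 ..
    finally have "K * theta p x = p ^ (j choose 2) * w ^ j * theta p w" .
    hence "K = p ^ (j choose 2) * w ^ j * theta p w / theta p x" using nz' by (simp add: field_simps)
    thus ?thesis by simp
  qed
  ultimately show ?thesis unfolding x_def by simp
qed

text \<open>The previous lemma applied to every monomial of a q-difference equation.  The equation is needed
  on the spiral only.\<close>
lemma laplace_equation:
  fixes p lam z :: complex and I :: "'i set"
  assumes p: "norm p > 1" and g: "laplace_growth p C M u" and lam: "lam \<noteq> 0"
    and fin: "finite I"
    and eq: "\<And>l. (\<Sum>i\<in>I. cf i * (p powi l * lam) ^ dg i * u (l + ex i)) =
                   (\<Sum>j\<le>d. b j * (p powi l * lam) ^ j)"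
    and z: "z \<noteq> 0" "theta p (z / lam) \<noteq> 0"
    and small: "\<And>i. i \<in> I \<Longrightarrow> M * norm (p powi (int (dg i) + ex i) * (z / lam)) < 1"
  defines "f \<equiv> \<lambda>z. laplace_num p u (z / lam) / theta p (z / lam)"
  shows "(\<Sum>i\<in>I. cf i * p ^ (dg i choose 2) * z ^ dg i * f (p powi (int (dg i) + ex i) * z)) =
         (\<Sum>j\<le>d. b j * p ^ (j choose 2) * z ^ j)"
proof -
  define w where "w = z / lam"
  have w: "w \<noteq> 0" "z = lam * w" using z lam by (auto simp: w_def)
  have pl: "(p powi l * lam) ^ j = lam ^ j * p powi (l * int j)" for l j
    by (simp add: power_mult_distrib power_int_mult mult.commute)
  have f: "f (p powi k * z) = laplace_num p u (p powi k * w) / theta p (p powi k * w)" for k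
    unfolding f_def w_def by simp
  have "((\<lambda>l. (cf i * lam ^ dg i) * (p powi (l * int (dg i)) * u (l + ex i) * (theta_coeff p l * w powi l)))
      has_sum ((cf i * lam ^ dg i) * (p ^ (dg i choose 2) * w ^ dg i * f (p powi (int (dg i) + ex i) * z)
        * theta p w))) UNIV" if "i \<in> I" for i
    unfolding f using small[OF that] z(2)
    by (intro has_sum_cmult_right laplace_shift_has_sum[OF p g w(1)]) (auto simp: w_def)
  hence 1: "((\<lambda>l. \<Sum>i\<in>I. (cf i * lam ^ dg i) * (p powi (l * int (dg i)) * u (l + ex i) * (theta_coeff p l * w powi l)))
      has_sum (\<Sum>i\<in>I. (cf i * lam ^ dg i) * (p ^ (dg i choose 2) * w ^ dg i * f (p powi (int (dg i) + ex i) * z)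
        * theta p w))) UNIV"
    by (rule has_sum_sum_family[OF fin])
  have 2: "((\<lambda>l. \<Sum>j\<le>d. (b j * lam ^ j) * (p powi (l * int j) * (theta_coeff p l * w powi l)))
      has_sum (\<Sum>j\<le>d. (b j * lam ^ j) * (p ^ (j choose 2) * w ^ j * theta p w))) UNIV"
    by (intro has_sum_sum_family finite_atMost has_sum_cmult_right theta_monomial_has_sum p w(1))
  have "(\<Sum>i\<in>I. (cf i * lam ^ dg i) * (p powi (l * int (dg i)) * u (l + ex i) * (theta_coeff p l * w powi l)))
     = (\<Sum>j\<le>d. (b j * lam ^ j) * (p powi (l * int j) * (theta_coeff p l * w powi l)))" for l
  proof -
    have "(\<Sum>i\<in>I. (cf i * lam ^ dg i) * (p powi (l * int (dg i)) * u (l + ex i) * (theta_coeff p l * w powi l)))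
      = (\<Sum>i\<in>I. cf i * (p powi l * lam) ^ dg i * u (l + ex i)) * (theta_coeff p l * w powi l)"
      unfolding sum_distrib_right pl by (intro sum.cong refl) (simp only: mult_ac)
    also have "\<dots> = (\<Sum>j\<le>d. (b j * lam ^ j) * (p powi (l * int j) * (theta_coeff p l * w powi l)))"
      unfolding eq unfolding sum_distrib_right pl by (intro sum.cong refl) (simp only: mult_ac)
    finally show ?thesis .
  qed
  with has_sum_unique[OF 1] 2 have
    "(\<Sum>i\<in>I. (cf i * lam ^ dg i) * (p ^ (dg i choose 2) * w ^ dg i * f (p powi (int (dg i) + ex i) * z) * theta p w))
     = (\<Sum>j\<le>d. (b j * lam ^ j) * (p ^ (j choose 2) * w ^ j * theta p w))" by simp
  hence "(\<Sum>i\<in>I. cf i * p ^ (dg i choose 2) * z ^ dg i * f (p powi (int (dg i) + ex i) * z)) * theta p w =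
         (\<Sum>j\<le>d. b j * p ^ (j choose 2) * z ^ j) * theta p w"
    unfolding sum_distrib_right by (simp add: w(2) power_mult_distrib mult_ac)
  thus ?thesis using z(2) by (simp add: w_def)
qed

text \<open>Termwise, a monomial x^i goes to p^(i choose 2) w^i, so a Taylor remainder of order k on the
  spiral goes to a remainder whose Gevrey exponent s is raised by 1.  The remainder estimate of u is
  available only for l \<le> -N.  For -N < l < 0 both u and the partial sum are bounded and the factor
  (p^N)^k compensates the missing decay.  For l \<ge> 0 the values u l contribute at most the constant
  2 * C, which is absorbed because p^(k choose 2) |w|^k theta |w| \<ge> 1 for every k.\<close>
lemma laplace_asymptotic:
  fixes p :: complex and c :: "nat \<Rightarrow> complex"
  assumes p: "norm p > 1" and g: "laplace_growth p C M u" and L: "L \<ge> 0"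
    and as: "\<And>k l. l \<le> - int N \<Longrightarrow> norm (u l - (\<Sum>i<k. c i * p powi (l * int i))) \<le>
              L * M ^ k * norm p ^ (s * (k choose 2)) * norm p powi (l * int k)"
    and c: "\<And>i. norm (c i) \<le> L * M ^ i * norm p ^ (s * (i choose 2))"
    and w: "w \<noteq> 0" "M * norm w \<le> 1 / 2"
  shows "norm (laplace_num p u w - theta p w * (\<Sum>i<k. c i * p ^ (i choose 2) * w ^ i)) \<le>
    (L + 3 * C) * (2 * M * norm p ^ N) ^ k * norm p ^ (Suc s * (k choose 2)) * norm w ^ k
      * theta (norm p) (norm w)"
proof -
  have p0: "p \<noteq> 0" using p by auto
  define P where "P = norm p"
  have P: "P > 1" using p by (simp add: P_def)
  have M: "M \<ge> 1" and C: "C \<ge> 0" using g by (auto simp: laplace_growth_def)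
  have MP: "M \<le> 2 * M * P ^ N" "2 * M \<le> 2 * M * P ^ N"
  proof -
    have "2 * M * 1 \<le> 2 * M * P ^ N"
      using M P by (intro mult_left_mono) (auto simp: one_le_power)
    thus "2 * M \<le> 2 * M * P ^ N" by simp
    thus "M \<le> 2 * M * P ^ N" using M by linarith
  qed
  define B where "B = (L + C) * (2 * M * P ^ N) ^ k * P ^ (s * (k choose 2))"
  define R where "R = (\<lambda>l. u l - (\<Sum>i<k. c i * p powi (l * int i)))"
  \<comment> \<open>Majorant of the terms u l with l \<ge> 0, about which the expansion says nothing.\<close>
  define D where "D = (\<lambda>l. if l \<ge> 0 then C * (M * norm w) ^ nat l else 0)"
  have sum_c: "(\<Sum>i<k. norm (c i)) \<le> L * (2 * M) ^ k * P ^ (s * (k choose 2))"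
  proof -
    have "(\<Sum>i<k. norm (c i)) \<le> (\<Sum>i<k. L * M ^ k * P ^ (s * (k choose 2)))"
    proof (rule sum_mono)
      fix i assume i: "i \<in> {..<k}"
      have "(i choose 2) \<le> (k choose 2)" using i by (intro binomial_right_mono) auto
      hence "L * M ^ i * P ^ (s * (i choose 2)) \<le> L * M ^ k * P ^ (s * (k choose 2))"
        using i M P L by (intro mult_mono power_increasing mult_left_mono) auto
      thus "norm (c i) \<le> L * M ^ k * P ^ (s * (k choose 2))" using c[of i] unfolding P_def by linarith
    qed
    also have "\<dots> = real k * (L * M ^ k * P ^ (s * (k choose 2)))" by simp
    also have "\<dots> \<le> 2 ^ k * (L * M ^ k * P ^ (s * (k choose 2)))"
      using M P L of_nat_less_two_power[of k, where 'a = real] by (intro mult_right_mono) auto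
    finally show ?thesis by (simp add: power_mult_distrib mult_ac)
  qed
  have B0: "B \<ge> 0" unfolding B_def using L C M P by simp
  have ge1: "P ^ (s * (k choose 2)) \<ge> 1" "(2 * M) ^ k \<ge> 1" "(P ^ N) ^ k \<ge> 1"
    using P M one_le_power[of P] one_le_power[of "2 * M" k] one_le_power[of "P ^ N" k]
    by (simp_all add: one_le_power)
  have tail: "norm (\<Sum>i<k. c i * p powi (l * int i)) \<le> L * (2 * M) ^ k * P ^ (s * (k choose 2)) * X"
    if X: "\<And>i. i < k \<Longrightarrow> P powi (l * int i) \<le> X" "X \<ge> 0" for l X
  proof -
    have "norm (\<Sum>i<k. c i * p powi (l * int i)) \<le> (\<Sum>i<k. norm (c i) * X)"
      by (rule sum_norm_le)
         (use X in \<open>auto simp: norm_mult norm_power_int P_def intro!: mult_left_mono\<close>)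
    also have "\<dots> = (\<Sum>i<k. norm (c i)) * X" by (simp add: sum_distrib_right)
    also have "\<dots> \<le> L * (2 * M) ^ k * P ^ (s * (k choose 2)) * X"
      using sum_c X(2) by (rule mult_right_mono)
    finally show ?thesis .
  qed
  have D0: "D l \<ge> 0" for l unfolding D_def using C M by simp
  have Rbound: "norm (R l) * (norm (theta_coeff p l) * norm w powi l) \<le>
      B * (P powi (l * int k) * (theta_coeff P l * norm w powi l)) + D l" for l
  proof -
    have tpos: "norm (theta_coeff p l) * norm w powi l \<ge> 0" by simp
    consider "l \<le> - int N" | "l > - int N" "l < 0" | "l \<ge> 0" by linarith
    thus ?thesis
    proof cases
      case 1
      have "norm (R l) \<le> L * M ^ k * P ^ (s * (k choose 2)) * P powi (l * int k)"
        using as[OF 1, of k] by (simp add: R_def P_def)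
      also have "\<dots> \<le> B * P powi (l * int k)"
      proof -
        have "L * M ^ k \<le> (L + C) * (2 * M * P ^ N) ^ k"
          by (rule mult_mono[OF _ power_mono[OF MP(1)]]) (use L C M in auto)
        thus ?thesis unfolding B_def using P by (intro mult_right_mono) auto
      qed
      finally have "norm (R l) \<le> B * P powi (l * int k)" .
      from mult_right_mono[OF this tpos] D0[of l] show ?thesis
        by (simp add: norm_theta_coeff P_def mult_ac)
    next
      case 2
      have X: "1 \<le> P ^ (N * k) * P powi (l * int k)"
      proof -
        have "P ^ (N * k) * P powi (l * int k) = P powi (int (N * k) + l * int k)"
          using P by (simp only: power_int_of_nat[symmetric]) (simp add: power_int_add)
        also have "int (N * k) + l * int k = (int N + l) * int k" by (simp add: distrib_right)
        also have "P powi ((int N + l) * int k) \<ge> 1" using P 2 by (intro one_le_power_int) auto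
        finally show ?thesis .
      qed
      have "norm (R l) \<le> norm (u l) + norm (\<Sum>i<k. c i * p powi (l * int i))"
        unfolding R_def by (rule norm_triangle_ineq4)
      also have "norm (u l) \<le> C" using g 2 by (auto simp: laplace_growth_def)
      also have "norm (\<Sum>i<k. c i * p powi (l * int i)) \<le> L * (2 * M) ^ k * P ^ (s * (k choose 2)) * 1"
      proof (rule tail)
        fix i
        have "P powi (l * int i) \<le> P powi 0"
          using P 2 by (intro power_int_increasing) (auto simp: mult_nonpos_nonneg)
        thus "P powi (l * int i) \<le> 1" by simp
      qed auto
      also have "C \<le> C * (2 * M) ^ k * P ^ (s * (k choose 2)) * 1"
      proof -
        have "1 * 1 \<le> (2 * M) ^ k * P ^ (s * (k choose 2))"
          using ge1 by (intro mult_mono) auto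
        from mult_left_mono[OF this C] show ?thesis by (simp only: mult.assoc mult_1_right)
      qed
      finally have "norm (R l) \<le> (L + C) * (2 * M) ^ k * P ^ (s * (k choose 2)) * 1"
        by (simp add: distrib_right)
      also have "\<dots> \<le> (L + C) * (2 * M) ^ k * P ^ (s * (k choose 2)) * (P ^ (N * k) * P powi (l * int k))"
        using X L C M P by (intro mult_left_mono) auto
      also have "\<dots> = B * P powi (l * int k)"
        unfolding B_def by (simp add: power_mult_distrib power_mult mult_ac)
      finally have "norm (R l) \<le> B * P powi (l * int k)" .
      from mult_right_mono[OF this tpos] D0[of l] show ?thesis
        by (simp add: norm_theta_coeff P_def mult_ac)
    next
      case 3
      then obtain n where n: "l = int n" by (metis nonneg_int_cases)
      have "norm (R l) \<le> norm (u l) + norm (\<Sum>i<k. c i * p powi (l * int i))"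
        unfolding R_def by (rule norm_triangle_ineq4)
      also have "norm (\<Sum>i<k. c i * p powi (l * int i)) \<le> L * (2 * M) ^ k * P ^ (s * (k choose 2)) * P powi (l * int k)"
        by (rule tail) (use P 3 in \<open>auto intro!: power_int_increasing intro: mult_left_mono\<close>)
      also have "\<dots> \<le> B * P powi (l * int k)"
      proof -
        have "L * (2 * M) ^ k \<le> (L + C) * (2 * M * P ^ N) ^ k"
          by (rule mult_mono[OF _ power_mono[OF MP(2)]]) (use L C M in auto)
        thus ?thesis unfolding B_def using P by (intro mult_right_mono) auto
      qed
      finally have "norm (R l) \<le> B * P powi (l * int k) + norm (u l)" by simp
      from mult_right_mono[OF this tpos] have
        "norm (R l) * (norm (theta_coeff p l) * norm w powi l) \<le>
          B * (P powi (l * int k) * (theta_coeff P l * norm w powi l)) + norm (u l * theta_coeff p l) * norm w ^ n"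
        by (simp add: norm_theta_coeff P_def distrib_right distrib_left norm_mult n mult_ac)
      also have "norm (u l * theta_coeff p l) * norm w ^ n \<le> (C * M ^ n) * norm w ^ n"
        unfolding n using laplace_term_bound[OF p g] by (intro mult_right_mono) auto
      also have "(C * M ^ n) * norm w ^ n = D l" by (simp add: D_def n power_mult_distrib)
      finally show ?thesis by simp
    qed
  qed
  have Mw: "norm (M * norm w) < 1" using w M by auto
  have Dsum: "(D has_sum (C * (1 / (1 - M * norm w)) + 0)) UNIV"
  proof (rule has_sum_intI)
    have "(\<lambda>n. C * (M * norm w) ^ n) sums (C * (1 / (1 - M * norm w)))"
      by (intro sums_mult geometric_sums Mw)
    hence "((\<lambda>n. C * (M * norm w) ^ n) has_sum (C * (1 / (1 - M * norm w)))) UNIV"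
      using C M by (intro sums_nonneg_imp_has_sum) auto
    thus "((\<lambda>n. D (int n)) has_sum (C * (1 / (1 - M * norm w)))) UNIV" by (simp add: D_def)
    show "((\<lambda>n. D (- 1 - int n)) has_sum 0) UNIV" by (simp add: D_def)
  qed
  have "C * (1 / (1 - M * norm w)) \<le> C * 2"
    using w C by (intro mult_left_mono) (auto simp: divide_le_eq)
  define T where "T = P ^ (k choose 2) * norm w ^ k * theta P (norm w)"
  have Tsum: "((\<lambda>l. P powi (l * int k) * (theta_coeff P l * norm w powi l)) has_sum T) UNIV"
  proof -
    define y where "y = P powi int k * norm w"
    have y: "y > 0" using P w by (simp add: y_def)
    have 1: "((\<lambda>l. theta_coeff P l * y powi l) has_sum theta P y) UNIV"
      unfolding theta_def by (rule has_sum_infsum[OF theta_summable_real[OF P y]])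
    have 2: "theta P y = T"
      unfolding y_def using theta_shift[of P "norm w" "int k"] P w by (simp add: T_def tri_of_nat)
    have 3: "theta_coeff P l * y powi l = P powi (l * int k) * (theta_coeff P l * norm w powi l)" for l
    proof -
      have "(P powi int k) powi l = P powi (l * int k)"
        by (metis mult.commute power_int_mult)
      thus ?thesis unfolding y_def power_int_mult_distrib by simp
    qed
    show ?thesis using 1 unfolding 2 3 .
  qed
  have T1: "T \<ge> 1"
  proof -
    have 1: "theta P (norm w) \<ge> theta_coeff P (- int k) * norm w powi (- int k)"
      by (rule theta_real_ge_term) (use P w in auto)
    have "tri (- int k + 1) = tri (int k)" using tri_minus[of "int k - 1"] by simp
    hence 2: "theta_coeff P (- int k) = inverse (P ^ (k choose 2))"
      unfolding theta_coeff_def by (simp add: tri_of_nat power_int_minus)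
    have "inverse (P ^ (k choose 2)) * inverse (norm w ^ k) \<le> theta P (norm w)"
      using 1 unfolding 2 power_int_minus power_int_of_nat .
    hence "inverse (P ^ (k choose 2) * norm w ^ k) \<le> theta P (norm w)"
      by (simp only: inverse_mult_distrib)
    hence "P ^ (k choose 2) * norm w ^ k * inverse (P ^ (k choose 2) * norm w ^ k) \<le> T"
      unfolding T_def using P by (intro mult_left_mono) auto
    moreover have "P ^ (k choose 2) * norm w ^ k \<noteq> 0" using P w by simp
    ultimately show ?thesis by (metis right_inverse)
  qed
  have m1: "((\<lambda>l. \<Sum>i<k. c i * (p powi (l * int i) * (theta_coeff p l * w powi l))) has_sum
      (\<Sum>i<k. c i * (p ^ (i choose 2) * w ^ i * theta p w))) UNIV"
    by (rule has_sum_sum_family[OF finite_lessThan], rule has_sum_cmult_right, rule theta_monomial_has_sum[OF p w(1)])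
  have m2: "((\<lambda>l. u l * theta_coeff p l * w powi l) has_sum laplace_num p u w) UNIV"
    using w by (intro laplace_has_sum[OF p g]) auto
  have m3: "u l * theta_coeff p l * w powi l - (\<Sum>i<k. c i * (p powi (l * int i) * (theta_coeff p l * w powi l)))
     = R l * (theta_coeff p l * w powi l)" for l
    unfolding R_def left_diff_distrib sum_distrib_right by (simp only: mult.assoc)
  have m4: "(\<Sum>i<k. c i * (p ^ (i choose 2) * w ^ i * theta p w)) = theta p w * (\<Sum>i<k. c i * p ^ (i choose 2) * w ^ i)"
    unfolding sum_distrib_left by (intro sum.cong refl) (simp only: mult_ac)
  have main: "((\<lambda>l. R l * (theta_coeff p l * w powi l)) has_sum
      (laplace_num p u w - theta p w * (\<Sum>i<k. c i * p ^ (i choose 2) * w ^ i))) UNIV"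
    using has_sum_diff[OF m2 m1] unfolding m3 m4 .
  have 1: "norm (laplace_num p u w - theta p w * (\<Sum>i<k. c i * p ^ (i choose 2) * w ^ i)) \<le>
      B * T + (C * (1 / (1 - M * norm w)) + 0)"
  proof (rule norm_infsum_le)
    show "((\<lambda>l. R l * (theta_coeff p l * w powi l)) has_sum
      (laplace_num p u w - theta p w * (\<Sum>i<k. c i * p ^ (i choose 2) * w ^ i))) UNIV"
      by (rule main)
    show "((\<lambda>l. B * (P powi (l * int k) * (theta_coeff P l * norm w powi l)) + D l) has_sum
        (B * T + (C * (1 / (1 - M * norm w)) + 0))) UNIV"
      by (intro has_sum_add has_sum_cmult_right Tsum Dsum)
    fix l
    show "norm (R l * (theta_coeff p l * w powi l)) \<le> B * (P powi (l * int k) * (theta_coeff P l * norm w powi l)) + D l"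
      using Rbound[of l] by (simp add: norm_mult norm_power_int)
  qed
  define Q where "Q = (2 * M * P ^ N) ^ k * P ^ (s * (k choose 2))"
  have "1 * 1 \<le> (2 * M) ^ k * (P ^ N) ^ k"
    using ge1 by (intro mult_mono) auto
  hence "1 \<le> (2 * M * P ^ N) ^ k" by (simp add: power_mult_distrib)
  hence "1 * 1 \<le> Q" unfolding Q_def
    using ge1(1) by (intro mult_mono) auto
  hence "1 * 1 \<le> Q * T"
    using T1 by (intro mult_mono) auto
  hence "C * 2 * 1 \<le> C * 2 * (Q * T)"
    using C by (intro mult_left_mono) auto
  with 1 \<open>C * (1 / (1 - M * norm w)) \<le> C * 2\<close>
  have 2: "norm (laplace_num p u w - theta p w * (\<Sum>i<k. c i * p ^ (i choose 2) * w ^ i)) \<le>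
      B * T + C * 2 * (Q * T)" by linarith
  have "B = (L + C) * Q" by (simp add: B_def Q_def)
  hence 3: "B * T + C * 2 * (Q * T) = (L + 3 * C) * (Q * T)" by (simp add: algebra_simps)
  have 4: "Q * T = (2 * M * norm p ^ N) ^ k * norm p ^ (Suc s * (k choose 2)) * norm w ^ k * theta (norm p) (norm w)"
    unfolding Q_def T_def P_def by (simp add: power_add)
  show ?thesis using 2 unfolding 3 unfolding 4 by (simp only: mult.assoc)
qed

section \<open>Continuation and growth of solutions of q-difference equations\<close>

definition spirals :: "complex \<Rightarrow> complex set \<Rightarrow> complex set" where
  "spirals p R = {p powi k * s | k s. s \<in> R}"

lemma spirals_self: "R \<subseteq> spirals p R"
proof
  fix s assume "s \<in> R"
  thus "s \<in> spirals p R" unfolding spirals_def by (intro CollectI exI[of _ 0] exI[of _ s]) auto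
qed

lemma spirals_powi:
  assumes "p \<noteq> 0"
  shows "p powi j * z \<in> spirals p R \<longleftrightarrow> z \<in> spirals p R"
proof -
  have *: "p powi i * y \<in> spirals p R" if y: "y \<in> spirals p R" for i y
  proof -
    obtain k s where "y = p powi k * s" "s \<in> R" using y by (auto simp: spirals_def)
    hence "p powi i * y = p powi (i + k) * s" using assms by (simp add: power_int_add)
    thus ?thesis using \<open>s \<in> R\<close> unfolding spirals_def by blast
  qed
  have "p powi (- j) * (p powi j * z) = z"
    using assms by (simp add: power_int_minus mult.assoc[symmetric])
  thus ?thesis using *[of z j] *[of "p powi j * z" "- j"] by metis
qed

lemma spirals_divide:
  assumes "p \<noteq> 0"
  shows "z / p ^ d \<in> spirals p R \<longleftrightarrow> z \<in> spirals p R"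
  using spirals_powi[OF assms, of "- int d" z R] by (simp add: power_int_minus divide_inverse mult.commute)

lemma spirals_nonzero: "p \<noteq> 0 \<Longrightarrow> 0 \<notin> R \<Longrightarrow> 0 \<notin> spirals p R"
  by (auto simp: spirals_def)

text \<open>Up to a rotation and dilation, a spiral is contained in the zero set of theta, which is a
  holomorphic function on the punctured plane that is not identically zero.\<close>
lemma spirals_sparse_single:
  assumes p: "norm p > 1" and s: "s \<noteq> 0"
  shows "spirals p {s} sparse_in - {0}"
proof -
  define f where "f = (\<lambda>z. theta p (- z / s))"
  have hol: "f holomorphic_on - {0}"
    unfolding f_def
    by (rule holomorphic_on_compose_gen[OF _ theta_holomorphic[OF p], unfolded o_def])
       (use s in \<open>auto intro!: holomorphic_intros\<close>)
  hence "f meromorphic_on - {0}"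
    by (intro analytic_on_imp_meromorphic_on) (subst analytic_on_open, auto)
  hence "(\<forall>\<^sub>\<approx>z\<in>-{0}. f z = 0) \<or> (\<forall>\<^sub>\<approx>z\<in>-{0}. f z \<noteq> 0)"
    by (rule meromorphic_imp_constant_or_avoid) (auto simp: connected_punctured_universe)
  moreover have "\<not> (\<forall>\<^sub>\<approx>z\<in>-{0}. f z = 0)"
  proof
    assume "\<forall>\<^sub>\<approx>z\<in>-{0}. f z = 0"
    hence ev: "eventually (\<lambda>z. f z = 0) (at (- s))"
      using eventually_cosparse_imp_eventually_at[of "\<lambda>z. f z = 0" "-{0}" "-s" UNIV] s by simp
    have "isCont f (- s)"
      by (rule continuous_on_eq_continuous_at[THEN iffD1, rule_format,
             OF _ holomorphic_on_imp_continuous_on[OF hol]]) (use s in auto)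
    hence "(f \<longlongrightarrow> f (- s)) (at (- s))" by (simp add: isCont_def)
    moreover have "f (- s) \<noteq> 0" using theta_powi_nz[OF p, of 0] s by (simp add: f_def)
    ultimately have "eventually (\<lambda>z. f z \<noteq> 0) (at (- s))"
      by (rule tendsto_imp_eventually_ne)
    with ev have "eventually (\<lambda>z. False) (at (- s))" by eventually_elim auto
    thus False by (simp add: trivial_limit_def[symmetric])
  qed
  ultimately have "\<forall>\<^sub>\<approx>z\<in>-{0}. f z \<noteq> 0" by blast
  hence "{z. f z = 0} sparse_in - {0}" by (simp add: eventually_cosparse)
  moreover have "spirals p {s} \<subseteq> {z. f z = 0}"
    using theta_minus_powi[OF p] s by (auto simp: spirals_def f_def)
  ultimately show ?thesis by (meson sparse_in_subset2)
qed

lemma spirals_sparse: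
  assumes p: "norm p > 1" and R: "finite R" "0 \<notin> R"
  shows "spirals p R sparse_in - {0}"
proof -
  have "spirals p R = (\<Union>s\<in>R. spirals p {s})" by (auto simp: spirals_def)
  moreover have "(\<Union>s\<in>R. spirals p {s}) sparse_in - {0}"
    using R by (intro sparse_in_UN_finite spirals_sparse_single p) auto
  ultimately show ?thesis by simp
qed

lemma spirals_open:
  assumes "norm p > 1" "finite R" "0 \<notin> R" "open A" "A \<subseteq> - {0}"
  shows "open (A - spirals p R)"
  using open_diff_sparse_pts[OF assms(4), of "spirals p R"] spirals_sparse[OF assms(1-3)] assms(5)
  by (meson sparse_in_subset)

lemma spirals_countable:
  assumes "finite R"
  shows "countable (spirals p R)"
proof -
  have "spirals p R = (\<lambda>(k, s). p powi k * s) ` (UNIV \<times> R)" by (auto simp: spirals_def)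
  thus ?thesis using assms by (simp add: countable_finite)
qed

text \<open>Here the highest shift has been normalised to the identity.  Solving the equation for f z in
  terms of the values f (z / p^d), d \<ge> 1, extends f from a punctured disc of radius r to the one of
  radius |p| r, and so on.  New singularities arise only at the zeros of the coefficient D of f z
  and on the spirals through singularities that are already present.\<close>
lemma qdiff_extension:
  fixes f :: "complex \<Rightarrow> complex" and d :: "'i \<Rightarrow> nat"
  assumes p: "norm p > 1" and R: "finite R" "0 \<notin> R" and r: "r > 0"
    and fin: "finite J" and d: "\<And>i. i \<in> J \<Longrightarrow> d i \<ge> 1"
    and mero: "f meromorphic_on ball 0 r - {0}"
    and hol: "f holomorphic_on ball 0 r - {0} - spirals p R"
    and B: "B holomorphic_on UNIV" and D: "D holomorphic_on UNIV"
    and C: "\<And>i. i \<in> J \<Longrightarrow> C i holomorphic_on UNIV"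
    and D0: "\<And>z. z \<noteq> 0 \<Longrightarrow> D z = 0 \<Longrightarrow> z \<in> spirals p R"
    and eq: "\<And>z. z \<in> ball 0 r - {0} - spirals p R \<Longrightarrow>
               D z * f z + (\<Sum>i\<in>J. C i z * f (z / p ^ d i)) = B z"
  obtains F where "F meromorphic_on - {0}" "F holomorphic_on - {0} - spirals p R"
    "\<And>z. z \<in> ball 0 r - {0} - spirals p R \<Longrightarrow> F z = f z"
    "\<And>z. z \<in> - {0} - spirals p R \<Longrightarrow> D z * F z + (\<Sum>i\<in>J. C i z * F (z / p ^ d i)) = B z"
proof -
  define X where "X = spirals p R"
  have p0: "p \<noteq> 0" using p by auto
  define P where "P = norm p"
  have P: "P > 1" using p by (simp add: P_def)
  define step where "step = (\<lambda>g z. (B z - (\<Sum>i\<in>J. C i z * g (z / p ^ d i))) / D z)"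
  \<comment> \<open>The k-th iterate is correct on the disc of radius r * |p|^k; F glues the iterates.\<close>
  define fk where "fk = (\<lambda>k. (step ^^ k) f)"
  have fk_0: "fk 0 = f" and fk_Suc: "fk (Suc k) = step (fk k)" for k by (simp_all add: fk_def)
  define A where "A = (\<lambda>k. ball (0::complex) (r * P ^ k) - {0})"
  have A_open: "open (A k)" "A k \<subseteq> - {0}" for k by (auto simp: A_def)
  have AX_open: "open (A k - X)" for k
    unfolding X_def by (rule spirals_open[OF p R A_open])
  have A_mono: "A k \<subseteq> A j" if "k \<le> j" for k j
  proof -
    have "r * P ^ k \<le> r * P ^ j" using r P that by (intro mult_left_mono power_increasing) auto
    thus ?thesis by (auto simp: A_def)
  qed
  have A_div: "z / p ^ d i \<in> A k" if "z \<in> A (Suc k)" "i \<in> J" for z i k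
  proof -
    have "norm z < r * P ^ Suc k" "z \<noteq> 0" using that by (auto simp: A_def)
    hence "norm z < P * (r * P ^ k)" by (simp add: mult_ac)
    also have "\<dots> \<le> P ^ d i * (r * P ^ k)"
      using power_increasing[OF d[OF that(2)], of P] r P by (intro mult_right_mono) auto
    finally have "norm (z / p ^ d i) < r * P ^ k"
      using P by (simp add: norm_divide norm_power P_def[symmetric] divide_less_eq mult.commute)
    thus ?thesis using \<open>z \<noteq> 0\<close> p0 by (auto simp: A_def)
  qed
  have A_div': "z / p ^ d i \<in> A k" if "z \<in> A k" "i \<in> J" for z i k
    using A_div[of z k i] A_mono[of k "Suc k"] that by auto
  have X_div: "z / p ^ n \<in> X \<longleftrightarrow> z \<in> X" for z n
    unfolding X_def by (rule spirals_divide[OF p0])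
  have an: "h meromorphic_on S" if "h holomorphic_on UNIV" for h S
    using that analytic_on_subset analytic_on_imp_meromorphic_on
    by (metis analytic_on_open open_UNIV top_greatest)
  have mB: "B meromorphic_on S" and mD: "D meromorphic_on S"
    and mC: "i \<in> J \<Longrightarrow> C i meromorphic_on S" for S i
    using an B D C by blast+
  have inv: "fk k meromorphic_on A k \<and> fk k holomorphic_on A k - X \<and>
     (\<forall>z\<in>A k - X. D z * fk k z + (\<Sum>i\<in>J. C i z * fk k (z / p ^ d i)) = B z)" for k
  proof (induction k)
    case 0
    show ?case using mero hol eq by (simp add: fk_0 A_def X_def)
  next
    case (Suc k)
    have eqk: "fk (Suc k) z = fk k z" if z: "z \<in> A k - X" for z
    proof -
      have "D z \<noteq> 0" using D0[of z] z by (auto simp: A_def X_def)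
      moreover have "D z * fk k z + (\<Sum>i\<in>J. C i z * fk k (z / p ^ d i)) = B z"
        using Suc.IH z by blast
      ultimately show ?thesis unfolding fk_Suc step_def by (simp add: field_simps)
    qed
    have "(\<lambda>z. fk k (z / p ^ d i)) meromorphic_on A (Suc k)" if i: "i \<in> J" for i
    proof (rule meromorphic_on_compose[of "fk k" "A k" "\<lambda>z. z / p ^ d i" "A (Suc k)"])
      show "fk k meromorphic_on A k" using Suc.IH by blast
      show "(\<lambda>z. z / p ^ d i) analytic_on A (Suc k)"
        by (intro analytic_intros) (use p0 in auto)
      show "(\<lambda>z. z / p ^ d i) ` A (Suc k) \<subseteq> A k" using A_div i by blast
    qed
    hence 1: "fk (Suc k) meromorphic_on A (Suc k)"
      unfolding fk_Suc step_def
      by (intro meromorphic_on_divide meromorphic_on_diff meromorphic_on_sum meromorphic_on_mult mB mC mD)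
    have "(\<lambda>z. fk k (z / p ^ d i)) holomorphic_on A (Suc k) - X" if i: "i \<in> J" for i
    proof (rule holomorphic_on_compose_gen[unfolded o_def, of "\<lambda>z. z / p ^ d i" _ "fk k" "A k - X"])
      show "fk k holomorphic_on A k - X" using Suc.IH by blast
      show "(\<lambda>z. z / p ^ d i) holomorphic_on A (Suc k) - X"
        by (intro holomorphic_intros) (use p0 in auto)
      show "(\<lambda>z. z / p ^ d i) ` (A (Suc k) - X) \<subseteq> A k - X" using A_div i X_div by blast
    qed
    moreover have "D z \<noteq> 0" if "z \<in> A (Suc k) - X" for z
      using D0[of z] that by (auto simp: A_def X_def)
    ultimately have 2: "fk (Suc k) holomorphic_on A (Suc k) - X"
      unfolding fk_Suc step_def
      by (intro holomorphic_intros holomorphic_on_subset[OF B] holomorphic_on_subset[OF C]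
           holomorphic_on_subset[OF D]) auto
    have 3: "D z * fk (Suc k) z + (\<Sum>i\<in>J. C i z * fk (Suc k) (z / p ^ d i)) = B z"
      if z: "z \<in> A (Suc k) - X" for z
    proof -
      have "D z \<noteq> 0" using D0[of z] z by (auto simp: A_def X_def)
      moreover have "fk (Suc k) (z / p ^ d i) = fk k (z / p ^ d i)" if "i \<in> J" for i
        using eqk[of "z / p ^ d i"] A_div[of z k i] X_div z that by auto
      hence "(\<Sum>i\<in>J. C i z * fk (Suc k) (z / p ^ d i)) = (\<Sum>i\<in>J. C i z * fk k (z / p ^ d i))"
        by (intro sum.cong) auto
      ultimately show ?thesis unfolding fk_Suc by (simp add: step_def)
    qed
    from 1 2 3 show ?case by blast
  qed
  have eqk: "fk (Suc k) z = fk k z" if z: "z \<in> A k - X" for z k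
  proof -
    have "D z \<noteq> 0" using D0[of z] z by (auto simp: A_def X_def)
    moreover have "D z * fk k z + (\<Sum>i\<in>J. C i z * fk k (z / p ^ d i)) = B z"
      using inv[of k] z by blast
    ultimately show ?thesis unfolding fk_Suc step_def by (simp add: field_simps)
  qed
  have eqkj: "fk j z = fk k z" if "z \<in> A k - X" "k \<le> j" for z k j
    using that(2)
  proof (induction rule: dec_induct)
    case (step n)
    thus ?case using eqk[of z n] A_mono[of k n] that(1) by auto
  qed auto
  define kap where "kap = (\<lambda>z. LEAST k. z \<in> A k)"
  define F where "F = (\<lambda>z. fk (kap z) z)"
  have ex: "\<exists>k. z \<in> A k" if "z \<noteq> 0" for z
  proof -
    obtain k where "norm z / r < P ^ k" using real_arch_pow[OF P] by blast
    hence "norm z < r * P ^ k" using r by (simp add: divide_less_eq mult.commute)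
    thus ?thesis using that by (auto simp: A_def)
  qed
  have F_eq: "F z = fk k z" if z: "z \<in> A k - X" for z k
  proof -
    have "z \<in> A (kap z)" unfolding kap_def by (rule LeastI) (use z in blast)
    moreover have "kap z \<le> k" unfolding kap_def by (rule Least_le) (use z in blast)
    ultimately show ?thesis unfolding F_def using eqkj[of z "kap z" k] z by auto
  qed
  have un: "- {0} = (\<Union>k. A k)" using ex by (auto simp: A_def)
  show ?thesis
  proof (rule that[of F])
    have "F meromorphic_on (\<Union>k. A k)"
    proof (rule meromorphic_on_UN)
      fix k
      have "X sparse_in A k" unfolding X_def
        using spirals_sparse[OF p R] A_open(2) by (meson sparse_in_subset)
      hence "\<forall>\<^sub>\<approx>z\<in>A k. z \<notin> X" by (rule eventually_not_in_cosparse)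
      moreover have "\<forall>\<^sub>\<approx>z\<in>A k. z \<in> A k" by (rule eventually_in_cosparse) (use A_open in auto)
      ultimately have "\<forall>\<^sub>\<approx>z\<in>A k. F z = fk k z"
        by eventually_elim (use F_eq in auto)
      thus "F meromorphic_on A k"
        using meromorphic_on_cong'[of F "fk k" "A k" "A k"] inv[of k] by blast
    qed
    thus "F meromorphic_on - {0}" by (simp add: un)
    have "F holomorphic_on (\<Union>k. A k - X)"
    proof (rule holomorphic_on_UN_open)
      fix k
      show "F holomorphic_on A k - X"
        by (rule holomorphic_transform[of "fk k"]) (use inv[of k] F_eq in auto)
      show "open (A k - X)" by (rule AX_open)
    qed
    moreover have "(\<Union>k. A k - X) = - {0} - X" unfolding un by auto
    ultimately show "F holomorphic_on - {0} - spirals p R" by (simp add: X_def)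
    show "F z = f z" if "z \<in> ball 0 r - {0} - spirals p R" for z
      using F_eq[of z 0] that by (simp add: A_def X_def fk_0)
    show "D z * F z + (\<Sum>i\<in>J. C i z * F (z / p ^ d i)) = B z" if z: "z \<in> - {0} - spirals p R" for z
    proof -
      obtain k where k: "z \<in> A k" using ex[of z] z by auto
      have zX: "z \<in> A k - X" using k z by (auto simp: X_def)
      have "F (z / p ^ d i) = fk k (z / p ^ d i)" if "i \<in> J" for i
        using F_eq[of "z / p ^ d i" k] A_div'[OF k that] X_div zX by auto
      hence "(\<Sum>i\<in>J. C i z * F (z / p ^ d i)) = (\<Sum>i\<in>J. C i z * fk k (z / p ^ d i))"
        by (intro sum.cong) auto
      thus ?thesis using F_eq[OF zX] inv[of k] zX by simp
    qed
  qed
qed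

text \<open>The exponent identity behind the next lemma: a coefficient of size |z|^d at |z| = P^n raises the
  bound P^((n - d) choose 2) of f (z / p^d) exactly to P^(n choose 2), up to a factor that does not
  depend on n.\<close>
lemma choose_2_diff:
  fixes P :: real
  assumes "P > 0" "d \<le> n"
  shows "P ^ ((n - d) choose 2) * P ^ (n * d) = P ^ (n choose 2) * P ^ (Suc d choose 2)"
proof -
  have "tri (int (n - d) + int d) = tri (int (n - d)) + tri (int d) + int (n - d) * int d"
    by (rule tri_add)
  hence "int (n choose 2) = int ((n - d) choose 2) + int (d choose 2) + int (n - d) * int d"
    using assms by (simp only: tri_of_nat flip: of_nat_add) simp
  hence 1: "n choose 2 = ((n - d) choose 2) + (d choose 2) + (n - d) * d" by (metis of_nat_add of_nat_eq_iff of_nat_mult)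
  have 2: "Suc d choose 2 = (d choose 2) + d" by (simp add: numeral_2_eq_2)
  have 3: "2 * (d choose 2) + d = d * d"
  proof -
    have "2 * int (d choose 2) = int d * (int d - 1)"
      using two_tri[of "int d"] unfolding tri_of_nat .
    hence "int (2 * (d choose 2) + d) = int (d * d)" by (simp add: algebra_simps)
    thus ?thesis by (simp only: of_nat_eq_iff)
  qed
  have "(n - d) * d + d * d = n * d" using assms by (metis add_mult_distrib le_add_diff_inverse2)
  hence "((n - d) choose 2) + n * d = (n choose 2) + (Suc d choose 2)"
    using 1 2 3 by linarith
  thus ?thesis by (simp only: power_add[symmetric])
qed

text \<open>When the coefficient of f (z / p^d) is O(|z|^d) relative to the coefficient of f z, the bound
  follows from the equation by induction on n: along z = p^n y each summand picks up P^(n choose 2)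
  and at least one power of M less, so a large M makes the finitely many summands fit.\<close>
lemma qdiff_growth:
  fixes F :: "complex \<Rightarrow> complex" and d :: "'i \<Rightarrow> nat"
  assumes p: "norm p > 1" and fin: "finite J" and d: "\<And>i. i \<in> J \<Longrightarrow> d i \<ge> 1"
    and S: "compact S" "S \<subseteq> - {0} - spirals p R"
    and hol: "F holomorphic_on - {0} - spirals p R"
    and eq: "\<And>z. z \<in> - {0} - spirals p R \<Longrightarrow> D z * F z + (\<Sum>i\<in>J. C i z * F (z / p ^ d i)) = B z"
    and K: "K \<ge> 0" and rho: "\<rho> > 0"
    and bound: "\<And>z. norm z \<ge> \<rho> \<Longrightarrow> D z \<noteq> 0 \<and> norm (B z) \<le> K * norm z ^ b * norm (D z) \<and>
             (\<forall>i\<in>J. norm (C i z) \<le> K * norm z ^ d i * norm (D z))"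
  shows "\<exists>A\<ge>0. \<exists>M\<ge>1. \<forall>n. \<forall>y\<in>S. norm (F (p ^ n * y)) \<le> A * M ^ n * norm p ^ (n choose 2)"
proof (cases "S = {}")
  case True
  thus ?thesis by (intro exI[of _ 0] conjI exI[of _ 1]) auto
next
  case Sne: False
  define P where "P = norm p"
  have P: "P > 1" using p by (simp add: P_def)
  have p0: "p \<noteq> 0" using p by auto
  obtain Y where Y: "Y \<ge> 1" "\<And>y. y \<in> S \<Longrightarrow> norm y \<le> Y"
  proof -
    obtain Y where "\<And>y. y \<in> S \<Longrightarrow> norm y \<le> Y" using compact_imp_bounded[OF S(1)] unfolding bounded_iff by blast
    thus ?thesis by (intro that[of "max 1 Y"]) (auto simp: le_max_iff_disj)
  qed
  obtain y0 where y0: "y0 \<in> S" "\<And>y. y \<in> S \<Longrightarrow> norm y0 \<le> norm y"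
    using continuous_attains_inf[OF S(1) Sne, of norm] by (auto intro: continuous_intros)
  have y0_pos: "norm y0 > 0" using y0(1) S(2) by auto
  define dm where "dm = Max (insert 1 (d ` J))"
  have dm: "d i \<le> dm" if "i \<in> J" for i
    unfolding dm_def by (rule Max_ge) (use fin that in auto)
  obtain N0 where N0: "\<rho> / norm y0 < P ^ N0" using real_arch_pow[OF P] by blast
  define N where "N = max N0 dm"
  have big: "norm (p ^ n * y) \<ge> \<rho>" if "n \<ge> N" "y \<in> S" for n y
  proof -
    have "\<rho> \<le> P ^ N0 * norm y0" using N0 y0_pos by (simp add: divide_less_eq)
    also have "\<dots> \<le> P ^ n * norm y"
      using that P y0(2)[OF that(2)] by (intro mult_mono power_increasing) (auto simp: N_def)
    finally show ?thesis by (simp add: norm_mult norm_power P_def)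
  qed
  have inX: "p ^ n * y \<in> - {0} - spirals p R" if "y \<in> S" for n y
    using S(2) that p0 spirals_powi[OF p0, of "int n" y R] by auto
  have "\<exists>A. \<forall>y\<in>S. norm (F (p ^ n * y)) \<le> A" for n
  proof -
    have "continuous_on S (\<lambda>y. p ^ n * y)" by (intro continuous_intros)
    moreover have "(\<lambda>y. p ^ n * y) ` S \<subseteq> - {0} - spirals p R"
      by (rule image_subsetI) (rule inX)
    ultimately have "continuous_on S (\<lambda>y. F (p ^ n * y))"
      by (rule continuous_on_compose2[OF holomorphic_on_imp_continuous_on[OF hol]])
    from compact_imp_bounded[OF compact_continuous_image[OF this S(1)]]
    show ?thesis unfolding bounded_iff by blast
  qed
  then obtain A0 where A0: "\<And>n y. y \<in> S \<Longrightarrow> norm (F (p ^ n * y)) \<le> A0 n" by metis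
  define W where "W = Y ^ dm * P ^ (Suc dm choose 2)"
  have W: "W \<ge> 1"
  proof -
    have "1 * 1 \<le> W" unfolding W_def using Y(1) P by (intro mult_mono one_le_power) auto
    thus ?thesis by simp
  qed
  \<comment> \<open>The first entry absorbs the right-hand side B, the second one the sum over J; each then takes up half of the bound.\<close>
  define M where "M = max (P ^ b) (1 + 2 * real (card J) * K * W)"
  have M: "M \<ge> 1" "M \<ge> P ^ b" "2 * real (card J) * K * W \<le> M"
    using P one_le_power[of P b] unfolding M_def by (auto simp: le_max_iff_disj)
  define A where "A = max (2 * K * Y ^ b) (\<Sum>n<N. \<bar>A0 n\<bar>)"
  have A: "A \<ge> 2 * K * Y ^ b" "A \<ge> 0" "\<And>n. n < N \<Longrightarrow> A0 n \<le> A"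
  proof -
    show "A \<ge> 2 * K * Y ^ b" by (simp add: A_def)
    show "A \<ge> 0" unfolding A_def by (simp add: le_max_iff_disj sum_nonneg)
    fix n assume "n < N"
    have "A0 n \<le> \<bar>A0 n\<bar>" by simp
    also have "\<dots> \<le> (\<Sum>n<N. \<bar>A0 n\<bar>)" by (rule member_le_sum) (use \<open>n < N\<close> in auto)
    finally show "A0 n \<le> A" by (simp add: A_def)
  qed
  have main: "norm (F (p ^ n * y)) \<le> A * M ^ n * P ^ (n choose 2)" if y: "y \<in> S" for n y
  proof (induction n rule: less_induct)
    case (less n)
    have Mn: "M ^ n \<ge> 1" "P ^ (n choose 2) \<ge> 1" using M(1) P by (simp_all add: one_le_power)
    show ?case
    proof (cases "n < N")
      case True
      have "norm (F (p ^ n * y)) \<le> A * (1 * 1)" using A0[OF y, of n] A(3)[OF True] by simp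
      also have "\<dots> \<le> A * (M ^ n * P ^ (n choose 2))"
        using Mn A(2) by (intro mult_left_mono mult_mono) auto
      finally show ?thesis by (simp only: mult.assoc)
    next
      case False
      define z where "z = p ^ n * y"
      define T where "T = A * M ^ n * P ^ (n choose 2)"
      have T0: "T \<ge> 0" unfolding T_def using A(2) Mn by simp
      have z: "z \<in> - {0} - spirals p R" unfolding z_def by (rule inX[OF y])
      have bz: "D z \<noteq> 0" "norm (B z) \<le> K * norm z ^ b * norm (D z)"
        "\<And>i. i \<in> J \<Longrightarrow> norm (C i z) \<le> K * norm z ^ d i * norm (D z)"
        using bound[of z] big[of n y] False y by (auto simp: z_def)
      have nz: "norm z = P ^ n * norm y" by (simp add: z_def norm_mult norm_power P_def)
      have Bb: "K * norm z ^ b \<le> T / 2"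
      proof -
        have "norm z ^ b \<le> (P ^ n * Y) ^ b" unfolding nz using Y(2)[OF y] P
          by (intro power_mono mult_left_mono) auto
        also have "\<dots> = (P ^ b) ^ n * Y ^ b" by (simp add: power_mult_distrib mult.commute flip: power_mult)
        also have "\<dots> \<le> M ^ n * Y ^ b" using M P Y(1) by (intro mult_right_mono power_mono) auto
        finally have "2 * (K * norm z ^ b) \<le> 2 * (K * (M ^ n * Y ^ b))"
          using K by (intro mult_left_mono) auto
        also have "\<dots> = (2 * K * Y ^ b) * (M ^ n * 1)" by simp
        also have "\<dots> \<le> A * (M ^ n * P ^ (n choose 2))"
          using A Mn K Y(1) by (intro mult_mono) auto
        finally show ?thesis by (simp add: T_def mult.assoc)
      qed
      have Cb: "K * norm z ^ d i * norm (F (z / p ^ d i)) \<le> K * W / M * T" if i: "i \<in> J" for i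
      proof -
        have di: "d i \<le> n" "d i \<ge> 1" "d i \<le> dm" using dm[OF i] d[OF i] False by (auto simp: N_def)
        have "p ^ n = p ^ (n - d i) * p ^ d i" using di(1) by (simp flip: power_add)
        hence "z / p ^ d i = p ^ (n - d i) * y" unfolding z_def using p0 by simp
        hence "norm (F (z / p ^ d i)) \<le> A * M ^ (n - d i) * P ^ ((n - d i) choose 2)"
          using less.IH[of "n - d i"] di by simp
        hence "norm z ^ d i * norm (F (z / p ^ d i)) \<le>
            (P ^ n * Y) ^ d i * (A * M ^ (n - d i) * P ^ ((n - d i) choose 2))"
          unfolding nz using Y(1) Y(2)[OF y] P by (intro mult_mono power_mono mult_left_mono) auto
        also have "\<dots> = Y ^ d i * A * M ^ (n - d i) * (P ^ ((n - d i) choose 2) * P ^ (n * d i))"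
          by (simp add: power_mult_distrib power_mult mult_ac)
        also have "\<dots> = Y ^ d i * A * M ^ (n - d i) * (P ^ (n choose 2) * P ^ (Suc (d i) choose 2))"
          using P di(1) by (subst choose_2_diff) auto
        also have "\<dots> = (Y ^ d i * P ^ (Suc (d i) choose 2)) * (A * M ^ (n - d i) * P ^ (n choose 2))"
          by (simp only: mult_ac)
        also have "\<dots> \<le> W * (A * M ^ (n - 1) * P ^ (n choose 2))"
        proof (rule mult_mono)
          have "(Suc (d i) choose 2) \<le> (Suc dm choose 2)" using di by (intro binomial_right_mono) auto
          thus "Y ^ d i * P ^ (Suc (d i) choose 2) \<le> W" unfolding W_def
            using Y(1) P di by (intro mult_mono power_increasing) auto
          have "M ^ (n - d i) \<le> M ^ (n - 1)" using M(1) di by (intro power_increasing) auto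
          thus "A * M ^ (n - d i) * P ^ (n choose 2) \<le> A * M ^ (n - 1) * P ^ (n choose 2)"
            using A(2) P by (intro mult_right_mono mult_left_mono) auto
        qed (use W A(2) M P in auto)
        also have "\<dots> = W / M * T"
        proof -
          have "M ^ n = M * M ^ (n - 1)" using di by (simp flip: power_Suc)
          thus ?thesis unfolding T_def using M(1) by simp
        qed
        finally have "K * (norm z ^ d i * norm (F (z / p ^ d i))) \<le> K * (W / M * T)"
          using K by (rule mult_left_mono)
        thus ?thesis by (simp add: mult.assoc)
      qed
      have "D z * F z = B z - (\<Sum>i\<in>J. C i z * F (z / p ^ d i))"
        using eq[OF z] by (simp add: algebra_simps)
      hence "norm (D z) * norm (F z) \<le> norm (B z) + norm (\<Sum>i\<in>J. C i z * F (z / p ^ d i))"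
        by (metis norm_mult norm_triangle_ineq4)
      also have "norm (\<Sum>i\<in>J. C i z * F (z / p ^ d i)) \<le> (\<Sum>i\<in>J. norm (D z) * (K * W / M * T))"
      proof (rule sum_norm_le)
        fix i assume i: "i \<in> J"
        have "norm (C i z * F (z / p ^ d i)) \<le> K * norm z ^ d i * norm (D z) * norm (F (z / p ^ d i))"
          unfolding norm_mult using bz(3)[OF i] by (rule mult_right_mono) auto
        also have "\<dots> = norm (D z) * (K * norm z ^ d i * norm (F (z / p ^ d i)))" by (simp only: mult_ac)
        also have "\<dots> \<le> norm (D z) * (K * W / M * T)" using Cb[OF i] by (rule mult_left_mono) auto
        finally show "norm (C i z * F (z / p ^ d i)) \<le> norm (D z) * (K * W / M * T)" .
      qed
      also have "\<dots> = norm (D z) * (real (card J) * (K * W / M * T))" by (simp add: mult_ac)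
      also have "\<dots> \<le> norm (D z) * (T / 2)"
      proof (rule mult_left_mono)
        have "2 * real (card J) * K * W / M \<le> 1" using M(1,3) by (simp add: divide_le_eq)
        hence "(2 * real (card J) * K * W / M) * T \<le> 1 * T" using T0 by (rule mult_right_mono)
        hence "(2 * real (card J) * K * W / M) * T / 2 \<le> 1 * T / 2" by (rule divide_right_mono) simp
        moreover have "real (card J) * (K * W / M * T) = (2 * real (card J) * K * W / M) * T / 2"
          by simp
        ultimately show "real (card J) * (K * W / M * T) \<le> T / 2" by simp
      qed auto
      also have "norm (B z) \<le> norm (D z) * (T / 2)"
      proof -
        have "norm (B z) \<le> (K * norm z ^ b) * norm (D z)" using bz(2) .
        also have "\<dots> \<le> (T / 2) * norm (D z)" using Bb by (rule mult_right_mono) auto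
        finally show ?thesis by (simp only: mult.commute)
      qed
      finally have "norm (D z) * norm (F z) \<le> norm (D z) * T" by (simp add: algebra_simps)
      thus ?thesis using bz(1) by (simp add: T_def z_def)
    qed
  qed
  show ?thesis
    by (rule exI[of _ A], intro conjI A, rule exI[of _ M], intro conjI M allI ballI main[unfolded P_def])
qed

section \<open>Equations with polynomial coefficients\<close>

lemma poly_norm_le:
  fixes q :: "complex poly"
  shows "\<exists>K\<ge>0. \<forall>z. norm z \<ge> 1 \<longrightarrow> norm (poly q z) \<le> K * norm z ^ degree q"
proof (intro exI conjI allI impI)
  show "0 \<le> (\<Sum>i\<le>degree q. norm (coeff q i))" by (simp add: sum_nonneg)
  fix z :: complex assume z: "norm z \<ge> 1"
  have "norm (poly q z) \<le> (\<Sum>i\<le>degree q. norm (coeff q i) * norm z ^ degree q)"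
    unfolding poly_altdef
    by (rule sum_norm_le)
       (use z in \<open>auto simp: norm_mult norm_power intro!: mult_left_mono power_increasing\<close>)
  thus "norm (poly q z) \<le> (\<Sum>i\<le>degree q. norm (coeff q i)) * norm z ^ degree q"
    by (simp add: sum_distrib_right)
qed

lemma poly_norm_ge:
  fixes q :: "complex poly"
  assumes "q \<noteq> 0"
  shows "\<exists>c>0. \<exists>\<rho>\<ge>1. \<forall>z. norm z \<ge> \<rho> \<longrightarrow> norm (poly q z) \<ge> c * norm z ^ degree q"
  using assms
proof (induction q rule: pCons_induct)
  case (pCons a q)
  show ?case
  proof (cases "q = 0")
    case True
    thus ?thesis using pCons.hyps by (intro exI[of _ "norm a"] conjI exI[of _ 1]) auto
  next
    case False
    then obtain c \<rho> where c: "c > 0" "\<rho> \<ge> 1" "\<And>z. norm z \<ge> \<rho> \<Longrightarrow> norm (poly q z) \<ge> c * norm z ^ degree q"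
      using pCons.IH by blast
    define \<rho>' where "\<rho>' = max \<rho> (2 * norm a / c)"
    have "norm (poly (pCons a q) z) \<ge> c / 2 * norm z ^ degree (pCons a q)" if z: "norm z \<ge> \<rho>'" for z
    proof -
      have z1: "norm z \<ge> \<rho>" "norm z \<ge> 1" "norm z \<ge> 2 * norm a / c" using z c(2) by (auto simp: \<rho>'_def)
      have "2 * norm a \<le> c * norm z" using z1(3) c(1) by (simp add: divide_le_eq mult.commute)
      also have "\<dots> \<le> c * (norm z * norm z ^ degree q)"
        using c(1) z1(2) mult_left_mono[OF one_le_power[OF z1(2), of "degree q"], of "norm z"]
        by (intro mult_left_mono) auto
      finally have 1: "norm a \<le> c / 2 * (norm z * norm z ^ degree q)" by simp
      have "norm z * (c * norm z ^ degree q) \<le> norm z * norm (poly q z)"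
        using c(3)[OF z1(1)] by (rule mult_left_mono) auto
      also have "\<dots> = norm (z * poly q z)" by (simp add: norm_mult)
      also have "\<dots> \<le> norm (a + z * poly q z) + norm a"
        using norm_triangle_ineq4[of "a + z * poly q z" a] by simp
      finally have "c * (norm z * norm z ^ degree q) \<le> norm (a + z * poly q z) + norm a" by (simp add: mult_ac)
      with 1 show ?thesis using False by simp
    qed
    thus ?thesis using c by (intro exI[of _ "c/2"] conjI exI[of _ \<rho>']) (auto simp: \<rho>'_def le_max_iff_disj)
  qed
qed auto

text \<open>The operator of a q-difference equation in base p as a sum of monomials cf z^dg sigma^ex with
  sigma : z \<mapsto> p z.  The index set is abstract: the transformations change the coefficients and the
  shifts of the monomials, but neither their number nor their degrees in z.\<close>
definition qop :: "complex \<Rightarrow> 'i set \<Rightarrow> ('i \<Rightarrow> complex) \<Rightarrow> ('i \<Rightarrow> nat) \<Rightarrow> ('i \<Rightarrow> int) \<Rightarrow>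
    (complex \<Rightarrow> complex) \<Rightarrow> complex \<Rightarrow> complex" where
  "qop p I cf dg ex f z = (\<Sum>i\<in>I. cf i * z ^ dg i * f (p powi ex i * z))"

text \<open>Substituting z / p^E for z makes the highest shift the identity and all others negative.\<close>
lemma qop_normal_form:
  fixes p :: complex
  assumes p: "p \<noteq> 0" and fin: "finite I" and E: "\<And>i. i \<in> I \<Longrightarrow> ex i \<le> E"
  shows "qop p I cf dg ex f (p powi (- E) * z) =
    (\<Sum>i | i \<in> I \<and> ex i = E. cf i * (p powi (- E) * z) ^ dg i) * f z +
    (\<Sum>i | i \<in> I \<and> ex i < E. cf i * (p powi (- E) * z) ^ dg i * f (z / p ^ nat (E - ex i)))"
proof -
  have I: "I = {i. i \<in> I \<and> ex i = E} \<union> {i. i \<in> I \<and> ex i < E}" using E by force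
  have e: "p powi ex i * (p powi (- E) * z) = z / p ^ nat (E - ex i)" if "i \<in> I" for i
  proof -
    have "p powi ex i * p powi (- E) = p powi (- int (nat (E - ex i)))"
      using p E[OF that] by (simp flip: power_int_add)
    also have "\<dots> = 1 / p ^ nat (E - ex i)"
      by (simp only: power_int_minus power_int_of_nat divide_inverse mult_1)
    finally show ?thesis by (simp add: mult.assoc[symmetric])
  qed
  have "qop p I cf dg ex f (p powi (- E) * z) =
    (\<Sum>i\<in>I. cf i * (p powi (- E) * z) ^ dg i * f (z / p ^ nat (E - ex i)))"
    unfolding qop_def by (intro sum.cong refl) (simp only: e)
  also have "\<dots> = (\<Sum>i | i \<in> I \<and> ex i = E. cf i * (p powi (- E) * z) ^ dg i * f (z / p ^ nat (E - ex i)))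
     + (\<Sum>i | i \<in> I \<and> ex i < E. cf i * (p powi (- E) * z) ^ dg i * f (z / p ^ nat (E - ex i)))"
    by (subst I, subst sum.union_disjoint) (use fin in auto)
  also have "(\<Sum>i | i \<in> I \<and> ex i = E. cf i * (p powi (- E) * z) ^ dg i * f (z / p ^ nat (E - ex i))) =
    (\<Sum>i | i \<in> I \<and> ex i = E. cf i * (p powi (- E) * z) ^ dg i) * f z"
    unfolding sum_distrib_right by (intro sum.cong) auto
  finally show ?thesis .
qed

text \<open>The coefficient polynomial of the highest shift sigma^E.  Its roots are the only sources of
  singularities when solutions are continued outwards.\<close>
definition top_part :: "'i set \<Rightarrow> ('i \<Rightarrow> complex) \<Rightarrow> ('i \<Rightarrow> nat) \<Rightarrow> ('i \<Rightarrow> int) \<Rightarrow> int \<Rightarrow> complex poly \<Rightarrow> bool" where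
  "top_part I cf dg ex E a \<longleftrightarrow> finite I \<and> (\<forall>i\<in>I. ex i \<le> E) \<and> a \<noteq> 0 \<and>
     a = (\<Sum>i | i \<in> I \<and> ex i = E. monom (cf i) (dg i))"

lemma poly_top_part: "top_part I cf dg ex E a \<Longrightarrow> poly a z = (\<Sum>i | i \<in> I \<and> ex i = E. cf i * z ^ dg i)"
  by (simp add: top_part_def poly_sum poly_monom)

lemma spirals_poly_root:
  fixes a :: "complex poly"
  assumes p: "p \<noteq> 0" and R: "\<And>z. z \<noteq> 0 \<Longrightarrow> poly a z = 0 \<Longrightarrow> z \<in> R" and z: "z \<noteq> 0" "poly a (p powi k * z) = 0"
  shows "z \<in> spirals p R"
proof -
  have "p powi k * z \<in> R" using R[OF _ z(2)] p z(1) by simp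
  hence "p powi k * z \<in> spirals p R" using spirals_self by blast
  thus ?thesis by (simp add: spirals_powi[OF p])
qed

lemma qop_extension:
  fixes f \<beta> :: "complex \<Rightarrow> complex"
  assumes p: "norm p > 1" and R: "finite R" "0 \<notin> R" and r: "r > 0" and r0: "r0 > 0"
    and top: "top_part I cf dg ex E a" and root: "\<And>z. z \<noteq> 0 \<Longrightarrow> poly a z = 0 \<Longrightarrow> z \<in> R"
    and mero: "f meromorphic_on ball 0 r - {0}"
    and hol: "f holomorphic_on ball 0 r - {0} - spirals p R"
    and \<beta>: "\<beta> holomorphic_on UNIV"
    and eq: "\<And>z. z \<in> ball 0 r0 - {0} - spirals p R \<Longrightarrow> qop p I cf dg ex f z = \<beta> z"
  obtains F r' where "r' > 0" "r' \<le> r" "F meromorphic_on - {0}" "F holomorphic_on - {0} - spirals p R"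
    "\<And>z. z \<in> ball 0 r' - {0} - spirals p R \<Longrightarrow> F z = f z"
    "\<And>z. z \<in> - {0} - spirals p R \<Longrightarrow> qop p I cf dg ex F z = \<beta> z"
proof -
  have p0: "p \<noteq> 0" using p by auto
  have fin: "finite I" and E: "\<And>i. i \<in> I \<Longrightarrow> ex i \<le> E" using top by (auto simp: top_part_def)
  define sc where "sc = (\<lambda>z. p powi (- E) * z)"
  define J where "J = {i \<in> I. ex i < E}"
  define C where "C = (\<lambda>i z. cf i * sc z ^ dg i)"
  define D where "D = (\<lambda>z. poly a (sc z))"
  define r' where "r' = min r (r0 * norm p powi E)"
  have r': "r' > 0" "r' \<le> r" using r r0 p0 by (auto simp: r'_def)
  have nf: "qop p I cf dg ex g (sc z) = D z * g z + (\<Sum>i\<in>J. C i z * g (z / p ^ nat (E - ex i)))" for g z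
    using qop_normal_form[OF p0 fin E, where cf = cf and dg = dg and f = g and z = z] poly_top_part[OF top]
    unfolding sc_def D_def C_def J_def by simp
  have sub: "ball 0 r' - {0} - spirals p R \<subseteq> ball 0 r - {0} - spirals p R"
    "ball 0 r' - {0} \<subseteq> ball 0 r - {0::complex}" using r' by auto
  have scX: "sc z \<in> spirals p R \<longleftrightarrow> z \<in> spirals p R" for z
    unfolding sc_def by (rule spirals_powi[OF p0])
  have sc_hol: "sc holomorphic_on UNIV" unfolding sc_def by (intro holomorphic_intros)
  obtain F where F: "F meromorphic_on - {0}" "F holomorphic_on - {0} - spirals p R"
    "\<And>z. z \<in> ball 0 r' - {0} - spirals p R \<Longrightarrow> F z = f z"
    "\<And>z. z \<in> - {0} - spirals p R \<Longrightarrow>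
        D z * F z + (\<Sum>i\<in>J. C i z * F (z / p ^ nat (E - ex i))) = \<beta> (sc z)"
  proof (rule qdiff_extension[OF p R r'(1), of J "\<lambda>i. nat (E - ex i)" f "\<lambda>z. \<beta> (sc z)" D C])
    show "finite J" using fin by (simp add: J_def)
    show "nat (E - ex i) \<ge> 1" if "i \<in> J" for i using that by (auto simp: J_def)
    show "f meromorphic_on ball 0 r' - {0}" using mero sub(2) by (rule meromorphic_on_subset)
    show "f holomorphic_on ball 0 r' - {0} - spirals p R" using hol sub(1) by (rule holomorphic_on_subset)
    show "(\<lambda>z. \<beta> (sc z)) holomorphic_on UNIV"
      using holomorphic_on_compose_gen[OF sc_hol \<beta>] by (simp add: o_def)
    show "D holomorphic_on UNIV" unfolding D_def by (intro holomorphic_intros sc_hol)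
    show "C i holomorphic_on UNIV" for i unfolding C_def by (intro holomorphic_intros sc_hol)
    show "z \<in> spirals p R" if "z \<noteq> 0" "D z = 0" for z
      using spirals_poly_root[OF p0 root, of a z "- E"] that unfolding D_def sc_def by blast
    show "D z * f z + (\<Sum>i\<in>J. C i z * f (z / p ^ nat (E - ex i))) = \<beta> (sc z)"
      if z: "z \<in> ball 0 r' - {0} - spirals p R" for z
    proof -
      have "norm z < r0 * norm p powi E" using z by (auto simp: r'_def)
      moreover have "norm (sc z) = norm z / norm p powi E"
        by (simp add: sc_def norm_mult norm_power_int power_int_minus divide_inverse mult.commute norm_inverse)
      moreover have "norm p powi E > 0" using p0 by simp
      ultimately have "norm (sc z) < r0" by (simp add: pos_divide_less_eq)
      hence "sc z \<in> ball 0 r0 - {0} - spirals p R" using z scX p0 by (auto simp: sc_def)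
      from eq[OF this] show ?thesis by (simp add: nf)
    qed
  qed (use that in blast)
  show ?thesis
  proof (rule that[of r' F])
    fix z assume z: "z \<in> - {0} - spirals p R"
    define y where "y = p powi E * z"
    have y: "sc y = z" using p0 by (simp add: y_def sc_def power_int_minus mult.assoc[symmetric])
    have "y \<in> - {0} - spirals p R" using z p0 scX[of y] y by (auto simp: y_def)
    from F(4)[OF this] show "qop p I cf dg ex F z = \<beta> z" using nf[of F y] by (simp add: y)
  qed (use r' F in auto)
qed

text \<open>The condition on the degrees says that, in the plane of the points (shift, degree), no monomial
  lies above the line of slope -1 through the leading monomial of the top part.  It means that the
  coefficient at distance d below the top shift is O(|z|^d) relative to the top part.\<close>
lemma qop_growth:
  fixes F :: "complex \<Rightarrow> complex" and b :: "complex poly"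
  assumes p: "norm p > 1"
    and top: "top_part I cf dg ex E a"
    and deg: "\<And>i. i \<in> I \<Longrightarrow> int (dg i) + ex i \<le> int (degree a) + E"
    and S: "compact S" "S \<subseteq> - {0} - spirals p R"
    and hol: "F holomorphic_on - {0} - spirals p R"
    and eq: "\<And>z. z \<in> - {0} - spirals p R \<Longrightarrow> qop p I cf dg ex F z = poly b z"
  shows "\<exists>A\<ge>0. \<exists>M\<ge>1. \<forall>n. \<forall>y\<in>S. norm (F (p ^ n * y)) \<le> A * M ^ n * norm p ^ (n choose 2)"
proof -
  have p0: "p \<noteq> 0" using p by auto
  define P where "P = norm p"
  have P: "P > 1" using p by (simp add: P_def)
  have fin: "finite I" and E: "\<And>i. i \<in> I \<Longrightarrow> ex i \<le> E" and a0: "a \<noteq> 0"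
    using top by (auto simp: top_part_def)
  define sc where "sc = (\<lambda>z. p powi (- E) * z)"
  define J where "J = {i \<in> I. ex i < E}"
  define d where "d = (\<lambda>i. nat (E - ex i))"
  define C where "C = (\<lambda>i z. cf i * sc z ^ dg i)"
  define D where "D = (\<lambda>z. poly a (sc z))"
  have nf: "qop p I cf dg ex g (sc z) = D z * g z + (\<Sum>i\<in>J. C i z * g (z / p ^ d i))" for g z
    using qop_normal_form[OF p0 fin E, where cf = cf and dg = dg and f = g and z = z] poly_top_part[OF top]
    unfolding sc_def D_def C_def J_def d_def by simp
  have scX: "sc z \<in> spirals p R \<longleftrightarrow> z \<in> spirals p R" for z
    unfolding sc_def by (rule spirals_powi[OF p0])
  obtain c \<rho> where c: "c > 0" "\<rho> \<ge> 1" "\<And>z. norm z \<ge> \<rho> \<Longrightarrow> norm (poly a z) \<ge> c * norm z ^ degree a"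
    using poly_norm_ge[OF a0] by blast
  obtain Kb where Kb: "Kb \<ge> 0" "\<And>z. norm z \<ge> 1 \<Longrightarrow> norm (poly b z) \<le> Kb * norm z ^ degree b"
    using poly_norm_le[of b] by blast
  define e where "e = P powi (- E)"
  have e: "e > 0" using P by (simp add: e_def)
  have nsc: "norm (sc z) = e * norm z" for z by (simp add: sc_def e_def P_def norm_mult norm_power_int)
  define K where "K = Kb * e ^ degree b / c + (\<Sum>i\<in>J. norm (cf i) * e ^ d i / c)"
  have K: "K \<ge> 0" "Kb * e ^ degree b / c \<le> K" "\<And>i. i \<in> J \<Longrightarrow> norm (cf i) * e ^ d i / c \<le> K"
  proof -
    have s: "0 \<le> (\<Sum>i\<in>J. norm (cf i) * e ^ d i / c)" using c e by (intro sum_nonneg) auto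
    have s2: "0 \<le> Kb * e ^ degree b / c" using Kb c e by simp
    show "K \<ge> 0" "Kb * e ^ degree b / c \<le> K" using s s2 by (auto simp: K_def)
    fix i assume "i \<in> J"
    hence "norm (cf i) * e ^ d i / c \<le> (\<Sum>i\<in>J. norm (cf i) * e ^ d i / c)"
      using fin c e by (intro member_le_sum) (auto simp: J_def)
    thus "norm (cf i) * e ^ d i / c \<le> K" using s2 by (simp add: K_def)
  qed
  show ?thesis
  proof (rule qdiff_growth[OF p, of J d S R F D C "\<lambda>z. poly b (sc z)" K "\<rho> / e" "degree b"])
    show "finite J" using fin by (simp add: J_def)
    show "d i \<ge> 1" if "i \<in> J" for i using that by (auto simp: J_def d_def)
    show "D z * F z + (\<Sum>i\<in>J. C i z * F (z / p ^ d i)) = poly b (sc z)"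
      if "z \<in> - {0} - spirals p R" for z
    proof -
      have "sc z \<in> - {0} - spirals p R" using that p0 scX by (auto simp: sc_def)
      from eq[OF this] show ?thesis by (simp add: nf)
    qed
    show "\<rho> / e > 0" using c e by simp
    fix z :: complex assume "norm z \<ge> \<rho> / e"
    hence z: "norm (sc z) \<ge> \<rho>" using e by (simp add: nsc divide_le_eq mult.commute)
    hence z1: "norm (sc z) \<ge> 1" using c by linarith
    define x where "x = norm (sc z)"
    have x: "x \<ge> 1" "x = e * norm z" using z1 nsc by (auto simp: x_def)
    have Dz: "c * x ^ degree a \<le> norm (D z)" unfolding D_def x_def by (rule c(3)[OF z])
    have Dpos: "norm (D z) \<ge> c" "norm (D z) > 0"
    proof -
      have "c * 1 \<le> c * x ^ degree a" using c x by (intro mult_left_mono one_le_power) auto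
      with Dz show "norm (D z) \<ge> c" by simp
      with c show "norm (D z) > 0" by linarith
    qed
    have 1: "norm (poly b (sc z)) \<le> K * norm z ^ degree b * norm (D z)"
    proof -
      have "norm (poly b (sc z)) \<le> Kb * x ^ degree b" unfolding x_def by (rule Kb(2)[OF z1])
      also have "\<dots> = (Kb * e ^ degree b / c) * norm z ^ degree b * c"
        unfolding x(2) using c by (simp add: power_mult_distrib)
      also have "\<dots> \<le> K * norm z ^ degree b * norm (D z)"
        using K Dpos c by (intro mult_mono mult_right_mono) auto
      finally show ?thesis .
    qed
    have 2: "norm (C i z) \<le> K * norm z ^ d i * norm (D z)" if i: "i \<in> J" for i
    proof -
      have "int (dg i) \<le> int (degree a) + int (d i)"
        using deg[of i] i by (auto simp: J_def d_def)
      hence "dg i \<le> degree a + d i" by linarith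
      hence "norm (C i z) \<le> norm (cf i) * x ^ (degree a + d i)"
        unfolding C_def norm_mult norm_power x_def[symmetric]
        using x by (intro mult_left_mono power_increasing) auto
      also have "\<dots> = (norm (cf i) * e ^ d i / c) * norm z ^ d i * (c * x ^ degree a)"
        using c unfolding power_add by (subst (2) x(2)) (simp add: power_mult_distrib mult_ac)
      also have "\<dots> \<le> K * norm z ^ d i * norm (D z)"
        using K(1) K(3)[OF i] Dz c x by (intro mult_mono mult_right_mono) auto
      finally show ?thesis .
    qed
    show "D z \<noteq> 0 \<and> norm (poly b (sc z)) \<le> K * norm z ^ degree b * norm (D z) \<and>
             (\<forall>i\<in>J. norm (C i z) \<le> K * norm z ^ d i * norm (D z))"
      using Dpos 1 2 by auto
  qed (use S hol K in auto)
qed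

section \<open>Transforming a solution\<close>

text \<open>The invariant that is carried through the successive q-Laplace transformations; s is the number of
  transformations applied so far and c is the formal solution at the level considered.  Near 0 the
  function \<phi> is the quotient of V by theta p (z / lam).  The asymptotic expansion is stated for the
  numerator V since there it holds on a full punctured disc, while \<phi> has poles accumulating at 0.\<close>
definition solves_level where
  "solves_level p lam R I cf dg ex b c s \<phi> V \<rho> L M \<longleftrightarrow>
     \<phi> meromorphic_on - {0} \<and> \<phi> holomorphic_on - {0} - spirals p R \<and>
     (\<forall>z\<in>- {0} - spirals p R. qop p I cf dg ex \<phi> z = poly b z) \<and>
     \<rho> > 0 \<and> V holomorphic_on ball 0 \<rho> - {0} \<and>
     (\<forall>z\<in>ball 0 \<rho> - {0} - spirals p R. \<phi> z * theta p (z / lam) = V z) \<and>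
     L \<ge> 0 \<and> M \<ge> 1 \<and>
     (\<forall>i. norm (c i) \<le> L * M ^ i * norm p ^ (s * (i choose 2))) \<and>
     (\<forall>k. \<forall>z\<in>ball 0 \<rho> - {0}. norm (V z - theta p (z / lam) * (\<Sum>i<k. c i * z ^ i)) \<le>
        L * M ^ k * norm p ^ (s * (k choose 2)) * norm z ^ k * theta (norm p) (norm (z / lam)))"

lemma theta_shift_norm:
  fixes p w :: complex
  assumes p: "norm p > 1" and w: "w \<noteq> 0"
  obtains r where "r > 0" "norm (theta p (p powi k * w)) = r * norm (theta p w)"
    "theta (norm p) (norm (p powi k * w)) = r * theta (norm p) (norm w)"
proof
  have p0: "p \<noteq> 0" using p by auto
  let ?r = "norm p powi tri k * norm w powi k"
  show "?r > 0" using p0 w by simp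
  show "norm (theta p (p powi k * w)) = ?r * norm (theta p w)"
    unfolding theta_shift[OF p w] by (simp add: norm_mult norm_power_int)
  show "theta (norm p) (norm (p powi k * w)) = ?r * theta (norm p) (norm w)"
    using theta_shift[of "norm p" "norm w" k] p w by (simp add: norm_mult norm_power_int)
qed

lemma theta_nz_off_spiral:
  assumes p: "norm p > 1" and lam: "lam \<noteq> 0" and R: "- lam \<in> R" and z: "z \<noteq> 0" "z \<notin> spirals p R"
  shows "theta p (z / lam) \<noteq> 0"
proof
  assume "theta p (z / lam) = 0"
  then obtain k where "z / lam = - (p powi k)" using theta_zero[OF p, of "z / lam"] z lam by auto
  hence "z = p powi k * (- lam)" using lam by (simp add: field_simps)
  thus False using z(2) R unfolding spirals_def by blast
qed

text \<open>The expansion of order 0 bounds V by the real theta function.  Along z = y / p^n the quotient of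
  |theta| and the real theta function does not depend on n, so \<phi> stays bounded.\<close>
lemma solves_level_bounded:
  assumes p: "norm p > 1" and lam: "lam \<noteq> 0" and R: "- lam \<in> R"
    and sol: "solves_level p lam R I cf dg ex b c s \<phi> V \<rho> L M"
    and S: "compact S" "S \<subseteq> - {0} - spirals p R"
  shows "\<exists>B\<ge>0. \<forall>n. \<forall>y\<in>S. norm (\<phi> (y / p ^ n)) \<le> B"
proof (cases "S = {}")
  case True
  thus ?thesis by (intro exI[of _ 0]) auto
next
  case Sne: False
  have p0: "p \<noteq> 0" using p by auto
  define P where "P = norm p"
  have P: "P > 1" using p by (simp add: P_def)
  have hol: "\<phi> holomorphic_on - {0} - spirals p R" and rho: "\<rho> > 0" and L: "L \<ge> 0"
    and Veq: "\<And>z. z \<in> ball 0 \<rho> - {0} - spirals p R \<Longrightarrow> \<phi> z * theta p (z / lam) = V z"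
    using sol by (auto simp: solves_level_def)
  have V0: "norm (V z) \<le> L * theta P (norm (z / lam))" if "z \<in> ball 0 \<rho> - {0}" for z
  proof -
    have "norm (V z - theta p (z / lam) * (\<Sum>i<0. c i * z ^ i)) \<le>
        L * M ^ 0 * norm p ^ (s * (0 choose 2)) * norm z ^ 0 * theta (norm p) (norm (z / lam))"
      using sol that unfolding solves_level_def by blast
    thus ?thesis by (simp add: P_def numeral_2_eq_2)
  qed
  have cont: "continuous_on S (\<lambda>y. norm (theta p (y / lam)))"
    by (intro continuous_on_norm continuous_on_compose2[OF holomorphic_on_imp_continuous_on[OF theta_holomorphic[OF p]]]
          continuous_intros) (use S lam in auto)
  obtain v where v: "v \<in> S" "\<And>y. y \<in> S \<Longrightarrow> norm (theta p (v / lam)) \<le> norm (theta p (y / lam))"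
    using continuous_attains_inf[OF S(1) Sne cont] by blast
  define c0 where "c0 = norm (theta p (v / lam))"
  have c0: "c0 > 0" unfolding c0_def using theta_nz_off_spiral[OF p lam R, of v] v(1) S(2) by auto
  obtain Y where Y: "\<And>y. y \<in> S \<Longrightarrow> norm y \<le> Y"
    using compact_imp_bounded[OF S(1)] unfolding bounded_iff by blast
  have contn: "continuous_on S (norm :: complex \<Rightarrow> real)" by (intro continuous_intros)
  obtain y0 where y0: "y0 \<in> S" "\<And>y. y \<in> S \<Longrightarrow> norm y0 \<le> norm y"
    using continuous_attains_inf[OF S(1) Sne contn] by blast
  have y0_pos: "norm y0 > 0" using y0(1) S(2) by auto
  define C0 where "C0 = theta P (norm (y0 / lam)) + theta P (Y / norm lam)"
  have C0: "theta P (norm (y / lam)) \<le> C0" if "y \<in> S" for y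
    unfolding C0_def using P y0_pos lam y0(2)[OF that] Y[OF that]
    by (intro theta_real_le) (auto simp: norm_divide divide_right_mono)
  have Ypos: "Y > 0" using Y[OF y0(1)] y0_pos by linarith
  obtain N where N: "Y / \<rho> < P ^ N" using real_arch_pow[OF P] by blast
  have inX: "y / p ^ n \<in> - {0} - spirals p R" if "y \<in> S" for n y
    using S(2) that p0 spirals_divide[OF p0, of y n R] by auto
  have small: "norm (\<phi> (y / p ^ n)) \<le> L * C0 / c0" if n: "n \<ge> N" and y: "y \<in> S" for n y
  proof -
    define z where "z = y / p ^ n"
    have "Y < P ^ N * \<rho>" using N rho by (simp add: divide_less_eq)
    also have "\<dots> \<le> P ^ n * \<rho>" using P n rho by (intro mult_right_mono power_increasing) auto
    finally have "norm y < P ^ n * \<rho>" using Y[OF y] by linarith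
    hence "norm z < \<rho>" using P by (simp add: z_def norm_divide norm_power P_def[symmetric] divide_less_eq mult.commute)
    hence z: "z \<in> ball 0 \<rho> - {0} - spirals p R" using inX[OF y, of n] by (auto simp: z_def)
    have yl: "y / lam \<noteq> 0" using S(2) y lam by auto
    have zl: "z / lam = p powi (- int n) * (y / lam)" by (simp add: z_def power_int_minus divide_inverse)
    obtain r where r: "r > 0" "norm (theta p (z / lam)) = r * norm (theta p (y / lam))"
        "theta P (norm (z / lam)) = r * theta P (norm (y / lam))"
      unfolding zl P_def using theta_shift_norm[OF p yl] by metis
    have "norm (\<phi> z) * (r * norm (theta p (y / lam))) = norm (V z)"
      using Veq[OF z] by (simp add: r(2)[symmetric] norm_mult[symmetric])
    also have "\<dots> \<le> L * (r * theta P (norm (y / lam)))" using V0[of z] z by (simp add: r(3))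
    finally have "r * (norm (\<phi> z) * norm (theta p (y / lam))) \<le> r * (L * theta P (norm (y / lam)))"
      by (simp only: mult_ac)
    hence 1: "norm (\<phi> z) * norm (theta p (y / lam)) \<le> L * theta P (norm (y / lam))" using r(1) by simp
    have "norm (\<phi> z) * c0 \<le> norm (\<phi> z) * norm (theta p (y / lam))"
      using v(2)[OF y] by (intro mult_left_mono) (auto simp: c0_def)
    also note 1
    also have "L * theta P (norm (y / lam)) \<le> L * C0" using C0[OF y] L by (rule mult_left_mono)
    finally show ?thesis using c0 by (simp add: z_def le_divide_eq)
  qed
  have "\<exists>A. \<forall>y\<in>S. norm (\<phi> (y / p ^ n)) \<le> A" for n
  proof -
    have "continuous_on S (\<lambda>y. y / p ^ n)" by (intro continuous_intros) (use p0 in auto)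
    moreover have "(\<lambda>y. y / p ^ n) ` S \<subseteq> - {0} - spirals p R"
      by (rule image_subsetI) (rule inX)
    ultimately have "continuous_on S (\<lambda>y. \<phi> (y / p ^ n))"
      by (rule continuous_on_compose2[OF holomorphic_on_imp_continuous_on[OF hol]])
    from compact_imp_bounded[OF compact_continuous_image[OF this S(1)]]
    show ?thesis unfolding bounded_iff by blast
  qed
  then obtain A where A: "\<And>n y. y \<in> S \<Longrightarrow> norm (\<phi> (y / p ^ n)) \<le> A n" by metis
  define B where "B = (\<Sum>n<N. \<bar>A n\<bar>) + \<bar>L * C0 / c0\<bar>"
  have "norm (\<phi> (y / p ^ n)) \<le> B" if y: "y \<in> S" for n y
  proof (cases "n \<ge> N")
    case True
    have "norm (\<phi> (y / p ^ n)) \<le> \<bar>L * C0 / c0\<bar>" using small[OF True y] by linarith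
    moreover have "(\<Sum>n<N. \<bar>A n\<bar>) \<ge> 0" by (simp add: sum_nonneg)
    ultimately show ?thesis unfolding B_def by linarith
  next
    case False
    have "norm (\<phi> (y / p ^ n)) \<le> \<bar>A n\<bar>" using A[OF y, of n] by linarith
    also have "\<dots> \<le> (\<Sum>n<N. \<bar>A n\<bar>)" by (rule member_le_sum) (use False in auto)
    finally show ?thesis unfolding B_def by linarith
  qed
  moreover have "B \<ge> 0" unfolding B_def by (simp add: sum_nonneg add_nonneg_nonneg)
  ultimately show ?thesis by blast
qed

lemma solves_level_growth:
  assumes p: "norm p > 1" and lam: "lam \<noteq> 0" and R: "- lam \<in> R"
    and sol: "solves_level p lam R I cf dg ex b c s \<phi> V \<rho> L M"
    and top: "top_part I cf dg ex E a"
    and deg: "\<And>i. i \<in> I \<Longrightarrow> int (dg i) + ex i \<le> int (degree a) + E"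
    and S: "compact S" "S \<subseteq> - {0} - spirals p R"
  obtains A K where "A \<ge> 0" "K \<ge> 1" "\<And>n y. y \<in> S \<Longrightarrow> norm (\<phi> (y / p ^ n)) \<le> A"
    "\<And>n y. y \<in> S \<Longrightarrow> norm (\<phi> (p ^ n * y)) \<le> A * K ^ n * norm p ^ (n choose 2)"
proof -
  obtain B where B: "B \<ge> 0" "\<And>n y. y \<in> S \<Longrightarrow> norm (\<phi> (y / p ^ n)) \<le> B"
    using solves_level_bounded[OF p lam R sol S] by blast
  have "\<exists>A\<ge>0. \<exists>M\<ge>1. \<forall>n. \<forall>y\<in>S. norm (\<phi> (p ^ n * y)) \<le> A * M ^ n * norm p ^ (n choose 2)"
    by (rule qop_growth[OF p top deg S]) (use sol in \<open>auto simp: solves_level_def\<close>)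
  then obtain A K where A: "A \<ge> 0" "K \<ge> 1"
    "\<And>n y. y \<in> S \<Longrightarrow> norm (\<phi> (p ^ n * y)) \<le> A * K ^ n * norm p ^ (n choose 2)" by blast
  show ?thesis
  proof (rule that[of "max A B" K])
    fix n y assume y: "y \<in> S"
    show "norm (\<phi> (y / p ^ n)) \<le> max A B" using B(2)[OF y, of n] by simp
    have "A * (K ^ n * norm p ^ (n choose 2)) \<le> max A B * (K ^ n * norm p ^ (n choose 2))"
      using A(2) by (intro mult_right_mono) auto
    thus "norm (\<phi> (p ^ n * y)) \<le> max A B * K ^ n * norm p ^ (n choose 2)"
      using A(3)[OF y, of n] by (simp add: mult.assoc)
  qed (use A B in auto)
qed

lemma laplace_growth_mono:
  assumes "laplace_growth p C M u" "C \<le> C'" "M \<le> M'"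
  shows "laplace_growth p C' M' u"
  unfolding laplace_growth_def
proof (intro conjI allI impI)
  have g: "C \<ge> 0" "M \<ge> 1" using assms by (auto simp: laplace_growth_def)
  show "0 \<le> C'" "1 \<le> M'" using assms g by auto
  show "norm (u l) \<le> C'" if "l \<le> 0" for l
    using assms that by (auto simp: laplace_growth_def intro: order_trans)
  show "norm (u (int n)) \<le> C' * M' ^ n * norm p ^ (n choose 2)" for n
  proof -
    have "norm (u (int n)) \<le> C * M ^ n * norm p ^ (n choose 2)"
      using assms by (auto simp: laplace_growth_def)
    also have "\<dots> \<le> C' * M' ^ n * norm p ^ (n choose 2)"
      using assms g by (intro mult_right_mono mult_mono power_mono) auto
    finally show ?thesis .
  qed
qed

text \<open>One q-Laplace transformation.  The function is holomorphic along the spiral of lam and the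
  equation controls its growth there, so the transform exists near 0; it solves the transformed
  equation, which in turn continues it to the punctured plane, and its expansion is the transform
  of the old one.\<close>
lemma level_step:
  fixes p lam :: complex and I :: "'i set"
  assumes p: "norm p > 1" and lam: "lam \<noteq> 0"
    and R: "finite R" "0 \<notin> R" "- lam \<in> R" and lamR: "lam \<notin> spirals p R"
    and sol: "solves_level p lam R I cf dg ex b c s \<phi> V \<rho> L M"
    and top: "top_part I cf dg ex E a"
    and deg: "\<And>i. i \<in> I \<Longrightarrow> int (dg i) + ex i \<le> int (degree a) + E"
    and cf': "\<And>i. i \<in> I \<Longrightarrow> cf' i = cf i * p ^ (dg i choose 2)"
    and ex': "\<And>i. i \<in> I \<Longrightarrow> ex' i = int (dg i) + ex i"
    and b': "\<And>j. coeff b' j = coeff b j * p ^ (j choose 2)"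
    and c': "\<And>j. c' j = c j * p ^ (j choose 2)"
    and R': "finite R'" "0 \<notin> R'" "- lam \<in> R'"
    and top': "top_part I cf' dg ex' E' a'" and root': "\<And>z. z \<noteq> 0 \<Longrightarrow> poly a' z = 0 \<Longrightarrow> z \<in> R'"
  defines "u \<equiv> \<lambda>l. \<phi> (p powi l * lam)"
  shows "\<exists>\<phi>' \<rho>' L' M'. solves_level p lam R' I cf' dg ex' b' c' (Suc s) \<phi>'
           (\<lambda>z. laplace_num p u (z / lam)) \<rho>' L' M'"
proof -
  have p0: "p \<noteq> 0" using p by auto
  define P where "P = norm p"
  have P: "P > 1" using p by (simp add: P_def)
  have fin: "finite I" using top by (simp add: top_part_def)
  have eq: "\<And>z. z \<in> - {0} - spirals p R \<Longrightarrow> qop p I cf dg ex \<phi> z = poly b z"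
    and rho: "\<rho> > 0" and L: "L \<ge> 0" and M: "M \<ge> 1"
    and Veq: "\<And>z. z \<in> ball 0 \<rho> - {0} - spirals p R \<Longrightarrow> \<phi> z * theta p (z / lam) = V z"
    and cb: "\<And>i. norm (c i) \<le> L * M ^ i * P ^ (s * (i choose 2))"
    and asy: "\<And>k z. z \<in> ball 0 \<rho> - {0} \<Longrightarrow> norm (V z - theta p (z / lam) * (\<Sum>i<k. c i * z ^ i)) \<le>
        L * M ^ k * P ^ (s * (k choose 2)) * norm z ^ k * theta P (norm (z / lam))"
    using sol by (auto simp: solves_level_def P_def)
  have onsp: "p powi l * lam \<in> - {0} - spirals p R" for l
    using lam p0 lamR by (auto simp: spirals_powi[OF p0])
  have lamS: "compact {lam}" "{lam} \<subseteq> - {0} - spirals p R" using lam lamR by auto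
  obtain A K where A: "A \<ge> 0" "K \<ge> 1" "\<And>n y. y \<in> {lam} \<Longrightarrow> norm (\<phi> (y / p ^ n)) \<le> A"
    "\<And>n y. y \<in> {lam} \<Longrightarrow> norm (\<phi> (p ^ n * y)) \<le> A * K ^ n * norm p ^ (n choose 2)"
    using solves_level_growth[OF p lam R(3) sol top deg lamS] by blast
  have gr0: "laplace_growth p A K u"
    unfolding laplace_growth_def
  proof (intro conjI allI impI A)
    fix l :: int assume "l \<le> 0"
    define n where "n = nat (- l)"
    have "l = - int n" using \<open>l \<le> 0\<close> by (simp add: n_def)
    hence "u l = \<phi> (lam / p ^ n)" by (simp add: u_def power_int_minus divide_inverse mult.commute)
    thus "norm (u l) \<le> A" using A(3)[of lam n] by simp
  next
    fix n
    show "norm (u (int n)) \<le> A * K ^ n * norm p ^ (n choose 2)" using A(4)[of lam n] by (simp add: u_def)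
  qed
  \<comment> \<open>The constant quotient of the real theta function and |theta| along the spiral through 1.\<close>
  define th1 where "th1 = theta P 1 / norm (theta p 1)"
  have th1: "th1 \<ge> 1"
  proof -
    have "norm (theta p 1) \<le> theta P 1" using norm_theta_le[OF p, of 1] by (simp add: P_def)
    moreover have "norm (theta p 1) > 0" using theta_powi_nz[OF p, of 0] by simp
    ultimately show ?thesis by (simp add: th1_def)
  qed
  define la where "la = max 1 (norm lam)"
  define M1 where "M1 = max K (M * la)"
  define L1 where "L1 = L * th1"
  have M1: "M1 \<ge> 1" "K \<le> M1" "M * la \<le> M1" "M \<le> M1" and la: "la \<ge> 1"
  proof -
    show la: "la \<ge> 1" by (simp add: la_def)
    show "K \<le> M1" "M * la \<le> M1" by (auto simp: M1_def)
    thus "M1 \<ge> 1" using A(2) by linarith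
    have "M * 1 \<le> M * la" using M la by (intro mult_left_mono) auto
    thus "M \<le> M1" using \<open>M * la \<le> M1\<close> by linarith
  qed
  have gr: "laplace_growth p A M1 u" by (rule laplace_growth_mono[OF gr0 order_refl M1(2)])
  have L1: "L1 \<ge> 0" using L th1 by (simp add: L1_def)
  have lamk: "norm lam ^ k * M ^ k \<le> M1 ^ k" for k
  proof -
    have "norm lam * M \<le> la * M" using M by (intro mult_right_mono) (auto simp: la_def)
    hence "norm lam * M \<le> M1" using M1(3) mult.commute[of M la] by linarith
    hence "(norm lam * M) ^ k \<le> M1 ^ k" using M by (intro power_mono) auto
    thus ?thesis by (simp add: power_mult_distrib)
  qed
  define cl where "cl = (\<lambda>i. c i * lam ^ i)"
  have clb: "norm (cl i) \<le> L1 * M1 ^ i * P ^ (s * (i choose 2))" for i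
  proof -
    have "norm (cl i) \<le> (L * M ^ i * P ^ (s * (i choose 2))) * norm lam ^ i"
      unfolding cl_def norm_mult norm_power using cb by (rule mult_right_mono) auto
    also have "\<dots> = L * (norm lam ^ i * M ^ i) * P ^ (s * (i choose 2))" by (simp only: mult_ac)
    also have "\<dots> \<le> L1 * M1 ^ i * P ^ (s * (i choose 2))"
    proof (intro mult_right_mono mult_mono lamk)
      show "L \<le> L1" unfolding L1_def using mult_left_mono[OF th1 L] by simp
    qed (use L1 M P in auto)
    finally show ?thesis .
  qed
  obtain N where N: "norm lam / \<rho> < P ^ N" using real_arch_pow[OF P] by blast
  have as: "norm (u l - (\<Sum>i<k. cl i * p powi (l * int i))) \<le>
      L1 * M1 ^ k * norm p ^ (s * (k choose 2)) * norm p powi (l * int k)"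
    if l: "l \<le> - int N" for k l
  proof -
    define z where "z = p powi l * lam"
    define n where "n = nat (- l)"
    have n: "l = - int n" "n \<ge> N" using l by (auto simp: n_def)
    have nz: "norm z = norm lam / P ^ n"
      by (simp add: z_def n norm_mult norm_power_int power_int_minus P_def divide_inverse mult.commute norm_inverse norm_power)
    have "norm lam < P ^ N * \<rho>" using N rho by (simp add: divide_less_eq)
    also have "\<dots> \<le> P ^ n * \<rho>" using P n rho by (intro mult_right_mono power_increasing) auto
    finally have "norm z < \<rho>" unfolding nz using P by (simp add: divide_less_eq mult.commute)
    hence z: "z \<in> ball 0 \<rho> - {0} - spirals p R" using onsp[of l] by (auto simp: z_def)
    have zl: "z / lam = p powi l * 1" using lam by (simp add: z_def)
    obtain r where r: "r > 0" "norm (theta p (z / lam)) = r * norm (theta p 1)"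
        "theta P (norm (z / lam)) = r * theta P 1"
      unfolding zl P_def using theta_shift_norm[OF p, of 1 l] by (metis norm_one one_neq_zero)
    have t1: "norm (theta p 1) > 0" using theta_powi_nz[OF p, of 0] by simp
    have sumeq: "(\<Sum>i<k. cl i * p powi (l * int i)) = (\<Sum>i<k. c i * z ^ i)"
      unfolding cl_def z_def by (intro sum.cong refl) (simp add: power_mult_distrib power_int_mult)
    have "norm (u l - (\<Sum>i<k. c i * z ^ i)) * norm (theta p (z / lam)) =
        norm (V z - theta p (z / lam) * (\<Sum>i<k. c i * z ^ i))"
      using Veq[OF z] unfolding norm_mult[symmetric] by (simp add: u_def z_def algebra_simps)
    also have "\<dots> \<le> L * M ^ k * P ^ (s * (k choose 2)) * norm z ^ k * theta P (norm (z / lam))"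
      using z by (intro asy) auto
    finally have "r * (norm (u l - (\<Sum>i<k. c i * z ^ i)) * norm (theta p 1)) \<le>
        r * (L * M ^ k * P ^ (s * (k choose 2)) * norm z ^ k * theta P 1)"
      unfolding r by (simp only: mult_ac)
    hence "norm (u l - (\<Sum>i<k. c i * z ^ i)) * norm (theta p 1) \<le>
        L * M ^ k * P ^ (s * (k choose 2)) * norm z ^ k * theta P 1" using r(1) by simp
    hence "norm (u l - (\<Sum>i<k. c i * z ^ i)) \<le> L * M ^ k * P ^ (s * (k choose 2)) * norm z ^ k * th1"
      using t1 by (simp add: th1_def le_divide_eq)
    also have "norm z ^ k = norm lam ^ k * P powi (l * int k)"
      by (simp add: z_def norm_mult norm_power_int power_mult_distrib power_int_mult P_def mult.commute)
    also have "L * M ^ k * P ^ (s * (k choose 2)) * (norm lam ^ k * P powi (l * int k)) * th1 =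
        L1 * (norm lam ^ k * M ^ k) * P ^ (s * (k choose 2)) * P powi (l * int k)"
      by (simp add: L1_def mult_ac)
    also have "\<dots> \<le> L1 * M1 ^ k * P ^ (s * (k choose 2)) * P powi (l * int k)"
      using L1 P by (intro mult_right_mono mult_left_mono lamk) auto
    finally show ?thesis unfolding sumeq P_def .
  qed
  define V' where "V' = (\<lambda>z. laplace_num p u (z / lam))"
  define f where "f = (\<lambda>z. V' z / theta p (z / lam))"
  define r where "r = norm lam / M1"
  have r: "r > 0" using lam M1(1) by (simp add: r_def)
  have V'hol: "V' holomorphic_on ball 0 r - {0}"
    unfolding V'_def
  proof (rule holomorphic_on_compose_gen[OF _ laplace_num_holomorphic[OF p gr], unfolded o_def])
    show "(\<lambda>z. z / lam) holomorphic_on ball 0 r - {0}" by (intro holomorphic_intros) (use lam in auto)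
    show "(\<lambda>z. z / lam) ` (ball 0 r - {0}) \<subseteq> ball 0 (1 / M1) - {0}"
      using lam M1(1) by (auto simp: r_def norm_divide field_simps)
  qed
  have thhol: "(\<lambda>z. theta p (z / lam)) holomorphic_on - {0}"
    by (rule holomorphic_on_compose_gen[OF _ theta_holomorphic[OF p], unfolded o_def])
       (use lam in \<open>auto intro!: holomorphic_intros\<close>)
  have fmero: "f meromorphic_on ball 0 r - {0}"
  proof -
    have o: "open (ball 0 r - {0 :: complex})" by auto
    have "V' meromorphic_on ball 0 r - {0}" "(\<lambda>z. theta p (z / lam)) meromorphic_on ball 0 r - {0}"
      using V'hol holomorphic_on_subset[OF thhol, of "ball 0 r - {0}"] analytic_on_open[OF o]
      by (auto intro!: analytic_on_imp_meromorphic_on)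
    thus ?thesis unfolding f_def by (rule meromorphic_on_divide)
  qed
  have fhol: "f holomorphic_on ball 0 r - {0} - spirals p R'"
    unfolding f_def
    by (intro holomorphic_on_divide holomorphic_on_subset[OF V'hol] holomorphic_on_subset[OF thhol])
       (use theta_nz_off_spiral[OF p lam R'(3)] in auto)
  define W where "W = 1 + (\<Sum>i\<in>I. norm (p powi (int (dg i) + ex i)))"
  have W: "W > 0" "\<And>i. i \<in> I \<Longrightarrow> norm (p powi (int (dg i) + ex i)) < W"
  proof -
    have s: "0 \<le> (\<Sum>i\<in>I. norm (p powi (int (dg i) + ex i)))" by (simp add: sum_nonneg)
    thus "W > 0" unfolding W_def by linarith
    fix i assume "i \<in> I"
    hence "norm (p powi (int (dg i) + ex i)) \<le> (\<Sum>i\<in>I. norm (p powi (int (dg i) + ex i)))"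
      using fin by (intro member_le_sum) auto
    thus "norm (p powi (int (dg i) + ex i)) < W" unfolding W_def by linarith
  qed
  \<comment> \<open>Small enough for the numerator to converge at all the shifted points.\<close>
  define r0 where "r0 = norm lam / (M1 * W)"
  have r0: "r0 > 0" using lam M1(1) W by (simp add: r0_def)
  have eq': "qop p I cf' dg ex' f z = poly b' z" if z: "z \<in> ball 0 r0 - {0} - spirals p R'" for z
  proof -
    have zn: "z \<noteq> 0" "norm z < r0" using z by auto
    have th: "theta p (z / lam) \<noteq> 0" using theta_nz_off_spiral[OF p lam R'(3), of z] z by auto
    have small: "M1 * norm (p powi (int (dg i) + ex i) * (z / lam)) < 1" if i: "i \<in> I" for i
    proof -
      have "M1 * norm (p powi (int (dg i) + ex i) * (z / lam)) =
          (M1 * norm (p powi (int (dg i) + ex i)) / norm lam) * norm z"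
        by (simp add: norm_mult norm_divide)
      also have "\<dots> \<le> (M1 * W / norm lam) * norm z"
        using W(2)[OF i] M1(1) lam by (intro mult_right_mono divide_right_mono mult_left_mono) auto
      also have "\<dots> < (M1 * W / norm lam) * r0"
        using zn(2) M1(1) W(1) lam by (intro mult_strict_left_mono) auto
      also have "\<dots> = 1" using M1(1) W(1) lam by (simp add: r0_def)
      finally show ?thesis .
    qed
    have sp: "(\<Sum>i\<in>I. cf i * (p powi l * lam) ^ dg i * u (l + ex i)) =
        (\<Sum>j\<le>degree b. coeff b j * (p powi l * lam) ^ j)" for l
    proof -
      have "(\<Sum>i\<in>I. cf i * (p powi l * lam) ^ dg i * u (l + ex i)) = qop p I cf dg ex \<phi> (p powi l * lam)"
        unfolding qop_def u_def using p0 by (intro sum.cong refl) (simp add: power_int_add mult_ac)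
      also have "\<dots> = poly b (p powi l * lam)" by (rule eq[OF onsp])
      finally show ?thesis by (simp add: poly_altdef)
    qed
    have "qop p I cf' dg ex' f z = (\<Sum>i\<in>I. cf i * p ^ (dg i choose 2) * z ^ dg i *
         f (p powi (int (dg i) + ex i) * z))"
      unfolding qop_def by (intro sum.cong refl) (simp add: cf' ex')
    also have "\<dots> = (\<Sum>j\<le>degree b. coeff b j * p ^ (j choose 2) * z ^ j)"
      unfolding f_def V'_def by (rule laplace_equation[OF p gr lam fin sp zn(1) th small])
    also have "\<dots> = poly b' z"
    proof -
      have "degree b' = degree b" by (rule degree_cong) (use p0 in \<open>simp add: b'\<close>)
      thus ?thesis by (simp add: poly_altdef b')
    qed
    finally show ?thesis .
  qed
  obtain F r' where F: "r' > 0" "r' \<le> r" "F meromorphic_on - {0}" "F holomorphic_on - {0} - spirals p R'"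
    "\<And>z. z \<in> ball 0 r' - {0} - spirals p R' \<Longrightarrow> F z = f z"
    "\<And>z. z \<in> - {0} - spirals p R' \<Longrightarrow> qop p I cf' dg ex' F z = poly b' z"
    by (rule qop_extension[OF p R'(1,2) r r0 top' root' fmero fhol _ eq'])
       (auto intro!: holomorphic_intros)
  define \<rho>' where "\<rho>' = min r' (norm lam / (2 * M1))"
  have \<rho>': "\<rho>' > 0" "\<rho>' \<le> r'" using F(1) lam M1(1) by (auto simp: \<rho>'_def)
  define L' where "L' = L1 + 3 * A"
  define M' where "M' = max 1 (max M (2 * M1 * P ^ N / norm lam))"
  have L': "L' \<ge> 0" "L \<le> L'"
  proof -
    have "L * 1 \<le> L * th1" using th1 L by (intro mult_left_mono) auto
    thus "L' \<ge> 0" "L \<le> L'" using L A(1) by (auto simp: L'_def L1_def)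
  qed
  have M': "M' \<ge> 1" "M \<le> M'" "2 * M1 * P ^ N / norm lam \<le> M'" by (auto simp: M'_def)
  have as': "norm (V' z - theta p (z / lam) * (\<Sum>i<k. c' i * z ^ i)) \<le>
        L' * M' ^ k * norm p ^ (Suc s * (k choose 2)) * norm z ^ k * theta (norm p) (norm (z / lam))"
    if z: "z \<in> ball 0 \<rho>' - {0}" for k z
  proof -
    define w where "w = z / lam"
    have w: "w \<noteq> 0" "z = lam * w" using z lam by (auto simp: w_def)
    have "norm z < norm lam / (2 * M1)" using z by (auto simp: \<rho>'_def)
    hence wM: "M1 * norm w \<le> 1 / 2" using lam M1(1) by (simp add: w_def norm_divide field_simps)
    have tpos: "theta P (norm w) \<ge> 0" using theta_real_ge_1[OF P, of "norm w"] w by auto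
    have "(\<Sum>i<k. c' i * z ^ i) = (\<Sum>i<k. cl i * p ^ (i choose 2) * w ^ i)"
      unfolding w(2) by (intro sum.cong refl) (simp add: c' cl_def power_mult_distrib mult_ac)
    hence "norm (V' z - theta p (z / lam) * (\<Sum>i<k. c' i * z ^ i)) =
        norm (laplace_num p u w - theta p w * (\<Sum>i<k. cl i * p ^ (i choose 2) * w ^ i))"
      by (simp add: V'_def w_def)
    also have "\<dots> \<le> (L1 + 3 * A) * (2 * M1 * norm p ^ N) ^ k * norm p ^ (Suc s * (k choose 2)) * norm w ^ k
      * theta (norm p) (norm w)"
      by (rule laplace_asymptotic[OF p gr L1 as clb[unfolded P_def] w(1) wM])
    also have "norm w ^ k = norm z ^ k * (1 / norm lam) ^ k"
      by (simp add: w_def norm_divide power_divide)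
    also have "(L1 + 3 * A) * (2 * M1 * norm p ^ N) ^ k * norm p ^ (Suc s * (k choose 2)) *
        (norm z ^ k * (1 / norm lam) ^ k) * theta (norm p) (norm w) =
       L' * (2 * M1 * P ^ N / norm lam) ^ k * P ^ (Suc s * (k choose 2)) * norm z ^ k * theta P (norm w)"
      unfolding L'_def P_def divide_inverse power_mult_distrib by (simp only: mult_ac mult_1 power_one)
    also have "\<dots> \<le> L' * M' ^ k * P ^ (Suc s * (k choose 2)) * norm z ^ k * theta P (norm w)"
      using M' L' P M1(1) tpos by (intro mult_right_mono mult_left_mono power_mono) auto
    finally show ?thesis by (simp add: P_def w_def)
  qed
  have cb': "norm (c' i) \<le> L' * M' ^ i * norm p ^ (Suc s * (i choose 2))" for i
  proof -
    have "norm (c' i) = norm (c i) * P ^ (i choose 2)" by (simp add: c' norm_mult norm_power P_def)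
    also have "\<dots> \<le> (L * M ^ i * P ^ (s * (i choose 2))) * P ^ (i choose 2)"
      using cb[of i] P by (intro mult_right_mono) auto
    also have "\<dots> \<le> (L' * M' ^ i * P ^ (s * (i choose 2))) * P ^ (i choose 2)"
      using L' L M M' P by (intro mult_right_mono mult_mono power_mono) auto
    finally show ?thesis by (simp add: P_def power_add mult_ac)
  qed
  have "solves_level p lam R' I cf' dg ex' b' c' (Suc s) F V' \<rho>' L' M'"
    unfolding solves_level_def
  proof (intro conjI ballI allI)
    show "V' holomorphic_on ball 0 \<rho>' - {0}"
      by (rule holomorphic_on_subset[OF V'hol]) (use \<rho>' F(2) in auto)
    fix z assume z: "z \<in> ball 0 \<rho>' - {0} - spirals p R'"
    hence "F z = f z" using \<rho>' by (intro F) auto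
    moreover have "theta p (z / lam) \<noteq> 0" using theta_nz_off_spiral[OF p lam R'(3), of z] z by auto
    ultimately show "F z * theta p (z / lam) = V' z" by (simp add: f_def)
  qed (use F \<rho>' L' M' as' cb' in auto)
  thus ?thesis unfolding V'_def by blast
qed

section \<open>The domain of the q-Laplace transformation\<close>

lemma frac_ints_image: "frac_ints N = range (\<lambda>j::int. of_int j / of_nat N)"
  by (auto simp: frac_ints_def)

lemma qpow_frac:
  assumes "N > 0"
  shows "qpow lq (of_real (of_int j / of_nat N)) = exp (lq / of_nat N) powi j"
  unfolding qpow_def exp_power_int by (simp add: field_simps)

text \<open>Combines the quasi-periodicity of theta with its symmetry under w \<mapsto> 1/w.\<close>
lemma q_laplace_term:
  fixes p w :: complex
  assumes p: "norm p > 1" and w: "w \<noteq> 0"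
  shows "x / theta p (p powi (j + 1) * (1 / w)) = (x * theta_coeff p j * w powi j) / theta p w"
proof -
  have p0: "p \<noteq> 0" using p by auto
  have "theta p (p powi (j + 1) * (1 / w)) = p powi tri (j + 1) * (1 / w) powi (j + 1) * (w * theta p w)"
    using theta_shift[OF p, of "1 / w" "j + 1"] w theta_inverse[OF p w] by simp
  also have "(1 / w) powi (j + 1) = 1 / (w powi j * w)"
    using w by (simp add: power_int_add power_int_divide_distrib)
  also have "p powi tri (j + 1) * (1 / (w powi j * w)) * (w * theta p w) = p powi tri (j + 1) / w powi j * theta p w"
    using w by simp
  finally have e: "theta p (p powi (j + 1) * (1 / w)) = p powi tri (j + 1) / w powi j * theta p w" .
  show ?thesis unfolding e theta_coeff_def using p0 w by (simp add: power_int_minus divide_inverse mult_ac)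
qed

lemma q_laplace_sum:
  fixes lam z :: complex
  assumes N: "N > 0" and p: "p = exp (lq / of_nat N)" "norm p > 1" and lam: "lam \<noteq> 0" and z: "z \<noteq> 0"
  shows "of_real (real N) / of_nat N *
        (\<Sum>\<^sub>\<infinity>l\<in>frac_ints N. F (qpow lq (of_real l) * lam) /
           q_theta (qpow lq (of_real (1 / real N))) (qpow lq (of_real (1 / real N + l)) * lam / z)) =
     laplace_num p (\<lambda>l. F (p powi l * lam)) (z / lam) / theta p (z / lam)"
proof -
  define w where "w = z / lam"
  have w: "w \<noteq> 0" using z lam by (simp add: w_def)
  have inj: "inj (\<lambda>j::int. real_of_int j / real N)" using N by (auto intro!: injI)
  have 1: "qpow lq (of_real (1 / real N)) = p" using qpow_frac[OF N, of lq 1] p(1) by simp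
  have 2: "qpow lq (of_real (1 / real N + of_int j / real N)) * lam / z = p powi (j + 1) * (1 / w)" for j
  proof -
    have "1 / real N + of_int j / real N = of_int (j + 1) / real N" by (simp add: add_divide_distrib)
    thus ?thesis using qpow_frac[OF N, of lq "j + 1"] p(1) by (simp add: w_def)
  qed
  have 3: "qpow lq (of_real (of_int j / real N)) = p powi j" for j
    using qpow_frac[OF N, of lq j] p(1) by simp
  have "(\<Sum>\<^sub>\<infinity>l\<in>frac_ints N. F (qpow lq (of_real l) * lam) /
           q_theta (qpow lq (of_real (1 / real N))) (qpow lq (of_real (1 / real N + l)) * lam / z)) =
        (\<Sum>\<^sub>\<infinity>j. F (p powi j * lam) / theta p (p powi (j + 1) * (1 / w)))"
    unfolding frac_ints_image infsum_reindex[OF inj] o_def q_theta_eq_theta 1 2 3 ..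
  also have "\<dots> = (\<Sum>\<^sub>\<infinity>j. (F (p powi j * lam) * theta_coeff p j * w powi j) * (1 / theta p w))"
    unfolding q_laplace_term[OF p(2) w] by simp
  also have "\<dots> = laplace_num p (\<lambda>l. F (p powi l * lam)) w * (1 / theta p w)"
    unfolding laplace_num_def by (rule infsum_cmult_left')
  finally show ?thesis using N by (simp add: w_def)
qed

lemma connected_int_chain:
  fixes A :: "int \<Rightarrow> 'a::topological_space set"
  assumes conn: "\<And>l. connected (A l)" and meet: "\<And>l. A l \<inter> A (l + 1) \<noteq> {}"
  shows "connected (\<Union>l. A l)"
proof -
  let ?U = "\<Union>l. A l"
  have cc: "connected_component ?U x y" if "x \<in> A l" "y \<in> A l" for x y l
    using conn[of l] that unfolding connected_component_def by blast
  obtain a0 where a0: "a0 \<in> A 0" using meet[of 0] by blast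
  have all: "\<forall>x\<in>A l. connected_component ?U a0 x" for l
  proof (induction l rule: int_induct[where k = 0])
    case base
    show ?case using cc a0 by blast
  next
    case (step1 i)
    obtain y where y: "y \<in> A i" "y \<in> A (i + 1)" using meet[of i] by blast
    show ?case
    proof
      fix x assume "x \<in> A (i + 1)"
      show "connected_component ?U a0 x"
        by (rule connected_component_trans[OF step1(2)[rule_format, OF y(1)] cc[OF y(2)]]) fact
    qed
  next
    case (step2 i)
    obtain y where y: "y \<in> A (i - 1)" "y \<in> A i" using meet[of "i - 1"] by auto
    show ?case
    proof
      fix x assume "x \<in> A (i - 1)"
      show "connected_component ?U a0 x"
        by (rule connected_component_trans[OF step2(2)[rule_format, OF y(2)] cc[OF y(1)]]) fact
    qed
  qed
  show ?thesis unfolding connected_iff_connected_component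
  proof (intro ballI)
    fix x y assume "x \<in> ?U" "y \<in> ?U"
    hence "connected_component ?U a0 x" "connected_component ?U a0 y" using all by blast+
    thus "connected_component ?U x y"
      using connected_component_trans[OF connected_component_sym] by blast
  qed
qed

text \<open>The spirals of R are countable, so lam and p * lam are joined by a path avoiding them.  A tubular
  neighbourhood of the path, together with all its images under powers of p, is a connected domain
  that contains the required discs around the points of the spiral, and it consists of the
  p-multiples of points of one compact set S.\<close>
lemma spiral_neighbourhood:
  fixes lam :: complex
  assumes p: "norm p > 1" and R: "finite R" "0 \<notin> R" and lam: "lam \<noteq> 0" "lam \<notin> spirals p R"
  obtains S \<Omega> \<epsilon> where "compact S" "S \<subseteq> - {0} - spirals p R" "open \<Omega>" "connected \<Omega>"
    "\<And>z. z \<in> \<Omega> \<Longrightarrow> \<exists>l y. y \<in> S \<and> z = p powi l * y" "\<epsilon> > 0"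
    "\<And>l z. norm (z - p powi l * lam) < \<epsilon> * norm (p powi l * lam) \<Longrightarrow> z \<in> \<Omega>"
proof -
  have p0: "p \<noteq> 0" using p by auto
  let ?X = "insert 0 (spirals p R)"
  have "path_connected (- ?X)"
    by (rule path_connected_complement_countable) (use spirals_countable[OF R(1), of p] in auto)
  moreover have "lam \<in> - ?X" "p * lam \<in> - ?X"
    using lam p0 spirals_powi[OF p0, of 1 lam R] by auto
  ultimately obtain g where g: "path g" "path_image g \<subseteq> - ?X" "pathstart g = lam" "pathfinish g = p * lam"
    unfolding path_connected_def by blast
  define G where "G = path_image g"
  have G: "compact G" "connected G" "lam \<in> G" "p * lam \<in> G"
    using g pathstart_in_path_image[of g] pathfinish_in_path_image[of g]
    by (auto simp: G_def compact_path_image connected_path_image)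
  have O: "open (- {0} - spirals p R)" by (rule spirals_open[OF p R]) auto
  have GO: "G \<subseteq> - {0} - spirals p R" using g(2) by (auto simp: G_def)
  obtain \<eta> where eta: "\<eta> > 0" "(\<Union>x\<in>G. cball x \<eta>) \<subseteq> - {0} - spirals p R"
    using compact_subset_open_imp_cball_epsilon_subset[OF G(1) O GO] by blast
  define T where "T = (\<Union>x\<in>G. ball x \<eta>)"
  have T_open: "open T" by (auto simp: T_def)
  have GT: "G \<subseteq> T" using eta(1) by (auto simp: T_def intro!: bexI)
  have T_conn: "connected T"
  proof -
    have cc: "connected_component T x y" if "x \<in> G" "y \<in> ball x \<eta>" for x y
      unfolding connected_component_def
      using that eta(1) by (intro exI[of _ "ball x \<eta>"]) (auto simp: T_def)
    have cG: "connected_component T x y" if "x \<in> G" "y \<in> G" for x y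
      unfolding connected_component_def using that G(2) GT by blast
    have base: "connected_component T lam y" if yT: "y \<in> T" for y
    proof -
      obtain x where x: "x \<in> G" "y \<in> ball x \<eta>" using yT unfolding T_def by blast
      show ?thesis using connected_component_trans[OF cG[OF G(3) x(1)] cc[OF x]] .
    qed
    show ?thesis unfolding connected_iff_connected_component
    proof (intro ballI)
      fix x y assume "x \<in> T" "y \<in> T"
      thus "connected_component T x y"
        by (rule connected_component_trans[OF connected_component_sym[OF base] base])
    qed
  qed
  define A where "A = (\<lambda>l::int. (\<lambda>z. p powi l * z) ` T)"
  have A_conn: "connected (A l)" for l
    unfolding A_def by (intro connected_continuous_image T_conn continuous_intros)
  have A_open: "open (A l)" for l
  proof -
    have "A l = (\<lambda>z. p powi (- l) * z) -` T"
    proof (intro equalityI subsetI)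
      fix z assume "z \<in> A l"
      thus "z \<in> (\<lambda>z. p powi (- l) * z) -` T"
        using p0 by (auto simp: A_def power_int_minus mult.assoc[symmetric])
    next
      fix z assume "z \<in> (\<lambda>z. p powi (- l) * z) -` T"
      hence "p powi l * (p powi (- l) * z) \<in> A l" by (auto simp: A_def)
      thus "z \<in> A l" using p0 by (simp add: power_int_minus mult.assoc[symmetric])
    qed
    moreover have "open ((\<lambda>z. p powi (- l) * z) -` T)"
      by (intro open_vimage T_open continuous_intros)
    ultimately show ?thesis by simp
  qed
  have A_meet: "A l \<inter> A (l + 1) \<noteq> {}" for l
  proof -
    have "p powi l * (p * lam) \<in> A l" using G(4) GT by (auto simp: A_def)
    moreover have "p powi (l + 1) * lam \<in> A (l + 1)" using G(3) GT by (auto simp: A_def)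
    moreover have "p powi l * (p * lam) = p powi (l + 1) * lam" using p0 by (simp add: power_int_add)
    ultimately show ?thesis by auto
  qed
  show ?thesis
  proof (rule that[of "\<Union>x\<in>G. cball x \<eta>" "\<Union>l. A l" "\<eta> / norm lam"])
    show "compact (\<Union>x\<in>G. cball x \<eta>)" by (rule compact_minkowski_sum_cball[OF G(1)])
    show "connected (\<Union>l. A l)" by (rule connected_int_chain) (rule A_conn, rule A_meet)
    show "\<exists>l y. y \<in> (\<Union>x\<in>G. cball x \<eta>) \<and> z = p powi l * y" if z: "z \<in> (\<Union>l. A l)" for z
    proof -
      obtain l y where "y \<in> T" "z = p powi l * y" using z by (auto simp: A_def)
      moreover have "T \<subseteq> (\<Union>x\<in>G. cball x \<eta>)" unfolding T_def by (intro UN_mono) auto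
      ultimately show ?thesis by blast
    qed
    show "\<eta> / norm lam > 0" using eta(1) lam by simp
    show "z \<in> (\<Union>l. A l)" if z: "norm (z - p powi l * lam) < \<eta> / norm lam * norm (p powi l * lam)" for l z
    proof -
      define y where "y = p powi (- l) * z"
      have y: "z = p powi l * y" using p0 by (simp add: y_def power_int_minus mult.assoc[symmetric])
      have "norm (p powi l) * norm (y - lam) = norm (z - p powi l * lam)"
        unfolding y norm_mult[symmetric] by (simp add: right_diff_distrib)
      also have "\<dots> < norm (p powi l) * \<eta>" using z lam by (simp add: norm_mult mult.commute)
      finally have "norm (y - lam) < \<eta>" using p0 by simp
      hence "y \<in> ball lam \<eta>" by (simp add: dist_norm norm_minus_commute)
      hence "y \<in> T" using G(3) by (auto simp: T_def)
      thus ?thesis unfolding y by (auto simp: A_def)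
    qed
  qed (use eta A_open in auto)
qed

lemma cosparse_subset:
  assumes "eventually P (cosparse A)" "B \<subseteq> A"
  shows "eventually P (cosparse B)"
  using assms unfolding eventually_cosparse by (meson sparse_in_subset)

lemma meromorphic_germ_eq_imp_germ:
  assumes "meromorphic_germ_eq f \<phi>" "\<phi> meromorphic_on - {0}"
  shows "f \<in> meromorphic_germs"
proof -
  obtain r where r: "r > 0" "\<forall>\<^sub>\<approx>z\<in>ball 0 r - {0}. f z = \<phi> z"
    using assms(1) by (auto simp: meromorphic_germ_eq_def)
  have "f meromorphic_on ball 0 r - {0} \<longleftrightarrow> \<phi> meromorphic_on ball 0 r - {0}"
    by (rule meromorphic_on_cong'[OF r(2) refl])
  moreover have "\<phi> meromorphic_on ball 0 r - {0}" using assms(2) by (rule meromorphic_on_subset) auto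
  ultimately show ?thesis using r(1) by (auto simp: meromorphic_germs_def)
qed

lemma norm_q_root:
  assumes "N > 0"
  shows "norm (exp lq) powr (1 / real N) = norm (exp (lq / of_nat N :: complex))"
proof -
  have "norm (exp lq) powr (1 / real N) = exp (Re lq / real N)"
    by (simp add: exp_powr_real)
  also have "Re (lq / of_nat N) = Re lq / real N"
    using Re_divide_of_real[of lq "real N"] by simp
  hence "exp (Re lq / real N) = norm (exp (lq / of_nat N :: complex))" by simp
  finally show ?thesis .
qed

text \<open>With x = K y / m \<ge> K, the term of index n of the theta series at P^n x equals
  x^n P^(n choose 2).\<close>
lemma theta_growth_bound:
  fixes P :: real
  assumes P: "P > 1" and m: "0 < m" "m \<le> y" and K: "K \<ge> 1"
  shows "theta P (K / m * (P powi l * y)) \<ge> (if l \<ge> 0 then K ^ nat l * P ^ (nat l choose 2) else 1)"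
proof (cases "l \<ge> 0")
  case True
  then obtain n where n: "l = int n" by (metis nonneg_int_cases)
  define x where "x = K / m * y"
  have x: "x \<ge> K" 
  proof -
    have "K * 1 \<le> K * (y / m)" using m K by (intro mult_left_mono) auto
    thus ?thesis by (simp add: x_def)
  qed
  have pos: "K / m * (P powi l * y) > 0" using P m K by (intro mult_pos_pos divide_pos_pos) auto
  have "theta_coeff P l * (K / m * (P powi l * y)) powi l \<le> theta P (K / m * (P powi l * y))"
    by (rule theta_real_ge_term[OF P pos])
  also have "K / m * (P powi l * y) = P ^ n * x" by (simp add: x_def n)
  also have "theta_coeff P l = 1 / (P ^ (n choose 2) * P ^ n)"
  proof -
    have "tri (int n + 1) = int ((n choose 2) + n)"
      using tri_add[of "int n" 1] by (simp add: tri_of_nat)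
    hence "theta_coeff P l = inverse (P ^ ((n choose 2) + n))"
      unfolding theta_coeff_def n by (simp only: power_int_minus power_int_of_nat)
    thus ?thesis by (simp add: power_add divide_inverse)
  qed
  also have "1 / (P ^ (n choose 2) * P ^ n) * (P ^ n * x) powi l = x ^ n * P ^ (n choose 2)"
  proof -
    have "2 * int (n choose 2) = int n * (int n - 1)" using two_tri[of "int n"] unfolding tri_of_nat .
    hence "int (n * n) = int ((n choose 2) + (n choose 2) + n)" by (simp add: algebra_simps)
    hence nn: "n * n = (n choose 2) + (n choose 2) + n" by (simp only: of_nat_eq_iff)
    have "(P ^ n * x) powi l = x ^ n * P ^ (n * n)" by (simp add: n power_mult_distrib power_mult)
    also have "\<dots> = x ^ n * P ^ (n choose 2) * (P ^ (n choose 2) * P ^ n)"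
      unfolding nn power_add by (simp only: mult_ac)
    finally show ?thesis using P by simp
  qed
  finally have "x ^ n * P ^ (n choose 2) \<le> theta P (P ^ n * x)" .
  moreover have "K ^ n * P ^ (n choose 2) \<le> x ^ n * P ^ (n choose 2)"
    using x K P by (intro mult_right_mono power_mono) auto
  moreover have "K / m * (P powi l * y) = P ^ n * x" by (simp add: x_def n)
  ultimately show ?thesis using True by (simp add: n)
next
  case False
  have "K / m * (P powi l * y) > 0" using P m K by (intro mult_pos_pos divide_pos_pos) auto
  thus ?thesis using False theta_real_ge_1[OF P] by simp
qed

lemma q_laplace_continuation_exists:
  assumes N: "N > 0" and pdef: "p = exp (lq / of_nat N)" and p: "norm p > 1" and lam: "lam \<noteq> 0"
    and R: "finite R" "0 \<notin> R" "- lam \<in> R" and lamR: "lam \<notin> spirals p R"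
    and sol: "solves_level p lam R I cf dg ex b c s \<phi> V \<rho> L M"
    and top: "top_part I cf dg ex E a"
    and deg: "\<And>i. i \<in> I \<Longrightarrow> int (dg i) + ex i \<le> int (degree a) + E"
    and f: "meromorphic_germ_eq f \<phi>"
  shows "q_laplace_continuation lq lam (real N) N f \<phi>"
proof -
  have p0: "p \<noteq> 0" using p by auto
  define P where "P = norm p"
  have P: "P > 1" using p by (simp add: P_def)
  have hol: "\<phi> holomorphic_on - {0} - spirals p R" using sol by (simp add: solves_level_def)
  obtain S \<Omega> \<epsilon> where S: "compact S" "S \<subseteq> - {0} - spirals p R" and \<Omega>: "open \<Omega>" "connected \<Omega>"
    "\<And>z. z \<in> \<Omega> \<Longrightarrow> \<exists>l y. y \<in> S \<and> z = p powi l * y" and \<epsilon>: "\<epsilon> > 0"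
    "\<And>l z. norm (z - p powi l * lam) < \<epsilon> * norm (p powi l * lam) \<Longrightarrow> z \<in> \<Omega>"
    using spiral_neighbourhood[OF p R(1,2) lam lamR] by blast
  obtain A K where A: "A \<ge> 0" "K \<ge> 1" "\<And>n y. y \<in> S \<Longrightarrow> norm (\<phi> (y / p ^ n)) \<le> A"
    "\<And>n y. y \<in> S \<Longrightarrow> norm (\<phi> (p ^ n * y)) \<le> A * K ^ n * norm p ^ (n choose 2)"
    using solves_level_growth[OF p lam R(3) sol top deg S] by blast
  have lam\<Omega>: "lam \<in> \<Omega>" using \<epsilon>(2)[of lam 0] \<epsilon>(1) lam by simp
  hence Sne: "S \<noteq> {}" using \<Omega>(3) by blast
  have contn: "continuous_on S (norm :: complex \<Rightarrow> real)" by (intro continuous_intros)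
  obtain y0 where y0: "y0 \<in> S" "\<And>y. y \<in> S \<Longrightarrow> norm y0 \<le> norm y"
    using continuous_attains_inf[OF S(1) Sne contn] by blast
  define m where "m = norm y0"
  have m: "m > 0" "\<And>y. y \<in> S \<Longrightarrow> m \<le> norm y" using y0 S(2) by (auto simp: m_def)
  have \<Omega>sub: "\<Omega> \<subseteq> - {0} - spirals p R"
  proof
    fix z assume "z \<in> \<Omega>"
    then obtain l y where "y \<in> S" "z = p powi l * y" using \<Omega>(3) by blast
    thus "z \<in> - {0} - spirals p R" using S(2) p0 spirals_powi[OF p0, of l y R] by auto
  qed
  have bound: "norm (\<phi> z) < (A + 1) * norm (q_theta (of_real (norm (exp lq) powr (1 / real N)))
      (of_real (K / m * norm z)))" if z: "z \<in> \<Omega>" for z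
  proof -
    obtain l y where y: "y \<in> S" "z = p powi l * y" using \<Omega>(3)[OF z] by blast
    have nz: "norm z = P powi l * norm y" by (simp add: y P_def norm_mult norm_power_int)
    have Kpos: "K / m * norm z > 0"
      unfolding nz using P m m(2)[OF y(1)] A(2) by (intro mult_pos_pos divide_pos_pos) auto
    define T where "T = theta P (K / m * norm z)"
    have T: "T \<ge> (if l \<ge> 0 then K ^ nat l * P ^ (nat l choose 2) else 1)" "T \<ge> 1"
      unfolding T_def using theta_growth_bound[OF P m(1) m(2)[OF y(1)] A(2), of l] nz
        theta_real_ge_1[OF P Kpos] by auto
    have "norm (\<phi> z) \<le> A * T"
    proof (cases "l \<ge> 0")
      case True
      then obtain n where n: "l = int n" by (metis nonneg_int_cases)
      have "norm (\<phi> z) \<le> A * (K ^ n * P ^ (n choose 2))" using A(4)[OF y(1), of n] by (simp add: y n P_def mult.assoc)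
      also have "\<dots> \<le> A * T" using T(1) A(1) by (intro mult_left_mono) (auto simp: n)
      finally show ?thesis .
    next
      case False
      define n where "n = nat (- l)"
      have "z = y / p ^ n" using False by (simp add: y n_def power_int_def divide_inverse power_inverse mult.commute)
      hence "norm (\<phi> z) \<le> A * 1" using A(3)[OF y(1), of n] by simp
      also have "\<dots> \<le> A * T" using T(2) A(1) by (intro mult_left_mono) auto
      finally show ?thesis .
    qed
    also have "A * T < (A + 1) * T" using T(2) by (simp add: distrib_right)
    also have "T = norm (q_theta (of_real (norm (exp lq) powr (1 / real N))) (of_real (K / m * norm z)))"
    proof -
      have e: "norm (exp lq) powr (1 / real N) = P" unfolding norm_q_root[OF N] P_def pdef ..
      have "q_theta (of_real P) (of_real (K / m * norm z)) = of_real T"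
        unfolding q_theta_eq_theta T_def by (rule theta_of_real[OF P Kpos])
      hence "norm (q_theta (of_real P) (of_real (K / m * norm z))) = \<bar>T\<bar>" by (simp only: norm_of_real)
      thus ?thesis unfolding e using T(2) by linarith
    qed
    finally show ?thesis .
  qed
  obtain r where r: "r > 0" "\<forall>\<^sub>\<approx>z\<in>ball 0 r - {0}. f z = \<phi> z"
    using f by (auto simp: meromorphic_germ_eq_def)
  have disc: "z \<in> \<Omega>" if lN: "l \<in> frac_ints N"
      and dz: "norm (z - lam * qpow lq (of_real l)) < \<epsilon> * norm (qpow lq (of_real l) * lam)" for l z
  proof -
    obtain j :: int where "l = of_int j / of_nat N" using lN unfolding frac_ints_image by blast
    hence "qpow lq (of_real l) = p powi j" using qpow_frac[OF N, of lq j] by (simp add: pdef)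
    thus ?thesis using dz \<epsilon>(2)[of z j] by (simp add: mult.commute)
  qed
  have an: "\<phi> analytic_on \<Omega>" using hol \<Omega>sub \<Omega>(1) by (simp add: analytic_on_open holomorphic_on_subset)
  have Km: "K / m > 0" using A(2) m(1) by simp
  have "\<forall>\<^sub>\<approx>z\<in>\<Omega> \<inter> (ball 0 r - {0}). f z = \<phi> z" using r(2) by (rule cosparse_subset) auto
  hence "\<exists>r>0. \<forall>\<^sub>\<approx>z\<in>\<Omega> \<inter> (ball 0 r - {0}). f z = \<phi> z" using r(1) by blast
  moreover have "\<exists>L>0. \<exists>M>0. \<forall>z\<in>\<Omega> - {0}.
           norm (\<phi> z) < L * norm (q_theta (of_real (norm (exp lq) powr (1 / real N)))
                                          (of_real (M * norm z)))"
    using bound Km A(1) by (intro exI[of _ "A + 1"] conjI exI[of _ "K / m"]) auto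
  moreover have "(\<Union>l\<in>frac_ints N. {z. z \<noteq> 0 \<and>
            norm (z - lam * qpow lq (of_real l)) < \<epsilon> * norm (qpow lq (of_real l) * lam)}) \<subseteq> \<Omega>"
    using disc by blast
  ultimately show ?thesis
    unfolding q_laplace_continuation_def using \<epsilon>(1) \<Omega>(1,2) an by blast
qed

text \<open>The definition of the transform chooses a continuation F.  Any such F agrees with the meromorphic
  function \<phi> near 0, where the domain of F contains points of the spiral, and hence by the identity
  theorem on the whole connected domain.\<close>
lemma q_laplace_continuation_unique:
  assumes N: "N > 0" and pdef: "p = exp (lq / of_nat N)" and p: "norm p > 1" and lam: "lam \<noteq> 0"
    and R: "finite R" "0 \<notin> R" and lamR: "lam \<notin> spirals p R"
    and mero: "\<phi> meromorphic_on - {0}" and hol: "\<phi> holomorphic_on - {0} - spirals p R"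
    and f: "meromorphic_germ_eq f \<phi>"
    and F: "q_laplace_continuation lq lam \<mu> N f F"
  shows "F (p powi l * lam) = \<phi> (p powi l * lam)"
proof -
  have p0: "p \<noteq> 0" using p by auto
  obtain \<epsilon> \<Omega> r where \<epsilon>: "\<epsilon> > 0" and \<Omega>: "open \<Omega>" "connected \<Omega>"
    "(\<Union>l\<in>frac_ints N. {z. z \<noteq> 0 \<and>
            norm (z - lam * qpow lq (of_real l)) < \<epsilon> * norm (qpow lq (of_real l) * lam)}) \<subseteq> \<Omega>"
    and Fan: "F analytic_on \<Omega>" and r: "r > 0" "\<forall>\<^sub>\<approx>z\<in>\<Omega> \<inter> (ball 0 r - {0}). f z = F z"
    using F unfolding q_laplace_continuation_def by blast
  obtain r1 where r1: "r1 > 0" "\<forall>\<^sub>\<approx>z\<in>ball 0 r1 - {0}. f z = \<phi> z"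
    using f by (auto simp: meromorphic_germ_eq_def)
  have sp: "p powi j * lam \<in> \<Omega> - {0}" for j
  proof -
    have "of_int j / of_nat N \<in> frac_ints N" by (auto simp: frac_ints_image)
    moreover have "qpow lq (of_real (of_int j / of_nat N)) = p powi j" using qpow_frac[OF N, of lq j] by (simp add: pdef)
    moreover have "p powi j * lam \<noteq> 0" using p0 lam by simp
    ultimately have "p powi j * lam \<in> (\<Union>l\<in>frac_ints N. {z. z \<noteq> 0 \<and>
            norm (z - lam * qpow lq (of_real l)) < \<epsilon> * norm (qpow lq (of_real l) * lam)})"
      using \<epsilon> by (intro UN_I[of "of_int j / of_nat N"]) (auto simp: mult.commute)
    thus ?thesis using \<Omega>(3) \<open>p powi j * lam \<noteq> 0\<close> by blast
  qed
  define g where "g = (\<lambda>z. F z - \<phi> z)"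
  have O: "open (\<Omega> - {0})" "connected (\<Omega> - {0})"
    using \<Omega>(1,2) by (auto intro!: connected_open_delete)
  have "g meromorphic_on \<Omega> - {0}"
    unfolding g_def
    by (intro meromorphic_on_diff analytic_on_imp_meromorphic_on analytic_on_subset[OF Fan]
          meromorphic_on_subset[OF mero]) auto
  hence alt: "(\<forall>\<^sub>\<approx>z\<in>\<Omega> - {0}. g z = 0) \<or> (\<forall>\<^sub>\<approx>z\<in>\<Omega> - {0}. g z \<noteq> 0)"
    by (rule meromorphic_imp_constant_or_avoid[OF _ O])
  have zero: "\<forall>\<^sub>\<approx>z\<in>\<Omega> - {0}. g z = 0"
  proof (rule ccontr)
    assume "\<not> ?thesis"
    with alt have ne: "\<forall>\<^sub>\<approx>z\<in>\<Omega> - {0}. g z \<noteq> 0" by blast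
    obtain n where n: "norm lam / min r r1 < norm p ^ n" using real_arch_pow[OF p] by blast
    define z0 where "z0 = p powi (- int n) * lam"
    have "norm lam < min r r1 * norm p ^ n" using n r(1) r1(1) by (simp add: pos_divide_less_eq mult.commute)
    moreover have "norm z0 * norm p ^ n = norm lam"
      using p0 by (simp add: z0_def norm_mult norm_power_int power_int_minus norm_power norm_inverse)
    ultimately have "norm z0 * norm p ^ n < min r r1 * norm p ^ n" by simp
    hence "norm z0 < min r r1" using p0 by simp
    hence z0: "z0 \<in> \<Omega> \<inter> (ball 0 r - {0})" "z0 \<in> ball 0 r1 - {0}" "z0 \<in> \<Omega> - {0}"
      using sp[of "- int n"] by (auto simp: z0_def)
    have "eventually (\<lambda>z. f z = F z) (at z0)" "eventually (\<lambda>z. f z = \<phi> z) (at z0)"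
      "eventually (\<lambda>z. g z \<noteq> 0) (at z0)"
      using eventually_cosparse_imp_eventually_at[OF r(2) z0(1)]
        eventually_cosparse_imp_eventually_at[OF r1(2) z0(2)]
        eventually_cosparse_imp_eventually_at[OF ne z0(3)] by auto
    hence "eventually (\<lambda>z. False) (at z0)" by eventually_elim (auto simp: g_def)
    thus False by (simp add: trivial_limit_def[symmetric])
  qed
  define z where "z = p powi l * lam"
  have z: "z \<in> \<Omega> - {0}" unfolding z_def by (rule sp)
  have zX: "z \<in> - {0} - spirals p R" using z lamR by (auto simp: z_def spirals_powi[OF p0])
  have "F analytic_on {z}" using Fan z by (auto intro: analytic_on_subset)
  hence cF: "isCont F z" by (rule analytic_at_imp_isCont)
  have "open (- {0} - spirals p R)" by (rule spirals_open[OF p R]) auto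
  hence "isCont \<phi> z" using holomorphic_on_imp_continuous_on[OF hol] zX
    by (simp add: continuous_on_eq_continuous_at)
  with cF have "(g \<longlongrightarrow> g z) (at z)" unfolding g_def by (intro tendsto_diff) (auto simp: isCont_def)
  moreover have "eventually (\<lambda>z. g z = 0) (at z)"
    using eventually_cosparse_imp_eventually_at[OF zero z] by auto
  hence "(g \<longlongrightarrow> 0) (at z)" by (rule tendsto_eventually)
  ultimately have "g z = 0" using LIM_unique by blast
  thus ?thesis by (simp add: g_def z_def)
qed

lemma q_laplace_stage:
  assumes N: "N > 0" and pdef: "p = exp (lq / of_nat N)" and p: "norm p > 1" and lam: "lam \<noteq> 0"
    and R: "finite R" "0 \<notin> R" "- lam \<in> R" and lamR: "lam \<notin> spirals p R"
    and sol: "solves_level p lam R I cf dg ex b c s \<phi> V \<rho> L M"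
    and top: "top_part I cf dg ex E a"
    and deg: "\<And>i. i \<in> I \<Longrightarrow> int (dg i) + ex i \<le> int (degree a) + E"
    and f: "meromorphic_germ_eq f \<phi>"
  shows "f \<in> q_laplace_dom lq lam (real N) N"
    and "z \<noteq> 0 \<Longrightarrow> q_laplace lq lam (real N) N f z =
           laplace_num p (\<lambda>l. \<phi> (p powi l * lam)) (z / lam) / theta p (z / lam)"
proof -
  have mero: "\<phi> meromorphic_on - {0}" and hol: "\<phi> holomorphic_on - {0} - spirals p R"
    using sol by (auto simp: solves_level_def)
  have ex: "q_laplace_continuation lq lam (real N) N f \<phi>"
    by (rule q_laplace_continuation_exists[OF N pdef p lam R lamR sol top deg f])
  show "f \<in> q_laplace_dom lq lam (real N) N"
    unfolding q_laplace_dom_def using ex meromorphic_germ_eq_imp_germ[OF f mero] by blast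
  define F where "F = (SOME F. q_laplace_continuation lq lam (real N) N f F)"
  have "q_laplace_continuation lq lam (real N) N f F"
    unfolding F_def by (rule someI[of "q_laplace_continuation lq lam (real N) N f", OF ex])
  hence eq: "F (p powi l * lam) = \<phi> (p powi l * lam)" for l
    by (rule q_laplace_continuation_unique[OF N pdef p lam R(1,2) lamR mero hol f])
  show "q_laplace lq lam (real N) N f z =
           laplace_num p (\<lambda>l. \<phi> (p powi l * lam)) (z / lam) / theta p (z / lam)" if z: "z \<noteq> 0"
    unfolding q_laplace_def Let_def F_def[symmetric] q_laplace_sum[OF N pdef p lam z] eq ..
qed

section \<open>Borel transforms of the equation\<close>

text \<open>Level t of the equation is the equation satisfied by the t-fold Borel transform of the formal
  solution: each transformation divides the coefficient of z^j by p^(j choose 2), and accordingly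
  takes the monomial operator z^d sigma^e to p^(-(d choose 2)) z^d sigma^(e - d).\<close>
definition level_coeff where "level_coeff p t cf dg i = cf i / p ^ (t * (dg i choose 2))" for cf :: "'i \<Rightarrow> complex"
definition level_shift :: "nat \<Rightarrow> ('i \<Rightarrow> nat) \<Rightarrow> ('i \<Rightarrow> int) \<Rightarrow> 'i \<Rightarrow> int" where
  "level_shift t dg ex i = ex i - int t * int (dg i)"
definition level_seq :: "complex \<Rightarrow> nat \<Rightarrow> (nat \<Rightarrow> complex) \<Rightarrow> nat \<Rightarrow> complex" where
  "level_seq p t c j = c j / p ^ (t * (j choose 2))"
definition level_poly :: "complex \<Rightarrow> nat \<Rightarrow> complex poly \<Rightarrow> complex poly" where
  "level_poly p t b = (\<Sum>j\<le>degree b. monom (level_seq p t (coeff b) j) j)"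

lemma coeff_level_poly: "coeff (level_poly p t b) j = level_seq p t (coeff b) j"
proof -
  have "coeff (level_poly p t b) j = (\<Sum>i\<le>degree b. if i = j then level_seq p t (coeff b) i else 0)"
    by (simp add: level_poly_def coeff_sum)
  also have "\<dots> = (if j \<le> degree b then level_seq p t (coeff b) j else 0)"
    by simp
  also have "\<dots> = level_seq p t (coeff b) j" by (simp add: level_seq_def coeff_eq_0)
  finally show ?thesis .
qed

lemma level_0: "level_coeff p 0 cf dg = cf" "level_shift 0 dg ex = ex" "level_seq p 0 c = c" "level_poly p 0 b = b"
  by (auto simp: level_coeff_def level_shift_def level_seq_def fun_eq_iff poly_eq_iff coeff_level_poly)

definition level_singularities :: "complex \<Rightarrow> complex poly \<Rightarrow> complex set" where
  "level_singularities lam a = insert (- lam) {z. z \<noteq> 0 \<and> poly a z = 0}"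

lemma level_singularities:
  assumes "a \<noteq> 0" "lam \<noteq> 0"
  shows "finite (level_singularities lam a)" "0 \<notin> level_singularities lam a" "- lam \<in> level_singularities lam a"
    "z \<noteq> 0 \<Longrightarrow> poly a z = 0 \<Longrightarrow> z \<in> level_singularities lam a"
  using assms poly_roots_finite[OF assms(1)] by (auto simp: level_singularities_def)

lemma lam_notin_level_spirals:
  assumes p: "norm p > 1" and lam: "lam \<noteq> 0"
    and no: "\<And>z. z \<noteq> 0 \<Longrightarrow> poly a z = 0 \<Longrightarrow> lam \<notin> spirals p {z}"
  shows "lam \<notin> spirals p (level_singularities lam a)"
proof
  assume "lam \<in> spirals p (level_singularities lam a)"
  then obtain k s where ks: "lam = p powi k * s" "s \<in> level_singularities lam a" by (auto simp: spirals_def)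
  show False
  proof (cases "s = - lam")
    case True
    hence "- (p powi k) = 1" using ks(1) lam by (metis minus_mult_commute mult_cancel_right2 mult_minus_left)
    thus False using minus_powi_neq_1[OF p] by blast
  next
    case False
    hence "s \<noteq> 0" "poly a s = 0" using ks(2) by (auto simp: level_singularities_def)
    moreover have "lam \<in> spirals p {s}" using ks(1) by (auto simp: spirals_def)
    ultimately show False using no by blast
  qed
qed

text \<open>The equation at each level provides the continuation that the next transformation needs.  The
  condition on lam starts at level 1 because no transformation is applied at level 0.\<close>
lemma level_chain:
  fixes p lam :: complex and I :: "'i set"
  assumes N: "N > 0" and pdef: "p = exp (lq / of_nat N)" and p: "norm p > 1" and lam: "lam \<noteq> 0"
    and top: "\<And>t. top_part I (level_coeff p t cf dg) dg (level_shift t dg ex) (E t) (a t)"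
    and deg: "\<And>t i. 1 \<le> t \<Longrightarrow> i \<in> I \<Longrightarrow> int (dg i) + level_shift t dg ex i \<le> int (degree (a t)) + E t"
    and gen: "\<And>t z. 1 \<le> t \<Longrightarrow> t \<le> T \<Longrightarrow> z \<noteq> 0 \<Longrightarrow> poly (a t) z = 0 \<Longrightarrow> lam \<notin> spirals p {z}"
  shows "t \<le> T \<Longrightarrow> solves_level p lam (level_singularities lam (a t)) I (level_coeff p t cf dg) dg (level_shift t dg ex)
           (level_poly p t b) (level_seq p t c) s \<phi> V \<rho> L M \<Longrightarrow> meromorphic_germ_eq f \<phi> \<Longrightarrow>
         q_laplaces_defined lq lam (replicate t (real N, N)) f \<and>
         (\<exists>\<phi>' V' \<rho>' L' M'. solves_level p lam (level_singularities lam (a 0)) I cf dg ex b c (s + t) \<phi>' V' \<rho>' L' M' \<and>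
            meromorphic_germ_eq (q_laplaces lq lam (replicate t (real N, N)) f) \<phi>')"
proof (induction t arbitrary: s \<phi> V \<rho> L M f)
  case 0
  have "solves_level p lam (level_singularities lam (a 0)) I cf dg ex b c s \<phi> V \<rho> L M"
    using 0(2) unfolding level_0 .
  thus ?case using 0(3)
    by (simp only: replicate_0 q_laplaces_defined.simps q_laplaces.simps add_0_right) blast
next
  case (Suc t)
  have p0: "p \<noteq> 0" using p by auto
  have a0: "a t \<noteq> 0" for t using top[of t] unfolding top_part_def by blast
  note R = level_singularities[OF a0 lam]
  note sol = Suc.prems(2) and f = Suc.prems(3)
  have lamR: "lam \<notin> spirals p (level_singularities lam (a (Suc t)))"
    by (rule lam_notin_level_spirals[OF p lam]) (use gen[of "Suc t"] Suc.prems(1) in auto)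
  have deg1: "int (dg i) + level_shift (Suc t) dg ex i \<le> int (degree (a (Suc t))) + E (Suc t)" if "i \<in> I" for i
    using deg[of "Suc t" i] that by simp
  note stage = q_laplace_stage[OF N pdef p lam R(1-3) lamR sol top deg1 f]
  define V' where "V' = (\<lambda>z. laplace_num p (\<lambda>l. \<phi> (p powi l * lam)) (z / lam))"
  have "\<exists>\<phi>' \<rho>' L' M'. solves_level p lam (level_singularities lam (a t)) I (level_coeff p t cf dg) dg (level_shift t dg ex)
     (level_poly p t b) (level_seq p t c) (Suc s) \<phi>' V' \<rho>' L' M'"
    unfolding V'_def
    by (rule level_step[OF p lam R(1-3) lamR sol top deg1 _ _ _ _ R(1-3) top R(4)])
       (use p0 in \<open>auto simp: level_coeff_def level_shift_def level_seq_def coeff_level_poly power_add algebra_simps\<close>)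
  then obtain \<phi>' \<rho>' L' M' where sol': "solves_level p lam (level_singularities lam (a t)) I (level_coeff p t cf dg) dg
     (level_shift t dg ex) (level_poly p t b) (level_seq p t c) (Suc s) \<phi>' V' \<rho>' L' M'" by blast
  define f' where "f' = q_laplace lq lam (real N) N f"
  have f': "meromorphic_germ_eq f' \<phi>'"
    unfolding meromorphic_germ_eq_def
  proof (intro exI conjI)
    show rho: "\<rho>' > 0" using sol' by (simp add: solves_level_def)
    have "spirals p (level_singularities lam (a t)) sparse_in ball 0 \<rho>' - {0}"
      using spirals_sparse[OF p R(1,2), of t] by (rule sparse_in_subset) auto
    hence "\<forall>\<^sub>\<approx>z\<in>ball 0 \<rho>' - {0}. z \<notin> spirals p (level_singularities lam (a t))"
      by (rule eventually_not_in_cosparse)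
    moreover have "\<forall>\<^sub>\<approx>z\<in>ball 0 \<rho>' - {0}. z \<in> ball 0 \<rho>' - {0}"
      by (rule eventually_in_cosparse) auto
    ultimately show "\<forall>\<^sub>\<approx>z\<in>ball 0 \<rho>' - {0}. f' z = \<phi>' z"
    proof eventually_elim
      case (elim z)
      have "theta p (z / lam) \<noteq> 0"
        using theta_nz_off_spiral[OF p lam R(3), of z t] elim by auto
      moreover have "\<phi>' z * theta p (z / lam) = V' z" using sol' elim by (auto simp: solves_level_def)
      ultimately have "\<phi>' z = V' z / theta p (z / lam)" by (simp add: eq_divide_eq)
      moreover have "f' z = V' z / theta p (z / lam)" unfolding f'_def V'_def
        by (rule stage(2)) (use elim in auto)
      ultimately show "f' z = \<phi>' z" by simp
    qed
  qed
  have "t \<le> T" using Suc.prems(1) by simp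
  from Suc.IH[OF this sol' f'] stage(1) show ?case by (simp add: f'_def)
qed

section \<open>Convergence after sufficiently many Borel transformations\<close>

text \<open>If among the monomials of least degree in z there is one, i0, whose shift is maximal among all
  monomials, the equation determines the coefficient c n by a recursion without loss: the other
  monomials of least degree (I1) contribute less by a factor |p|^n, and those of higher degree (I2)
  involve earlier coefficients with factors bounded relative to that of i0.\<close>
lemma power_series_coeff_bound:
  fixes c :: "nat \<Rightarrow> complex" and I :: "'i set"
  assumes p: "norm p > 1" and fin: "finite I" and i0: "i0 \<in> I" "cf i0 \<noteq> 0"
    and E: "\<And>i. i \<in> I \<Longrightarrow> ex i \<le> ex i0" and j0: "\<And>i. i \<in> I \<Longrightarrow> dg i0 \<le> dg i"
    and inj: "\<And>i. i \<in> I \<Longrightarrow> dg i = dg i0 \<Longrightarrow> ex i = ex i0 \<Longrightarrow> i = i0"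
    and rec: "\<And>l. (\<Sum>i\<in>I. if dg i \<le> l then cf i * p powi (ex i * int (l - dg i)) * c (l - dg i) else 0) = coeff b l"
  obtains L M where "L \<ge> 0" "M \<ge> 1" "\<And>n. norm (c n) \<le> L * M ^ n"
proof -
  have p0: "p \<noteq> 0" using p by auto
  define P where "P = norm p"
  have P: "P > 1" using p by (simp add: P_def)
  define I1 where "I1 = {i \<in> I. dg i = dg i0 \<and> i \<noteq> i0}"
  define I2 where "I2 = {i \<in> I. dg i > dg i0}"
  have Isplit: "I = insert i0 (I1 \<union> I2)" "i0 \<notin> I1 \<union> I2" "I1 \<inter> I2 = {}" "finite I1" "finite I2"
    using i0(1) j0 fin by (force simp: I1_def I2_def)+
  define Q where "Q = (\<Sum>i\<in>I1. norm (cf i))"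
  define k0 where "k0 = norm (cf i0)"
  have k0: "k0 > 0" using i0(2) by (simp add: k0_def)
  obtain n1 where n1: "2 * Q / k0 < P ^ n1" using real_arch_pow[OF P] by blast
  \<comment> \<open>From n0 on, the right-hand side vanishes and the monomials in I1 contribute at most half of the monomial i0.\<close>
  define n0 where "n0 = max n1 (Suc (degree b))"
  define W where "W = (\<Sum>i\<in>I2. norm (cf i) * P powi (- ex i0 * int (dg i - dg i0)))"
  have W0: "W \<ge> 0" unfolding W_def using P by (intro sum_nonneg mult_nonneg_nonneg) auto
  define M where "M = 1 + 2 * W / k0"
  have M: "M \<ge> 1" "2 * W / k0 \<le> M" using W0 k0 by (auto simp: M_def)
  define L where "L = (\<Sum>n<n0. norm (c n))"
  have L: "L \<ge> 0" by (simp add: L_def sum_nonneg)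
  have main: "norm (c n) \<le> L * M ^ n" for n
  proof (induction n rule: less_induct)
    case (less n)
    show ?case
    proof (cases "n < n0")
      case True
      have "norm (c n) \<le> L" unfolding L_def by (rule member_le_sum) (use True in auto)
      also have "L * 1 \<le> L * M ^ n" using L M by (intro mult_left_mono one_le_power) auto
      finally show ?thesis by simp
    next
      case False
      define l where "l = n + dg i0"
      define X where "X = P powi (ex i0 * int n)"
      have X: "X > 0" using P by (simp add: X_def)
      let ?t = "\<lambda>i. if dg i \<le> l then cf i * p powi (ex i * int (l - dg i)) * c (l - dg i) else 0"
      have "l > degree b" using False by (auto simp: n0_def l_def)
      hence "(\<Sum>i\<in>I. ?t i) = 0" using rec[of l] by (simp add: coeff_eq_0)
      hence "?t i0 + ((\<Sum>i\<in>I1. ?t i) + (\<Sum>i\<in>I2. ?t i)) = 0"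
        unfolding Isplit(1) using Isplit(2-5)
        by (subst (asm) sum.insert) (auto simp: sum.union_disjoint)
      hence eq: "?t i0 = - ((\<Sum>i\<in>I1. ?t i) + (\<Sum>i\<in>I2. ?t i))" by (simp only: eq_neg_iff_add_eq_0)
      have n0': "norm (?t i0) = k0 * X * norm (c n)"
        by (simp add: l_def norm_mult norm_power_int k0_def X_def P_def)
      have s1: "norm (\<Sum>i\<in>I1. ?t i) \<le> k0 / 2 * X * norm (c n)"
      proof -
        have "norm (\<Sum>i\<in>I1. ?t i) \<le> (\<Sum>i\<in>I1. norm (cf i) * (X / P ^ n) * norm (c n))"
        proof (rule sum_norm_le)
          fix i assume i: "i \<in> I1"
          hence "i \<in> I" "dg i = dg i0" "i \<noteq> i0" by (auto simp: I1_def)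
          hence "ex i < ex i0" using E[of i] inj[of i] by fastforce
          hence "ex i * int n \<le> (ex i0 - 1) * int n" by (intro mult_right_mono) auto
          hence "P powi (ex i * int n) \<le> P powi (ex i0 * int n - int n)"
            using P by (intro power_int_increasing) (auto simp: left_diff_distrib)
          also have "\<dots> = X / P ^ n" using P by (simp add: X_def power_int_diff)
          finally have "norm (cf i) * P powi (ex i * int n) * norm (c n) \<le> norm (cf i) * (X / P ^ n) * norm (c n)"
            by (intro mult_right_mono mult_left_mono) auto
          thus "norm (?t i) \<le> norm (cf i) * (X / P ^ n) * norm (c n)"
            using \<open>dg i = dg i0\<close> by (simp add: l_def norm_mult norm_power_int P_def)
        qed
        also have "\<dots> = Q / P ^ n * X * norm (c n)"
          by (simp add: Q_def sum_distrib_right sum_divide_distrib)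
        also have "\<dots> \<le> k0 / 2 * X * norm (c n)"
        proof -
          have "2 * Q / k0 \<le> P ^ n"
          proof -
            have "P ^ n1 \<le> P ^ n" using P False by (intro power_increasing) (auto simp: n0_def)
            thus ?thesis using n1 by linarith
          qed
          hence "Q / P ^ n \<le> k0 / 2" using k0 P by (simp add: field_simps)
          thus ?thesis using X by (intro mult_right_mono) auto
        qed
        finally show ?thesis .
      qed
      have s2: "norm (\<Sum>i\<in>I2. ?t i) \<le> W * X * (L * M ^ (n - 1))"
      proof -
        have "norm (\<Sum>i\<in>I2. ?t i) \<le> (\<Sum>i\<in>I2. (norm (cf i) * P powi (- ex i0 * int (dg i - dg i0))) * (X * (L * M ^ (n - 1))))"
        proof (rule sum_norm_le)
          fix i assume i: "i \<in> I2"
          hence iI: "i \<in> I" and dgi: "dg i > dg i0" by (auto simp: I2_def)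
          show "norm (?t i) \<le> (norm (cf i) * P powi (- ex i0 * int (dg i - dg i0))) * (X * (L * M ^ (n - 1)))"
          proof (cases "dg i \<le> l")
            case True
            define m where "m = l - dg i"
            have m: "m < n" "m = n - (dg i - dg i0)" "dg i - dg i0 \<le> n" "m \<le> n - 1"
              using True dgi by (auto simp: m_def l_def)
            have "ex i * int m \<le> ex i0 * int m" using E[OF iI] by (intro mult_right_mono) auto
            also have "ex i0 * int m = - ex i0 * int (dg i - dg i0) + ex i0 * int n"
              using m by (simp add: of_nat_diff algebra_simps)
            finally have "P powi (ex i * int m) \<le> P powi (- ex i0 * int (dg i - dg i0) + ex i0 * int n)"
              using P by (intro power_int_increasing) auto
            also have "\<dots> = P powi (- ex i0 * int (dg i - dg i0)) * X"
              unfolding X_def by (rule power_int_add) (use P in auto)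
            finally have 1: "P powi (ex i * int m) \<le> P powi (- ex i0 * int (dg i - dg i0)) * X" .
            have "norm (c m) \<le> L * M ^ m" by (rule less.IH[OF m(1)])
            also have "\<dots> \<le> L * M ^ (n - 1)" using L M m by (intro mult_left_mono power_increasing) auto
            finally have "norm (cf i) * P powi (ex i * int m) * norm (c m) \<le>
               norm (cf i) * (P powi (- ex i0 * int (dg i - dg i0)) * X) * (L * M ^ (n - 1))"
              using 1 X P by (intro mult_mono mult_left_mono) auto
            thus ?thesis using True by (simp add: m_def norm_mult norm_power_int P_def mult_ac)
          next
            case False
            thus ?thesis using X L M P by simp
          qed
        qed
        also have "\<dots> = W * (X * (L * M ^ (n - 1)))" by (simp only: W_def sum_distrib_right)
        finally show ?thesis by (simp only: mult.assoc)
      qed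
      have "k0 * X * norm (c n) \<le> norm (\<Sum>i\<in>I1. ?t i) + norm (\<Sum>i\<in>I2. ?t i)"
        unfolding n0'[symmetric] eq norm_minus_cancel by (rule norm_triangle_ineq)
      with s1 s2 have "k0 / 2 * X * norm (c n) \<le> W * X * (L * M ^ (n - 1))" by (simp add: field_simps)
      hence "X * (k0 / 2 * norm (c n)) \<le> X * (W * (L * M ^ (n - 1)))" by (simp only: mult_ac)
      hence "k0 / 2 * norm (c n) \<le> W * (L * M ^ (n - 1))" using X by simp
      hence "norm (c n) \<le> (2 * W / k0) * (L * M ^ (n - 1))" using k0 by (simp add: field_simps)
      also have "\<dots> \<le> M * (L * M ^ (n - 1))" using M L by (intro mult_right_mono) auto
      also have "\<dots> = L * M ^ n"
      proof -
        have "n > 0" using False by (auto simp: n0_def)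
        hence "M ^ n = M * M ^ (n - 1)" by (simp flip: power_Suc)
        thus ?thesis by simp
      qed
      finally show ?thesis .
    qed
  qed
  show ?thesis by (rule that[OF L M(1) main])
qed

text \<open>The convergent power series is itself the function at the highest level; its expansion is of
  Gevrey exponent 0 by the usual estimate of the Taylor remainder.  Taking V as the product with
  theta puts it into the form of the invariant.\<close>
lemma initial_level:
  fixes c :: "nat \<Rightarrow> complex" and I :: "'i set"
  assumes p: "norm p > 1" and lam: "lam \<noteq> 0" and R: "finite R" "0 \<notin> R" "- lam \<in> R"
    and top: "top_part I cf dg ex E a" and root: "\<And>z. z \<noteq> 0 \<Longrightarrow> poly a z = 0 \<Longrightarrow> z \<in> R"
    and L: "L \<ge> 0" and M: "M \<ge> 1" and c: "\<And>n. norm (c n) \<le> L * M ^ n"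
    and rec: "\<And>l. (\<Sum>i\<in>I. if dg i \<le> l then cf i * p powi (ex i * int (l - dg i)) * c (l - dg i) else 0) = coeff b l"
  shows "\<exists>\<phi> V \<rho> L' M'. solves_level p lam R I cf dg ex b c 0 \<phi> V \<rho> L' M' \<and>
           meromorphic_germ_eq (\<lambda>z. \<Sum>n. c n * z ^ n) \<phi>"
proof -
  have p0: "p \<noteq> 0" using p by auto
  have fin: "finite I" using top by (simp add: top_part_def)
  define F where "F = (\<lambda>z. \<Sum>n. c n * z ^ n)"
  have abs: "summable (\<lambda>n. norm (c n * z ^ n))" if z: "M * norm z < 1" for z
  proof (rule summable_comparison_test')
    show "summable (\<lambda>n. L * (M * norm z) ^ n)" using z M by (intro summable_mult summable_geometric) auto
    fix n
    have "norm (c n) * norm z ^ n \<le> L * M ^ n * norm z ^ n" using c by (rule mult_right_mono) auto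
    thus "norm (norm (c n * z ^ n)) \<le> L * (M * norm z) ^ n"
      by (simp add: norm_mult norm_power power_mult_distrib mult.assoc)
  qed
  have Fsums: "(\<lambda>n. c n * z ^ n) sums F z" if "M * norm z < 1" for z
    unfolding F_def using summable_norm_cancel[OF abs[OF that]] by (rule summable_sums)
  have small: "M * norm z < 1" if "z \<in> ball 0 (1 / M)" for z :: complex
    using that M by (simp add: field_simps)
  have Fhol: "F holomorphic_on ball 0 (1 / M)"
    by (rule power_series_holomorphic[where a = c]) (use Fsums small in simp)
  have rM: "1 / M > 0" using M by simp
  define W where "W = 1 + (\<Sum>i\<in>I. norm (p powi ex i))"
  have W: "W > 0" "\<And>i. i \<in> I \<Longrightarrow> norm (p powi ex i) < W"
  proof -
    have s: "0 \<le> (\<Sum>i\<in>I. norm (p powi ex i))" by (simp add: sum_nonneg)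
    thus "W > 0" unfolding W_def by linarith
    fix i assume "i \<in> I"
    hence "norm (p powi ex i) \<le> (\<Sum>i\<in>I. norm (p powi ex i))"
      using fin by (intro member_le_sum) auto
    thus "norm (p powi ex i) < W" unfolding W_def by linarith
  qed
  define r0 where "r0 = 1 / (M * W)"
  have r0: "r0 > 0" using M W by (simp add: r0_def)
  have eq: "qop p I cf dg ex F z = poly b z" if z: "norm z < r0" for z
  proof -
    have sm: "M * norm (p powi ex i * z) < 1" if i: "i \<in> I" for i
    proof -
      have "M * norm (p powi ex i * z) = (M * norm (p powi ex i)) * norm z" by (simp add: norm_mult)
      also have "\<dots> \<le> (M * W) * norm z" using W(2)[OF i] M by (intro mult_right_mono mult_left_mono) auto
      also have "\<dots> < (M * W) * r0" using z M W(1) by (intro mult_strict_left_mono) auto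
      also have "\<dots> = 1" using M W(1) by (simp add: r0_def)
      finally show ?thesis .
    qed
    have "(\<lambda>l. (if dg i \<le> l then cf i * p powi (ex i * int (l - dg i)) * c (l - dg i) else 0) * z ^ l)
        sums (cf i * z ^ dg i * F (p powi ex i * z))" if i: "i \<in> I" for i
    proof -
      let ?g = "\<lambda>l. (if dg i \<le> l then cf i * p powi (ex i * int (l - dg i)) * c (l - dg i) else 0) * z ^ l"
      have "(\<lambda>n. (cf i * z ^ dg i) * (c n * (p powi ex i * z) ^ n)) sums (cf i * z ^ dg i * F (p powi ex i * z))"
        by (intro sums_mult Fsums sm i)
      also have "(\<lambda>n. (cf i * z ^ dg i) * (c n * (p powi ex i * z) ^ n)) = (\<lambda>n. ?g (n + dg i))"
      proof
        fix n
        have "p powi (ex i * int n) = (p powi ex i) ^ n" unfolding power_int_mult by simp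
        thus "(cf i * z ^ dg i) * (c n * (p powi ex i * z) ^ n) = ?g (n + dg i)"
          by (simp add: power_mult_distrib power_add)
      qed
      finally have "(\<lambda>n. ?g (n + dg i)) sums (cf i * z ^ dg i * F (p powi ex i * z))" .
      moreover have "(\<Sum>l<dg i. ?g l) = 0" by (intro sum.neutral) auto
      ultimately show ?thesis using sums_iff_shift'[of ?g "dg i"] by (simp add: sums_iff_shift)
    qed
    hence "(\<lambda>l. \<Sum>i\<in>I. (if dg i \<le> l then cf i * p powi (ex i * int (l - dg i)) * c (l - dg i) else 0) * z ^ l)
        sums qop p I cf dg ex F z"
      unfolding qop_def by (intro sums_sum)
    hence "(\<lambda>l. coeff b l * z ^ l) sums qop p I cf dg ex F z"
      unfolding sum_distrib_right[symmetric] rec .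
    moreover have "(\<lambda>l. coeff b l * z ^ l) sums (\<Sum>l\<le>degree b. coeff b l * z ^ l)"
      by (rule sums_finite) (auto simp: coeff_eq_0)
    ultimately show ?thesis unfolding poly_altdef by (rule sums_unique2)
  qed
  have FX: "F holomorphic_on ball 0 (1 / M) - {0} - spirals p R"
    by (rule holomorphic_on_subset[OF Fhol]) auto
  have Fmero: "F meromorphic_on ball 0 (1 / M) - {0}"
    by (intro analytic_on_imp_meromorphic_on)
       (rule analytic_on_subset[of _ "ball 0 (1 / M)"], use Fhol in \<open>auto simp: analytic_on_open\<close>)
  obtain \<phi> r' where \<phi>: "r' > 0" "r' \<le> 1 / M" "\<phi> meromorphic_on - {0}" "\<phi> holomorphic_on - {0} - spirals p R"
    "\<And>z. z \<in> ball 0 r' - {0} - spirals p R \<Longrightarrow> \<phi> z = F z"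
    "\<And>z. z \<in> - {0} - spirals p R \<Longrightarrow> qop p I cf dg ex \<phi> z = poly b z"
    by (rule qop_extension[OF p R(1,2) rM r0 top root Fmero FX, of "poly b"])
       (use eq in \<open>auto intro!: holomorphic_intros\<close>)
  define \<rho> where "\<rho> = min r' (1 / (2 * M))"
  have \<rho>: "\<rho> > 0" "\<rho> \<le> r'" using \<phi>(1) M by (auto simp: \<rho>_def)
  define V where "V = (\<lambda>z. F z * theta p (z / lam))"
  have thhol: "(\<lambda>z. theta p (z / lam)) holomorphic_on - {0}"
    by (rule holomorphic_on_compose_gen[OF _ theta_holomorphic[OF p], unfolded o_def])
       (use lam in \<open>auto intro!: holomorphic_intros\<close>)
  have as: "norm (V z - theta p (z / lam) * (\<Sum>i<k. c i * z ^ i)) \<le>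
        2 * L * M ^ k * norm p ^ (0 * (k choose 2)) * norm z ^ k * theta (norm p) (norm (z / lam))"
    if z: "z \<in> ball 0 \<rho> - {0}" for k z
  proof -
    have "norm z < 1 / (2 * M)" using z by (auto simp: \<rho>_def)
    hence zM: "M * norm z < 1 / 2" using M by (simp add: field_simps)
    hence zM1: "M * norm z < 1" by simp
    have "(\<lambda>n. c (n + k) * z ^ (n + k)) sums (F z - (\<Sum>i<k. c i * z ^ i))"
      using Fsums[OF zM1] sums_iff_shift[of "\<lambda>n. c n * z ^ n" k "F z - (\<Sum>i<k. c i * z ^ i)"] by simp
    hence "F z - (\<Sum>i<k. c i * z ^ i) = (\<Sum>n. c (n + k) * z ^ (n + k))" by (rule sums_unique)
    also have "norm \<dots> \<le> (\<Sum>n. L * (M * norm z) ^ k * (M * norm z) ^ n)"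
    proof (rule norm_suminf_le)
      show "summable (\<lambda>n. L * (M * norm z) ^ k * (M * norm z) ^ n)"
        using zM1 M by (intro summable_mult summable_geometric) auto
      fix n
      have "norm (c (n + k)) * norm z ^ (n + k) \<le> L * M ^ (n + k) * norm z ^ (n + k)"
        using c by (rule mult_right_mono) auto
      thus "norm (c (n + k) * z ^ (n + k)) \<le> L * (M * norm z) ^ k * (M * norm z) ^ n"
        by (simp add: norm_mult norm_power power_mult_distrib power_add mult_ac)
    qed
    also have "\<dots> = L * (M * norm z) ^ k * (1 / (1 - M * norm z))"
      using zM1 M by (subst suminf_mult) (auto intro!: summable_geometric simp: suminf_geometric)
    also have "\<dots> \<le> L * (M * norm z) ^ k * 2"
      using zM L M by (intro mult_left_mono) (auto simp: divide_le_eq)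
    finally have 1: "norm (F z - (\<Sum>i<k. c i * z ^ i)) \<le> 2 * L * M ^ k * norm z ^ k"
      by (simp add: power_mult_distrib mult_ac)
    have 2: "norm (theta p (z / lam)) \<le> theta (norm p) (norm (z / lam))"
      using norm_theta_le[OF p, of "z / lam"] z lam by auto
    have "V z - theta p (z / lam) * (\<Sum>i<k. c i * z ^ i) = (F z - (\<Sum>i<k. c i * z ^ i)) * theta p (z / lam)"
      by (simp add: V_def algebra_simps)
    also have "norm \<dots> \<le> (2 * L * M ^ k * norm z ^ k) * theta (norm p) (norm (z / lam))"
      unfolding norm_mult using 1 2 L M by (intro mult_mono) auto
    finally show ?thesis by simp
  qed
  have "solves_level p lam R I cf dg ex b c 0 \<phi> V \<rho> (2 * L) M"
    unfolding solves_level_def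
  proof (intro conjI ballI allI)
    show "V holomorphic_on ball 0 \<rho> - {0}" unfolding V_def
      by (intro holomorphic_intros holomorphic_on_subset[OF Fhol] holomorphic_on_subset[OF thhol])
         (use \<rho> \<phi>(2) in auto)
    show "norm (c i) \<le> 2 * L * M ^ i * norm p ^ (0 * (i choose 2))" for i
    proof -
      have "L * M ^ i \<ge> 0" using L M by simp
      thus ?thesis using c[of i] by simp
    qed
  qed (use \<phi> \<rho> L M as in \<open>auto simp: V_def\<close>)
  moreover have "meromorphic_germ_eq F \<phi>"
    unfolding meromorphic_germ_eq_def
  proof (intro exI conjI)
    show "r' > 0" by fact
    have "spirals p R sparse_in ball 0 r' - {0}"
      using spirals_sparse[OF p R(1,2)] by (rule sparse_in_subset) auto
    hence "\<forall>\<^sub>\<approx>z\<in>ball 0 r' - {0}. z \<notin> spirals p R"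
      by (rule eventually_not_in_cosparse)
    moreover have "\<forall>\<^sub>\<approx>z\<in>ball 0 r' - {0}. z \<in> ball 0 r' - {0}"
      by (rule eventually_in_cosparse) auto
    ultimately show "\<forall>\<^sub>\<approx>z\<in>ball 0 r' - {0}. F z = \<phi> z"
      by eventually_elim (use \<phi>(5) in auto)
  qed
  ultimately show ?thesis unfolding F_def by blast
qed

section \<open>Properties of the sum\<close>

text \<open>The invariant determines \<phi> only up to its values on the discrete spirals, so the sum is the
  function with its removable singularities removed.  Near 0 it equals V divided by
  theta p (z / lam).  The lower bound for theta turns the expansion of V into the expansion of the
  quotient away from the spiral of -lam, and since the zeros of theta are simple and lie on that
  spiral, so do the poles.\<close>
lemma level_0_solution:
  assumes N: "N > 0" and pdef: "p = exp (lq / of_nat N)" and p: "norm p > 1" and lam: "lam \<noteq> 0"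
    and R: "finite R" "0 \<notin> R" "- lam \<in> R" and T: "T > 0"
    and sol: "solves_level p lam R I cf dg ex b (fps_nth h) T \<phi> V \<rho> L M"
  defines "S \<equiv> remove_sings \<phi>"
  shows "S nicely_meromorphic_on - {0}" "meromorphic_germ_eq S \<phi>"
    "\<forall>\<^sub>\<approx>z\<in>- {0}. qop p I cf dg ex S z = poly b z"
    "q_asymptotic lq lam (real N / real T) N S h"
    "\<exists>\<rho>>0. \<forall>z. 0 < norm z \<and> norm z < \<rho> \<and> is_pole S z \<longrightarrow>
        zorder S z \<ge> -1 \<and> (\<exists>l\<in>frac_ints N. z = - lam * qpow lq (of_real l))"
proof -
  have p0: "p \<noteq> 0" using p by auto
  have mero: "\<phi> meromorphic_on - {0}" and hol: "\<phi> holomorphic_on - {0} - spirals p R"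
    and eq: "\<And>z. z \<in> - {0} - spirals p R \<Longrightarrow> qop p I cf dg ex \<phi> z = poly b z"
    and rho: "\<rho> > 0" and Vhol: "V holomorphic_on ball 0 \<rho> - {0}"
    and V: "\<And>z. z \<in> ball 0 \<rho> - {0} - spirals p R \<Longrightarrow> \<phi> z * theta p (z / lam) = V z"
    and L: "L \<ge> 0" and M: "M \<ge> 1"
    and as: "\<And>k z. z \<in> ball 0 \<rho> - {0} \<Longrightarrow> norm (V z - theta p (z / lam) * (\<Sum>i<k. fps_nth h i * z ^ i)) \<le>
        L * M ^ k * norm p ^ (T * (k choose 2)) * norm z ^ k * theta (norm p) (norm (z / lam))"
    using sol by (auto simp: solves_level_def)
  have X_open: "open (- {0} - spirals p R)" by (rule spirals_open[OF p R(1,2)]) auto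
  have S_eq: "S z = \<phi> z" if "z \<in> - {0} - spirals p R" for z
  proof -
    have "\<phi> analytic_on {z}" using hol that X_open analytic_at by blast
    thus ?thesis unfolding S_def by (rule remove_sings_at_analytic)
  qed
  show "S nicely_meromorphic_on - {0}" unfolding S_def by (rule remove_sings_nicely_meromorphic[OF mero])
  have ev_eq: "\<forall>\<^sub>\<approx>z\<in>- {0}. S z = \<phi> z" unfolding S_def by (rule eventually_remove_sings_eq[OF mero])
  show "meromorphic_germ_eq S \<phi>"
    unfolding meromorphic_germ_eq_def
    by (intro exI[of _ 1] conjI cosparse_subset[OF ev_eq]) auto
  have offX: "\<forall>\<^sub>\<approx>z\<in>- {0}. z \<notin> spirals p R"
    by (rule eventually_not_in_cosparse[OF spirals_sparse[OF p R(1,2)]])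
  have off0: "\<forall>\<^sub>\<approx>z\<in>- {0}. z \<in> - {0 :: complex}" by (rule eventually_in_cosparse) auto
  show "\<forall>\<^sub>\<approx>z\<in>- {0}. qop p I cf dg ex S z = poly b z"
    using offX off0
  proof eventually_elim
    case (elim z)
    have "S (p powi k * z) = \<phi> (p powi k * z)" for k
      by (rule S_eq) (use elim p0 spirals_powi[OF p0] in auto)
    hence "qop p I cf dg ex S z = qop p I cf dg ex \<phi> z" by (simp add: qop_def)
    thus ?case using eq[of z] elim by simp
  qed
  have thhol: "(\<lambda>z. theta p (z / lam)) holomorphic_on - {0}"
    by (rule holomorphic_on_compose_gen[OF _ theta_holomorphic[OF p], unfolded o_def])
       (use lam in \<open>auto intro!: holomorphic_intros\<close>)
  have ball_open: "open (ball 0 \<rho> - {0 :: complex})" by auto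
  have ev_quot: "eventually (\<lambda>z. \<phi> z = V z / theta p (z / lam) \<and> S z = V z / theta p (z / lam)
       \<and> theta p (z / lam) \<noteq> 0) (at z0)" if z0: "z0 \<in> ball 0 \<rho> - {0}" for z0
  proof -
    have "eventually (\<lambda>z. z \<notin> spirals p R) (at z0)"
      using eventually_cosparse_imp_eventually_at[OF offX, of z0 UNIV] z0 by simp
    moreover have "eventually (\<lambda>z. z \<in> ball 0 \<rho> - {0}) (at z0)"
      using eventually_at_in_open'[OF ball_open z0] .
    ultimately show ?thesis
    proof eventually_elim
      case (elim z)
      have th: "theta p (z / lam) \<noteq> 0" using theta_nz_off_spiral[OF p lam R(3), of z] elim by auto
      moreover have "\<phi> z * theta p (z / lam) = V z" using V[of z] elim by auto
      ultimately have "\<phi> z = V z / theta p (z / lam)" by (simp add: eq_divide_eq)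
      thus ?case using S_eq[of z] elim th by auto
    qed
  qed
  have quot_lim: "((\<lambda>z. V z / theta p (z / lam)) \<longlongrightarrow> V z0 / theta p (z0 / lam)) (at z0)"
    if z0: "z0 \<in> ball 0 \<rho> - {0}" "theta p (z0 / lam) \<noteq> 0" for z0
  proof -
    have "isCont V z0"
      by (rule continuous_on_eq_continuous_at[THEN iffD1, rule_format, OF ball_open
            holomorphic_on_imp_continuous_on[OF Vhol] z0(1)])
    moreover have "isCont (\<lambda>z. theta p (z / lam)) z0"
      by (rule continuous_on_eq_continuous_at[THEN iffD1, rule_format, OF _
            holomorphic_on_imp_continuous_on[OF thhol]]) (use z0 in auto)
    ultimately show ?thesis using z0(2) by (intro tendsto_divide) (auto simp: isCont_def)
  qed
  have SV: "S z = V z / theta p (z / lam)" if z: "z \<in> ball 0 \<rho> - {0}" "theta p (z / lam) \<noteq> 0" for z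
    unfolding S_def
  proof (rule remove_sings_eqI)
    have "eventually (\<lambda>z. V z / theta p (z / lam) = \<phi> z) (at z)"
      using ev_quot[OF z(1)] by eventually_elim auto
    with quot_lim[OF z] show "(\<phi> \<longlongrightarrow> V z / theta p (z / lam)) (at z)"
      by (rule Lim_transform_eventually)
  qed
  have asym: "\<exists>L>0. \<exists>M>0. \<forall>k. \<forall>z\<in>{z. z \<noteq> 0 \<and> cmod z < Rr} -
             (\<Union>l\<in>frac_ints N. {z. z \<noteq> 0 \<and>
                cmod (z + qpow lq (complex_of_real l) * lam) < \<epsilon> * cmod (qpow lq (complex_of_real l) * lam)}).
           cmod (S z - (\<Sum>i<k. fps_nth h i * z ^ i))
             < L * M ^ k * cmod (exp lq) powr (real k * (real k - 1) / (2 * (real N / real T))) * cmod z ^ k"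
    if er: "0 < \<epsilon>" "Rr < \<rho>" for \<epsilon> Rr
  proof -
    obtain c where c: "c > 0" and cw: "\<forall>w. w \<noteq> 0 \<longrightarrow> (\<forall>l::int. norm (w + p powi l) \<ge> \<epsilon> * norm (p powi l)) \<longrightarrow>
           norm (theta p w) \<ge> c * theta (norm p) (norm w)"
      using theta_lower_bound[OF p er(1)] by (elim exE conjE) (rule that)
    have ineq: "cmod (S z - (\<Sum>i<k. fps_nth h i * z ^ i))
             < (L / c + 1) * M ^ k * cmod (exp lq) powr (real k * (real k - 1) / (2 * (real N / real T))) * cmod z ^ k"
      if z: "z \<in> {z. z \<noteq> 0 \<and> cmod z < Rr} -
             (\<Union>l\<in>frac_ints N. {z. z \<noteq> 0 \<and>
                cmod (z + qpow lq (complex_of_real l) * lam) < \<epsilon> * cmod (qpow lq (complex_of_real l) * lam)})" for k z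
    proof -
      have "z \<noteq> 0" "cmod z < Rr" using DiffD1[OF z] by simp_all
      hence zb: "z \<in> ball 0 \<rho> - {0}" using er(2) by simp
      have z2: "\<forall>l\<in>frac_ints N. \<not> (z \<noteq> 0 \<and>
          cmod (z + qpow lq (complex_of_real l) * lam) < \<epsilon> * cmod (qpow lq (complex_of_real l) * lam))"
        using DiffD2[OF z] by (simp only: UN_iff mem_Collect_eq) blast
      have far: "norm (z / lam + p powi j) \<ge> \<epsilon> * norm (p powi j)" for j
      proof -
        have "of_int j / of_nat N \<in> frac_ints N" by (auto simp: frac_ints_image)
        hence "\<not> cmod (z + qpow lq (complex_of_real (of_int j / of_nat N)) * lam) <
            \<epsilon> * cmod (qpow lq (complex_of_real (of_int j / of_nat N)) * lam)"
          using z2 \<open>z \<noteq> 0\<close> by blast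
        hence h: "\<epsilon> * norm (p powi j * lam) \<le> norm (z + p powi j * lam)"
          unfolding qpow_frac[OF N, of lq j] pdef[symmetric] by simp
        have e: "z + p powi j * lam = (z / lam + p powi j) * lam" using lam by (simp add: distrib_right)
        have "(\<epsilon> * norm (p powi j)) * norm lam \<le> norm (z / lam + p powi j) * norm lam"
          using h unfolding e norm_mult by (simp only: mult.assoc)
        thus ?thesis using lam by simp
      qed
      have w0: "z / lam \<noteq> 0" using zb lam by auto
      define t where "t = theta (norm p) (norm (z / lam))"
      have t: "t \<ge> 1" unfolding t_def using w0 p by (intro theta_real_ge_1) auto
      have ct: "c * t \<le> norm (theta p (z / lam))" unfolding t_def using cw w0 far by blast
      have "c * t > 0" using c t by simp
      with ct have th: "theta p (z / lam) \<noteq> 0" by auto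
      define G where "G = M ^ k * norm p ^ (T * (k choose 2)) * norm z ^ k"
      have G: "G > 0" unfolding G_def using M p0 zb by simp
      have "norm (S z - (\<Sum>i<k. fps_nth h i * z ^ i)) * norm (theta p (z / lam)) =
          norm (V z - theta p (z / lam) * (\<Sum>i<k. fps_nth h i * z ^ i))"
        unfolding SV[OF zb th] norm_mult[symmetric] using th by (simp add: field_simps)
      also have "\<dots> \<le> L * G * t" using as[OF zb, of k] by (simp add: G_def t_def mult.assoc)
      finally have "norm (S z - (\<Sum>i<k. fps_nth h i * z ^ i)) * (c * t) \<le> L * G * t"
        using mult_left_mono[OF ct, of "norm (S z - (\<Sum>i<k. fps_nth h i * z ^ i))"] by simp
      hence "(norm (S z - (\<Sum>i<k. fps_nth h i * z ^ i)) * c) * t \<le> (L * G) * t" by (simp only: mult_ac)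
      hence "norm (S z - (\<Sum>i<k. fps_nth h i * z ^ i)) * c \<le> L * G" using t by simp
      hence le: "norm (S z - (\<Sum>i<k. fps_nth h i * z ^ i)) \<le> L / c * G" using c by (simp add: field_simps)
      have lt: "L / c * G < (L / c + 1) * G" using G by (simp add: distrib_right)
      have pw: "cmod (exp lq) powr (real k * (real k - 1) / (2 * (real N / real T))) = norm p ^ (T * (k choose 2))"
      proof -
        have "real_of_int (2 * int (k choose 2)) = real_of_int (int k * (int k - 1))"
          using two_tri[of "int k"] unfolding tri_of_nat by (rule arg_cong)
        hence kk: "real k * (real k - 1) = 2 * real (k choose 2)" by simp
        have e: "real k * (real k - 1) / (2 * (real N / real T)) = (1 / real N) * real (T * (k choose 2))"
          unfolding kk by simp
        have "cmod (exp lq) powr ((1 / real N) * real (T * (k choose 2))) =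
            (cmod (exp lq) powr (1 / real N)) powr real (T * (k choose 2))"
          by (rule powr_powr[symmetric])
        also have "\<dots> = norm p powr real (T * (k choose 2))" unfolding norm_q_root[OF N] pdef ..
        also have "\<dots> = norm p ^ (T * (k choose 2))" by (rule powr_realpow) (use p0 in simp)
        finally show ?thesis unfolding e .
      qed
      show ?thesis using le_less_trans[OF le lt] unfolding pw G_def by (simp only: mult.assoc)
    qed
    have Lc: "L / c + 1 > 0" using L c by (simp add: add_nonneg_pos)
    have Mpos: "M > 0" using M by simp
    show ?thesis
      by (rule exI[of _ "L / c + 1"], rule conjI[OF Lc], rule exI[of _ M], rule conjI[OF Mpos],
          intro allI ballI, rule ineq)
  qed
  show "q_asymptotic lq lam (real N / real T) N S h"
    unfolding q_asymptotic_def
    by (rule exI[of _ 1], rule conjI[OF zero_less_one], rule exI[of _ \<rho>], rule conjI[OF rho],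
        intro allI impI, rule asym) auto
  show "\<exists>\<rho>>0. \<forall>z. 0 < norm z \<and> norm z < \<rho> \<and> is_pole S z \<longrightarrow>
        zorder S z \<ge> -1 \<and> (\<exists>l\<in>frac_ints N. z = - lam * qpow lq (of_real l))"
  proof (rule exI[of _ \<rho>], intro conjI allI impI)
    show "\<rho> > 0" by fact
    fix z assume *: "0 < norm z \<and> norm z < \<rho> \<and> is_pole S z"
    hence z: "z \<in> ball 0 \<rho> - {0}" and pole: "is_pole S z" by auto
    have evS: "eventually (\<lambda>z. S z = V z / theta p (z / lam)) (at z)"
      using ev_quot[OF z] by eventually_elim auto
    have th: "theta p (z / lam) = 0"
    proof (rule ccontr)
      assume nz: "theta p (z / lam) \<noteq> 0"
      have "(S \<longlongrightarrow> V z / theta p (z / lam)) (at z)"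
        by (rule Lim_transform_eventually[OF quot_lim[OF z nz]]) (use evS in eventually_elim, auto)
      thus False using pole unfolding is_pole_def
        using not_tendsto_and_filterlim_at_infinity[of "at z" S] by simp
    qed
    have w0: "z / lam \<noteq> 0" using z lam by auto
    obtain j where j: "z / lam = - (p powi j)" using theta_zero[OF p w0 th] by blast
    show "\<exists>l\<in>frac_ints N. z = - lam * qpow lq (of_real l)"
    proof (rule bexI[of _ "of_int j / of_nat N"])
      show "z = - lam * qpow lq (complex_of_real (real_of_int j / real N))"
        unfolding qpow_frac[OF N, of lq j] pdef[symmetric] using j lam by (simp add: field_simps)
      show "real_of_int j / real N \<in> frac_ints N" by (auto simp: frac_ints_image)
    qed
    have Van: "V analytic_on {z}" using Vhol z ball_open analytic_at by blast
    have than: "(\<lambda>z. theta p (z / lam)) analytic_on {z}"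
      unfolding analytic_at by (intro exI[of _ "-{0}"] conjI thhol) (use z in auto)
    have freqV: "frequently (\<lambda>z. V z \<noteq> 0) (at z)"
    proof (rule ccontr)
      assume "\<not> frequently (\<lambda>z. V z \<noteq> 0) (at z)"
      hence "eventually (\<lambda>z. V z = 0) (at z)" by (simp add: frequently_def)
      with evS have "eventually (\<lambda>z. S z = 0) (at z)" by eventually_elim simp
      hence "(S \<longlongrightarrow> 0) (at z)" by (rule tendsto_eventually)
      thus False using pole unfolding is_pole_def
        using not_tendsto_and_filterlim_at_infinity[of "at z" S] by simp
    qed
    have freqT: "frequently (\<lambda>z. theta p (z / lam) \<noteq> 0) (at z)"
      by (rule eventually_frequently) (use ev_quot[OF z] in \<open>auto elim: eventually_mono\<close>)
    have ordT: "zorder (\<lambda>z. theta p (z / lam)) z = 1"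
    proof (rule zorder_zero_eqI'[OF than])
      obtain d where d: "d \<noteq> 0" "(theta p has_field_derivative d) (at (z / lam))"
        using theta_zero_simple[OF p w0 th] by blast
      have "((\<lambda>z. z / lam) has_field_derivative (1 / lam)) (at z)"
        by (rule DERIV_cdivide[OF DERIV_ident])
      hence "((\<lambda>z. theta p (z / lam)) has_field_derivative (d * (1 / lam))) (at z)"
        by (rule DERIV_chain2[of "theta p" d "\<lambda>z. z / lam" z, OF d(2)])
      thus "(deriv ^^ nat 1) (\<lambda>z. theta p (z / lam)) z \<noteq> 0"
        using DERIV_imp_deriv d(1) lam by fastforce
    qed (use th in auto)
    have "zorder S z = zorder (\<lambda>z. V z / theta p (z / lam)) z"
      by (rule zorder_cong[OF evS refl])
    also have "\<dots> = zorder V z - zorder (\<lambda>z. theta p (z / lam)) z"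
      by (intro zorder_divide analytic_on_imp_meromorphic_on Van than freqV freqT)
    finally show "zorder S z \<ge> -1"
      using zorder_ge_0[OF Van freqV] ordT by simp
  qed
qed

section \<open>The formal equation\<close>

lemma fps_to_fls_sum: "fps_to_fls (\<Sum>i\<in>I. f i) = (\<Sum>i\<in>I. fps_to_fls (f i))"
  by (induction I rule: infinite_finite_induct) (auto simp: fps_to_fls_plus)

text \<open>D is the product of all denominators.  The formal equation is compared coefficientwise; for
  functions the equation with polynomial coefficients implies the original one outside the zeros
  of D.\<close>
lemma clear_denominators:
  fixes a :: "nat \<Rightarrow> complex poly fract"
  assumes nz: "\<exists>i\<le>m. a i \<noteq> 0" and sol: "qdiff_formal_solution q m a b h"
  obtains A B D where "\<exists>i\<le>m. A i \<noteq> 0" "D \<noteq> 0"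
    "\<And>l. (\<Sum>i\<le>m. \<Sum>j\<le>l. coeff (A i) j * ((q ^ i) ^ (l - j) * fps_nth h (l - j))) = coeff B l"
    "\<And>z y. poly D z \<noteq> 0 \<Longrightarrow> (\<Sum>i\<le>m. poly (A i) z * y i) = poly B z \<Longrightarrow>
       (\<Sum>i\<le>m. ratfun_eval (a i) z * y i) = ratfun_eval b z"
proof -
  define nu where "nu = (\<lambda>r :: complex poly fract. fst (quot_of_fract r))"
  define de where "de = (\<lambda>r :: complex poly fract. snd (quot_of_fract r))"
  have de: "de r \<noteq> 0" for r by (simp add: de_def)
  define D where "D = de b * (\<Prod>i\<le>m. de (a i))"
  define A where "A = (\<lambda>i. nu (a i) * (de b * (\<Prod>j\<in>{..m} - {i}. de (a j))))"
  define B where "B = nu b * (\<Prod>i\<le>m. de (a i))"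
  have D: "D \<noteq> 0" using de by (simp add: D_def)
  have DA: "D * nu (a i) = A i * de (a i)" if "i \<le> m" for i
  proof -
    have "(\<Prod>j\<le>m. de (a j)) = de (a i) * (\<Prod>j\<in>{..m} - {i}. de (a j))"
      using that by (intro prod.remove) auto
    thus ?thesis by (simp add: D_def A_def mult_ac)
  qed
  have DB: "D * nu b = B * de b" by (simp add: D_def B_def mult_ac)
  have Anz: "\<exists>i\<le>m. A i \<noteq> 0"
  proof -
    obtain i where i: "i \<le> m" "a i \<noteq> 0" using nz by blast
    have "nu (a i) \<noteq> 0"
    proof
      assume "nu (a i) = 0"
      hence "quot_of_fract (a i) = quot_of_fract 0"
        using fst_quot_of_fract_0_imp[of "a i"] by (simp add: nu_def prod_eq_iff)
      hence "quot_to_fract (quot_of_fract (a i)) = quot_to_fract (quot_of_fract 0)" by (rule arg_cong)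
      hence "a i = 0" by (simp only: quot_to_fract_quot_of_fract)
      thus False using i by simp
    qed
    thus ?thesis using i de by (intro exI[of _ i]) (simp add: A_def)
  qed
  define F where "F = (\<lambda>r. fps_to_fls (fps_of_poly r) :: complex fls)"
  have F_mult: "F (r * s) = F r * F s" for r s
    by (simp add: F_def fps_of_poly_mult fls_times_fps_to_fls)
  have F_nz: "F r \<noteq> 0" if "r \<noteq> 0" for r using that by (simp add: F_def)
  have rf: "ratfun_fls r = F (nu r) / F (de r)" for r
    by (simp add: ratfun_fls_def F_def nu_def de_def case_prod_beta)
  have rfD: "F D * ratfun_fls r = F X" if "D * nu r = X * de r" for r X
  proof -
    have "F D * F (nu r) = F X * F (de r)" using that by (metis F_mult)
    thus ?thesis unfolding rf using F_nz[OF de[of r]] by (simp add: field_simps)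
  qed
  define H where "H = (\<lambda>i. fps_compose h (fps_const (q ^ i) * fps_X))"
  have "(\<Sum>i\<le>m. ratfun_fls (a i) * fps_to_fls (H i)) = ratfun_fls b"
    using sol by (simp add: qdiff_formal_solution_def H_def)
  hence "F D * (\<Sum>i\<le>m. ratfun_fls (a i) * fps_to_fls (H i)) = F B"
    using rfD[OF DB] by simp
  also have "F D * (\<Sum>i\<le>m. ratfun_fls (a i) * fps_to_fls (H i)) = (\<Sum>i\<le>m. F (A i) * fps_to_fls (H i))"
    unfolding sum_distrib_left by (intro sum.cong refl) (simp add: mult.assoc[symmetric] rfD[OF DA])
  also have "\<dots> = fps_to_fls (\<Sum>i\<le>m. fps_of_poly (A i) * H i)"
    by (simp add: fps_to_fls_sum F_def fls_times_fps_to_fls)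
  finally have fe: "(\<Sum>i\<le>m. fps_of_poly (A i) * H i) = fps_of_poly B" by (simp add: F_def)
  have rec: "(\<Sum>i\<le>m. \<Sum>j\<le>l. coeff (A i) j * ((q ^ i) ^ (l - j) * fps_nth h (l - j))) = coeff B l" for l
  proof -
    have "fps_nth (\<Sum>i\<le>m. fps_of_poly (A i) * H i) l =
        (\<Sum>i\<le>m. \<Sum>j\<le>l. coeff (A i) j * ((q ^ i) ^ (l - j) * fps_nth h (l - j)))"
      by (simp add: fps_sum_nth fps_mult_nth H_def fps_compose_linear atLeast0AtMost)
    thus ?thesis unfolding fe by simp
  qed
  have ev: "(\<Sum>i\<le>m. ratfun_eval (a i) z * y i) = ratfun_eval b z"
    if z: "poly D z \<noteq> 0" and e: "(\<Sum>i\<le>m. poly (A i) z * y i) = poly B z" for z y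
  proof -
    have dz: "poly (de b) z \<noteq> 0" "\<And>i. i \<le> m \<Longrightarrow> poly (de (a i)) z \<noteq> 0"
      using z by (auto simp: D_def poly_prod)
    have re: "ratfun_eval r z = poly X z / poly D z" if X: "D * nu r = X * de r" and d: "poly (de r) z \<noteq> 0" for r X
    proof -
      have "poly D z * poly (nu r) z = poly X z * poly (de r) z" using X by (metis poly_mult)
      thus ?thesis using z d by (simp add: ratfun_eval_def nu_def de_def case_prod_beta field_simps)
    qed
    have "(\<Sum>i\<le>m. ratfun_eval (a i) z * y i) = (\<Sum>i\<le>m. poly (A i) z * y i / poly D z)"
      by (intro sum.cong refl) (simp add: re[OF DA dz(2)])
    also have "\<dots> = poly B z / poly D z" by (simp add: e sum_divide_distrib[symmetric])
    also have "\<dots> = ratfun_eval b z" by (rule re[OF DB dz(1), symmetric])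
    finally show ?thesis .
  qed
  show ?thesis by (rule that[OF Anz D rec ev])
qed

lemma top_part_exists:
  fixes cf :: "'i \<Rightarrow> complex"
  assumes fin: "finite I" and ne: "I \<noteq> {}" and cf: "\<And>i. i \<in> I \<Longrightarrow> cf i \<noteq> 0"
    and inj: "\<And>i i'. i \<in> I \<Longrightarrow> i' \<in> I \<Longrightarrow> dg i = dg i' \<Longrightarrow> ex i = ex i' \<Longrightarrow> i = i'"
  shows "\<exists>E a. top_part I cf dg ex E a \<and> (\<exists>i\<in>I. ex i = E \<and> dg i = degree a) \<and>
           (\<forall>i\<in>I. ex i = E \<longrightarrow> dg i \<le> degree a)"
proof -
  define E where "E = Max (ex ` I)"
  define a where "a = (\<Sum>i | i \<in> I \<and> ex i = E. monom (cf i) (dg i))"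
  have E: "ex i \<le> E" if "i \<in> I" for i unfolding E_def using fin that by (intro Max_ge) auto
  have "E \<in> ex ` I" unfolding E_def using fin ne by (intro Max_in) auto
  then obtain i1 where i1: "i1 \<in> I" "ex i1 = E" by auto
  have co: "coeff a (dg i) = cf i" if i: "i \<in> I" "ex i = E" for i
  proof -
    have "coeff a (dg i) = (\<Sum>k | k \<in> I \<and> ex k = E. if k = i then cf i else 0)"
      unfolding a_def coeff_sum by (intro sum.cong refl) (use i inj in auto)
    also have "\<dots> = cf i" using fin i by simp
    finally show ?thesis .
  qed
  have deg: "dg i \<le> degree a" if "i \<in> I" "ex i = E" for i
    using co[OF that] cf[OF that(1)] by (intro le_degree) simp
  have a0: "a \<noteq> 0" using co[OF i1] cf[OF i1(1)] by auto
  have "\<exists>i\<in>I. ex i = E \<and> dg i = degree a"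
  proof (rule ccontr)
    assume no: "\<not> (\<exists>i\<in>I. ex i = E \<and> dg i = degree a)"
    have "coeff a (degree a) = 0" unfolding a_def coeff_sum
      by (intro sum.neutral) (use no in \<open>auto simp: a_def\<close>)
    thus False using a0 by simp
  qed
  thus ?thesis using fin E a0 deg by (intro exI[of _ E] exI[of _ a]) (auto simp: top_part_def a_def)
qed

text \<open>The difference of the shifts of two monomials is a multiple of the difference of their degrees at
  level 0, and this persists at all levels.  A monomial of higher degree than the top part has a
  strictly smaller shift, so its shift is smaller by at least the difference of the degrees.\<close>
lemma level_degree_condition:
  assumes dv: "\<And>i i'. i \<in> I \<Longrightarrow> i' \<in> I \<Longrightarrow> dg i' < dg i \<Longrightarrow> int (dg i - dg i') dvd ex i' - ex i"
    and E: "\<And>i. i \<in> I \<Longrightarrow> level_shift t dg ex i \<le> E"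
    and top: "i0 \<in> I" "level_shift t dg ex i0 = E" "dg i0 = e"
    and max: "\<And>i. i \<in> I \<Longrightarrow> level_shift t dg ex i = E \<Longrightarrow> dg i \<le> e"
    and i: "i \<in> I"
  shows "int (dg i) + level_shift t dg ex i \<le> int e + E"
proof (cases "dg i \<le> e")
  case True
  thus ?thesis using E[OF i] by simp
next
  case False
  hence lt: "level_shift t dg ex i < E" using E[OF i] max[OF i] by force
  define d where "d = dg i - dg i0"
  have d: "d > 0" "int (dg i) = int (dg i0) + int d" using False top(3) by (auto simp: d_def)
  have "int d dvd ex i0 - ex i" unfolding d_def by (rule dv[OF i top(1)]) (use False top(3) in simp)
  then obtain k where k: "ex i0 - ex i = int d * k" by blast
  have "level_shift t dg ex i < level_shift t dg ex i0" using lt top(2) by simp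
  hence "0 < int d * k + int t * int d" unfolding level_shift_def using k d by (simp add: algebra_simps)
  hence "0 < int d * (k + int t)" by (simp add: algebra_simps)
  hence "0 < k + int t" using d(1) by (simp add: zero_less_mult_iff)
  hence "1 \<le> k + int t" by simp
  hence "int d * 1 \<le> int d * (k + int t)" by (intro mult_left_mono) auto
  hence "int d + level_shift t dg ex i \<le> level_shift t dg ex i0" unfolding level_shift_def using k d by (simp add: algebra_simps)
  thus ?thesis using d(2) top(2,3) by simp
qed

text \<open>Dividing the coefficient of z^l in the equation by p^(t (l choose 2)) distributes over the
  monomials, since l choose 2 = (l - d choose 2) + (d choose 2) + (l - d) d.\<close>
lemma level_recurrence:
  fixes c :: "nat \<Rightarrow> complex"
  assumes p0: "p \<noteq> 0"
    and rec: "\<And>l. (\<Sum>i\<in>I. if dg i \<le> l then cf i * p powi (ex i * int (l - dg i)) * c (l - dg i) else 0) = coeff b l"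
  shows "(\<Sum>i\<in>I. if dg i \<le> l then level_coeff p t cf dg i * p powi (level_shift t dg ex i * int (l - dg i)) *
            level_seq p t c (l - dg i) else 0) = coeff (level_poly p t b) l"
proof -
  have "(if dg i \<le> l then level_coeff p t cf dg i * p powi (level_shift t dg ex i * int (l - dg i)) *
            level_seq p t c (l - dg i) else 0) =
        (if dg i \<le> l then cf i * p powi (ex i * int (l - dg i)) * c (l - dg i) else 0) / p ^ (t * (l choose 2))" for i
  proof (cases "dg i \<le> l")
    case True
    define j k where "j = dg i" and "k = l - dg i"
    have l: "l = k + j" using True by (simp add: j_def k_def)
    have "int (l choose 2) = int ((k choose 2) + (j choose 2) + k * j)"
      using tri_add[of "int k" "int j"] unfolding l by (simp only: tri_of_nat flip: of_nat_add) simp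
    hence lc: "l choose 2 = (k choose 2) + (j choose 2) + k * j" by (simp only: of_nat_eq_iff)
    have le: "level_shift t dg ex i * int k = ex i * int k + (- int (t * (k * j)))"
      by (simp add: level_shift_def j_def algebra_simps)
    have "p powi (level_shift t dg ex i * int k) = p powi (ex i * int k) * p powi (- int (t * (k * j)))"
      unfolding le by (rule power_int_add) (use p0 in auto)
    hence e: "p powi (level_shift t dg ex i * int k) = p powi (ex i * int k) / p ^ (t * (k * j))"
      by (simp only: power_int_minus power_int_of_nat divide_inverse)
    have "t * (l choose 2) = t * (j choose 2) + t * (k * j) + t * (k choose 2)"
      unfolding lc by (simp add: algebra_simps)
    hence pw: "p ^ (t * (l choose 2)) = p ^ (t * (j choose 2)) * p ^ (t * (k * j)) * p ^ (t * (k choose 2))"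
      by (simp add: power_add)
    show ?thesis
      unfolding if_P[OF True] unfolding k_def[symmetric] unfolding e pw level_coeff_def level_seq_def
      unfolding j_def[symmetric] using p0 by simp
  qed auto
  hence "(\<Sum>i\<in>I. if dg i \<le> l then level_coeff p t cf dg i * p powi (level_shift t dg ex i * int (l - dg i)) *
            level_seq p t c (l - dg i) else 0) = coeff b l / p ^ (t * (l choose 2))"
    by (simp add: sum_divide_distrib[symmetric] rec)
  thus ?thesis by (simp add: coeff_level_poly level_seq_def)
qed

lemma qpow_q_borel_exponent:
  assumes N: "N > 0"
  shows "qpow lq (- (of_nat l * (of_nat l - 1) / (2 * of_real (real N)))) =
    inverse (exp (lq / of_nat N) ^ (l choose 2))"
proof -
  have "(of_int (2 * int (l choose 2)) :: complex) = of_int (int l * (int l - 1))"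
    using two_tri[of "int l"] unfolding tri_of_nat by (rule arg_cong)
  hence ll: "of_nat l * (of_nat l - 1) = (2 * of_nat (l choose 2) :: complex)"
    by (simp only: of_int_mult of_int_diff of_int_1 of_int_numeral of_int_of_nat_eq)
  have "2 * c / (2 * of_real (real N)) * x = c * (x / of_nat N)" for c x :: complex
    by simp
  hence "- (of_nat l * (of_nat l - 1) / (2 * of_real (real N))) * lq =
      - (of_nat (l choose 2) * (lq / of_nat N))"
    unfolding ll mult_minus_left by (rule arg_cong)
  thus ?thesis
    unfolding qpow_def by (simp only: exp_minus exp_of_nat_mult)
qed

lemma fps_nth_q_borels:
  assumes N: "N > 0"
  shows "fps_nth (q_borels lq (replicate t (real N)) h) = level_seq (exp (lq / of_nat N)) t (fps_nth h)"
proof (induction t)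
  case 0
  show ?case by (simp add: q_borels_def level_0)
next
  case (Suc t)
  define p where "p = exp (lq / of_nat N)"
  have "q_borels lq (replicate (Suc t) (real N)) h = q_borel lq (real N) (q_borels lq (replicate t (real N)) h)"
    unfolding q_borels_def by simp
  hence "fps_nth (q_borels lq (replicate (Suc t) (real N)) h) l =
      fps_nth (q_borels lq (replicate t (real N)) h) l * inverse (p ^ (l choose 2))" for l
    unfolding q_borel_def p_def qpow_q_borel_exponent[OF N] by (simp only: fps_nth_Abs_fps)
  hence "fps_nth (q_borels lq (replicate (Suc t) (real N)) h) l =
      fps_nth h l / p ^ (t * (l choose 2)) * inverse (p ^ (l choose 2))" for l
    unfolding Suc.IH level_seq_def p_def .
  moreover have "fps_nth h l / p ^ (t * (l choose 2)) * inverse (p ^ (l choose 2)) = level_seq p (Suc t) (fps_nth h) l" for l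
    by (simp add: level_seq_def divide_inverse power_add)
  ultimately show ?case unfolding p_def[symmetric] by (intro ext) (simp only:)
qed

lemma spiral_class:
  assumes N: "N > 0" and pdef: "p = exp (lq / of_nat N)" and x: "x \<noteq> 0"
  shows "spiral_rel lq N `` {x} = spirals p {x}"
proof -
  have p0: "p \<noteq> 0" by (simp add: pdef)
  show ?thesis
    unfolding spiral_rel_def spirals_def frac_ints_image
    using qpow_frac[OF N, of lq] x p0 by (auto simp: pdef)
qed

lemma spirals_single_eq:
  assumes p0: "p \<noteq> 0" and y: "y \<in> spirals p {x}"
  shows "spirals p {y} = spirals p {x}"
proof -
  obtain k where k: "y = p powi k * x" using y by (auto simp: spirals_def)
  have "p powi j * y = p powi (j + k) * x" "p powi j * x = p powi (j - k) * y" for j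
    using p0 by (auto simp: k power_int_add power_int_diff)
  thus ?thesis unfolding spirals_def by blast
qed

lemma meromorphic_germ_eq_trans:
  assumes "meromorphic_germ_eq f \<phi>" "meromorphic_germ_eq g \<phi>"
  shows "meromorphic_germ_eq f g"
proof -
  obtain r s where r: "r > 0" "\<forall>\<^sub>\<approx>z\<in>ball 0 r - {0}. f z = \<phi> z" and s: "s > 0" "\<forall>\<^sub>\<approx>z\<in>ball 0 s - {0}. g z = \<phi> z"
    using assms by (auto simp: meromorphic_germ_eq_def)
  have "\<forall>\<^sub>\<approx>z\<in>ball 0 (min r s) - {0}. f z = \<phi> z" "\<forall>\<^sub>\<approx>z\<in>ball 0 (min r s) - {0}. g z = \<phi> z"
    by (rule cosparse_subset[OF r(2)], force, rule cosparse_subset[OF s(2)], force)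
  hence "\<forall>\<^sub>\<approx>z\<in>ball 0 (min r s) - {0}. f z = g z" by eventually_elim simp
  thus ?thesis unfolding meromorphic_germ_eq_def using r(1) s(1) by (intro exI[of _ "min r s"]) auto
qed

section \<open>Summation of formal solutions\<close>

theorem mainTheorem1:
  fixes q lq :: complex
    and m :: nat and a :: "nat \<Rightarrow> complex poly fract" and b :: "complex poly fract"
    and h :: "complex fps"
  assumes "exp lq = q" and "norm q > 1"
    and "\<exists>i\<le>m. a i \<noteq> 0"
    and "qdiff_formal_solution q m a b h"
  shows "\<exists>(\<kappa>s :: real list) (n :: nat) (K :: nat) (\<Sigma> :: complex set set).
           \<kappa>s \<noteq> [] \<and> (\<forall>\<kappa>\<in>set \<kappa>s. \<kappa> \<in> \<rat> \<and> \<kappa> > 0) \<and>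
           n > 0 \<and> K > 0 \<and> n dvd K \<and>
           (\<forall>\<kappa>\<in>set (butlast \<kappa>s). \<exists>j::nat. j > 0 \<and> real K = \<kappa> * real j) \<and>
           (\<exists>j::nat. j > 0 \<and> real n = last \<kappa>s * real j) \<and>
           finite \<Sigma> \<and> \<Sigma> \<subseteq> (- {0}) // spiral_rel lq n \<and>
           (\<forall>\<Lambda> \<in> (- {0}) // spiral_rel lq n - \<Sigma>. \<forall>lam\<in>\<Lambda>.
              q_borel_summable lq \<kappa>s n K lam h \<and>
              q_borel_sum lq \<kappa>s n K lam h \<in> meromorphic_germs \<and>
              (\<exists>S. S nicely_meromorphic_on (- {0}) \<and>
                   meromorphic_germ_eq S (q_borel_sum lq \<kappa>s n K lam h) \<and>
                   qdiff_meromorphic_solution q m a b S \<and>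
                   (\<exists>\<mu>. \<mu> \<in> \<rat> \<and> \<mu> > 0 \<and> q_asymptotic lq lam \<mu> n S h) \<and>
                   (\<exists>\<rho>>0. \<forall>z. 0 < norm z \<and> norm z < \<rho> \<and> is_pole S z \<longrightarrow>
                      zorder S z \<ge> -1 \<and> (\<exists>l\<in>frac_ints n. z = - lam * qpow lq (of_real l)))))"
proof -
  obtain A B Dn where A: "\<exists>i\<le>m. A i \<noteq> 0" and Dn: "Dn \<noteq> 0"
    and Arec: "\<And>l. (\<Sum>i\<le>m. \<Sum>j\<le>l. coeff (A i) j * ((q ^ i) ^ (l - j) * fps_nth h (l - j))) = coeff B l"
    and Aev: "\<And>z y. poly Dn z \<noteq> 0 \<Longrightarrow> (\<Sum>i\<le>m. poly (A i) z * y i) = poly B z \<Longrightarrow>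
       (\<Sum>i\<le>m. ratfun_eval (a i) z * y i) = ratfun_eval b z"
    by (rule clear_denominators[OF assms(3,4)], rule that) assumption+
  define deg where "deg = (\<Sum>i\<le>m. degree (A i))"
  have deg: "degree (A i) \<le> deg" if "i \<le> m" for i
    unfolding deg_def by (rule member_le_sum) (use that in auto)
  \<comment> \<open>Every difference of degrees divides N, and therefore the difference of the corresponding shifts.\<close>
  define N :: nat where "N = fact deg"
  have N: "N > 0" by (simp add: N_def)
  define p where "p = exp (lq / of_nat N)"
  have p0: "p \<noteq> 0" by (simp add: p_def)
  have qp: "q = p ^ N"
    using assms(1) N unfolding p_def exp_of_nat_mult[symmetric] by simp
  have p: "norm p > 1"
  proof (rule ccontr)
    assume "\<not> norm p > 1"
    hence "norm p ^ N \<le> 1" by (intro power_le_one) auto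
    thus False using assms(2) by (simp add: qp norm_power)
  qed
  define I where "I = {(i, j). i \<le> m \<and> j \<le> deg \<and> coeff (A i) j \<noteq> 0}"
  define cf where "cf = (\<lambda>(i, j). coeff (A i) j)"
  define dg :: "nat \<times> nat \<Rightarrow> nat" where "dg = snd"
  define ex :: "nat \<times> nat \<Rightarrow> int" where "ex = (\<lambda>(i, j). int N * int i)"
  have Isub: "I \<subseteq> {..m} \<times> {..deg}" by (auto simp: I_def)
  have fin: "finite I" using Isub by (rule finite_subset) auto
  have Ine: "I \<noteq> {}"
  proof -
    obtain i where "i \<le> m" "A i \<noteq> 0" using A by blast
    hence "(i, degree (A i)) \<in> I" using deg by (auto simp: I_def)
    thus ?thesis by blast
  qed
  have inj: "x = y" if "x \<in> I" "y \<in> I" "dg x = dg y" "ex x = ex y" for x y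
    using that N by (auto simp: dg_def ex_def prod_eq_iff split: prod.splits)
  have cfnz: "cf x \<noteq> 0" if "x \<in> I" for x using that by (auto simp: I_def cf_def)
  have sumI: "(\<Sum>x\<in>I. cf x * G x) = (\<Sum>i\<le>m. \<Sum>j\<le>deg. coeff (A i) j * G (i, j))" for G :: "nat \<times> nat \<Rightarrow> complex"
  proof -
    have "(\<Sum>x\<in>I. cf x * G x) = (\<Sum>x\<in>{..m} \<times> {..deg}. cf x * G x)"
      by (rule sum.mono_neutral_left) (use Isub in \<open>auto simp: I_def cf_def\<close>)
    also have "\<dots> = (\<Sum>i\<le>m. \<Sum>j\<le>deg. coeff (A i) j * G (i, j))"
      unfolding sum.cartesian_product by (intro sum.cong refl) (auto simp: cf_def)
    finally show ?thesis .
  qed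
  have qop_A: "qop p I cf dg ex f z = (\<Sum>i\<le>m. poly (A i) z * f (q ^ i * z))" for f z
  proof -
    have "qop p I cf dg ex f z = (\<Sum>x\<in>I. cf x * (z ^ dg x * f (p powi ex x * z)))"
      by (simp add: qop_def mult.assoc)
    also have "\<dots> = (\<Sum>i\<le>m. \<Sum>j\<le>deg. coeff (A i) j * (z ^ j * f (q ^ i * z)))"
      unfolding sumI by (intro sum.cong refl) (simp add: dg_def ex_def qp power_int_mult power_mult)
    also have "\<dots> = (\<Sum>i\<le>m. poly (A i) z * f (q ^ i * z))"
    proof (intro sum.cong refl)
      fix i assume "i \<in> {..m}"
      hence d: "degree (A i) \<le> deg" using deg by simp
      have "poly (A i) z = (\<Sum>j\<le>deg. coeff (A i) j * z ^ j)"
        unfolding poly_altdef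
        by (rule sum.mono_neutral_left) (use d in \<open>auto simp: coeff_eq_0\<close>)
      thus "(\<Sum>j\<le>deg. coeff (A i) j * (z ^ j * f (q ^ i * z))) = poly (A i) z * f (q ^ i * z)"
        by (simp add: sum_distrib_right mult.assoc)
    qed
    finally show ?thesis .
  qed
  have rec: "(\<Sum>x\<in>I. if dg x \<le> l then cf x * p powi (ex x * int (l - dg x)) * fps_nth h (l - dg x) else 0) = coeff B l" for l
  proof -
    have "(\<Sum>x\<in>I. if dg x \<le> l then cf x * p powi (ex x * int (l - dg x)) * fps_nth h (l - dg x) else 0) =
      (\<Sum>x\<in>I. cf x * (if dg x \<le> l then p powi (ex x * int (l - dg x)) * fps_nth h (l - dg x) else 0))"
      by (intro sum.cong refl) (simp add: mult.assoc)
    also have "\<dots> = (\<Sum>i\<le>m. \<Sum>j\<le>deg. coeff (A i) j *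
        (if j \<le> l then (q ^ i) ^ (l - j) * fps_nth h (l - j) else 0))"
    proof -
      have "p powi (int N * int i * int k) = (q ^ i) ^ k" for i k
      proof -
        have "int N * int i * int k = int (N * i * k)" by simp
        thus ?thesis unfolding qp by (simp only: power_int_of_nat power_mult)
      qed
      thus ?thesis unfolding sumI by (intro sum.cong refl) (simp add: dg_def ex_def flip: of_nat_diff)
    qed
    also have "\<dots> = (\<Sum>i\<le>m. \<Sum>j\<le>l. coeff (A i) j * ((q ^ i) ^ (l - j) * fps_nth h (l - j)))"
    proof (rule sum.cong[OF refl])
      fix i assume "i \<in> {..m}"
      hence d: "degree (A i) \<le> deg" using deg by simp
      let ?g = "\<lambda>j. coeff (A i) j * (if j \<le> l then (q ^ i) ^ (l - j) * fps_nth h (l - j) else 0)"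
      have "(\<Sum>j\<le>deg. ?g j) = (\<Sum>j\<le>deg + l. ?g j)"
        by (rule sum.mono_neutral_left) (use d in \<open>auto simp: coeff_eq_0\<close>)
      also have "\<dots> = (\<Sum>j\<le>l. ?g j)"
        by (rule sum.mono_neutral_right) auto
      also have "\<dots> = (\<Sum>j\<le>l. coeff (A i) j * ((q ^ i) ^ (l - j) * fps_nth h (l - j)))"
        by (intro sum.cong) auto
      finally show "(\<Sum>j\<le>deg. ?g j) = (\<Sum>j\<le>l. coeff (A i) j * ((q ^ i) ^ (l - j) * fps_nth h (l - j)))" .
    qed
    also have "\<dots> = coeff B l" by (rule Arec)
    finally show ?thesis .
  qed
  have "\<exists>E a. top_part I (level_coeff p t cf dg) dg (level_shift t dg ex) E a \<and>
      (\<exists>i\<in>I. level_shift t dg ex i = E \<and> dg i = degree a) \<and> (\<forall>i\<in>I. level_shift t dg ex i = E \<longrightarrow> dg i \<le> degree a)" for t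
  proof (rule top_part_exists[OF fin Ine])
    show "level_coeff p t cf dg x \<noteq> 0" if "x \<in> I" for x using cfnz[OF that] p0 by (simp add: level_coeff_def)
    show "x = y" if "x \<in> I" "y \<in> I" "dg x = dg y" "level_shift t dg ex x = level_shift t dg ex y" for x y
      using inj[OF that(1-3)] that(3,4) by (simp add: level_shift_def)
  qed
  then obtain E tp where top: "\<And>t. top_part I (level_coeff p t cf dg) dg (level_shift t dg ex) (E t) (tp t)"
    and top1: "\<And>t. \<exists>i\<in>I. level_shift t dg ex i = E t \<and> dg i = degree (tp t)"
    and top2: "\<And>t i. i \<in> I \<Longrightarrow> level_shift t dg ex i = E t \<Longrightarrow> dg i \<le> degree (tp t)" by metis
  have dv: "int (dg x - dg y) dvd ex y - ex x" if "x \<in> I" "y \<in> I" "dg y < dg x" for x y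
  proof -
    have "dg x - dg y dvd N" unfolding N_def
      by (rule dvd_fact) (use that in \<open>auto simp: I_def dg_def\<close>)
    hence "int (dg x - dg y) dvd int N" by (simp only: of_nat_dvd_iff)
    thus ?thesis by (auto simp: ex_def split: prod.splits intro!: dvd_diff)
  qed
  have degc: "int (dg i) + level_shift t dg ex i \<le> int (degree (tp t)) + E t" if i: "i \<in> I" for t i
  proof -
    obtain i0 where i0: "i0 \<in> I" "level_shift t dg ex i0 = E t" "dg i0 = degree (tp t)" using top1[of t] by blast
    show ?thesis
      by (rule level_degree_condition[OF dv _ i0 top2 i]) (use top[of t] in \<open>auto simp: top_part_def\<close>)
  qed
  have tp0: "tp t \<noteq> 0" for t using top[of t] unfolding top_part_def by blast
  \<comment> \<open>The monomial i0 has the largest shift among those of least degree j0 in z.  Level t lowers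
    the shift of a monomial of degree d by t * d, and the shifts at level 0 lie between 0 and N * m;
    hence for T > N * m the shift of i0 is maximal among all monomials at level T.\<close>
  define j0 where "j0 = Min (dg ` I)"
  have j0: "j0 \<le> dg x" if "x \<in> I" for x unfolding j0_def using fin that by (intro Min_le) auto
  define I0 where "I0 = {x \<in> I. dg x = j0}"
  have "j0 \<in> dg ` I" unfolding j0_def using fin Ine by (intro Min_in) auto
  hence I0: "finite I0" "I0 \<noteq> {}" using fin by (auto simp: I0_def)
  have "Max (ex ` I0) \<in> ex ` I0" using I0 by (intro Max_in) auto
  then obtain i0 where i0: "i0 \<in> I0" "ex i0 = Max (ex ` I0)" by auto
  have i0max: "ex x \<le> ex i0" if "x \<in> I0" for x unfolding i0(2) using I0 that by (intro Max_ge) auto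
  have i0I: "i0 \<in> I" "dg i0 = j0" using i0(1) by (auto simp: I0_def)
  define T where "T = Suc (N * m)"
  have exb: "0 \<le> ex x" "ex x \<le> int (N * m)" if "x \<in> I" for x
    using that by (auto simp: ex_def I_def intro!: mult_left_mono)
  have levT: "level_shift T dg ex x \<le> level_shift T dg ex i0" if x: "x \<in> I" for x
  proof (cases "dg x = j0")
    case True
    hence "ex x \<le> ex i0" using i0max[of x] x by (simp add: I0_def)
    thus ?thesis using True i0I by (simp add: level_shift_def)
  next
    case False
    hence "dg x \<ge> Suc j0" using j0[OF x] by simp
    hence "int T * int (Suc j0) \<le> int T * int (dg x)" by (intro mult_left_mono) auto
    hence "int T * int j0 + int T \<le> int T * int (dg x)" by (simp add: distrib_left)
    moreover have "ex x < ex i0 + int T" using exb[OF x] exb[OF i0I(1)] by (simp add: T_def)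
    ultimately show ?thesis unfolding level_shift_def i0I(2) by linarith
  qed
  have recT: "(\<Sum>x\<in>I. if dg x \<le> l then level_coeff p T cf dg x * p powi (level_shift T dg ex x * int (l - dg x)) *
      level_seq p T (fps_nth h) (l - dg x) else 0) = coeff (level_poly p T B) l" for l
    by (rule level_recurrence[OF p0 rec])
  obtain L M where LM: "L \<ge> 0" "M \<ge> 1" "\<And>n. norm (level_seq p T (fps_nth h) n) \<le> L * M ^ n"
  proof (rule power_series_coeff_bound[where p = p and I = I and ?i0.0 = i0 and cf = "level_coeff p T cf dg"
        and ex = "level_shift T dg ex" and dg = dg and c = "level_seq p T (fps_nth h)" and b = "level_poly p T B"])
    show "level_coeff p T cf dg i0 \<noteq> 0" using cfnz[OF i0I(1)] p0 by (simp add: level_coeff_def)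
    show "x = i0" if "x \<in> I" "dg x = dg i0" "level_shift T dg ex x = level_shift T dg ex i0" for x
      using inj[OF that(1) i0I(1) that(2)] that(2,3) by (simp add: level_shift_def)
  qed (use p fin i0I levT j0 recT in auto)
  define \<kappa>s where "\<kappa>s = replicate T (real N)"
  have T: "T > 0" by (simp add: T_def)
  have stages: "q_sum_stages \<kappa>s N N = replicate T (real N, N)"
  proof -
    have snoc: "replicate T x = replicate (N * m) x @ [x]" for x :: 'x
      by (simp add: T_def replicate_append_same)
    show ?thesis unfolding \<kappa>s_def snoc q_sum_stages_def by (simp del: replicate_append_same)
  qed
  have borel: "fps_nth (q_borels lq \<kappa>s h) = level_seq p T (fps_nth h)"
    unfolding \<kappa>s_def p_def by (rule fps_nth_q_borels[OF N])
  have conv: "fps_conv_radius (q_borels lq \<kappa>s h) > 0"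
  proof -
    have "summable (\<lambda>n. fps_nth (q_borels lq \<kappa>s h) n * (of_real (1 / (2 * M)) :: complex) ^ n)"
    proof (rule summable_comparison_test')
      show "summable (\<lambda>n. L * (1 / 2) ^ n)" by (intro summable_mult summable_geometric) auto
      fix n
      have "norm (level_seq p T (fps_nth h) n) * (1 / (2 * M)) ^ n \<le> (L * M ^ n) * (1 / (2 * M)) ^ n"
        using LM by (intro mult_right_mono) auto
      also have "\<dots> = L * (1 / 2) ^ n" using LM(2) by (simp add: power_divide power_mult_distrib)
      finally show "norm (fps_nth (q_borels lq \<kappa>s h) n * (of_real (1 / (2 * M)) :: complex) ^ n) \<le> L * (1 / 2) ^ n"
        unfolding borel norm_mult norm_power norm_of_real using LM(2) by simp
    qed
    hence "ereal (norm (of_real (1 / (2 * M)) :: complex)) \<le> conv_radius (fps_nth (q_borels lq \<kappa>s h))"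
      by (rule conv_radius_geI)
    moreover have "0 < ereal (norm (of_real (1 / (2 * M)) :: complex))" using LM(2) by simp
    ultimately show ?thesis unfolding fps_conv_radius_def by (rule less_le_trans[rotated])
  qed
  define Z where "Z = {s. s \<noteq> 0 \<and> (\<exists>t\<in>{1..T}. poly (tp t) s = 0)}"
  have Zfin: "finite Z"
  proof -
    have "finite (\<Union>t\<in>{1..T}. {s. poly (tp t) s = 0})"
      using poly_roots_finite[OF tp0] by blast
    thus ?thesis by (rule rev_finite_subset) (auto simp: Z_def)
  qed
  define \<Sigma> where "\<Sigma> = (\<lambda>s. spiral_rel lq N `` {s}) ` Z"
  have \<Sigma>sub: "\<Sigma> \<subseteq> (- {0}) // spiral_rel lq N" by (auto simp: \<Sigma>_def Z_def quotient_def)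
  have main: "q_borel_summable lq \<kappa>s N N lam h \<and>
              q_borel_sum lq \<kappa>s N N lam h \<in> meromorphic_germs \<and>
              (\<exists>S. S nicely_meromorphic_on (- {0}) \<and>
                   meromorphic_germ_eq S (q_borel_sum lq \<kappa>s N N lam h) \<and>
                   qdiff_meromorphic_solution q m a b S \<and>
                   (\<exists>\<mu>. \<mu> \<in> \<rat> \<and> \<mu> > 0 \<and> q_asymptotic lq lam \<mu> N S h) \<and>
                   (\<exists>\<rho>>0. \<forall>z. 0 < norm z \<and> norm z < \<rho> \<and> is_pole S z \<longrightarrow>
                      zorder S z \<ge> -1 \<and> (\<exists>l\<in>frac_ints N. z = - lam * qpow lq (of_real l))))"
    if \<Lambda>: "\<Lambda> \<in> (- {0}) // spiral_rel lq N - \<Sigma>" and lam\<Lambda>: "lam \<in> \<Lambda>" for \<Lambda> lam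
  proof -
    obtain x where x: "x \<noteq> 0" "\<Lambda> = spirals p {x}"
      using \<Lambda> spiral_class[OF N p_def] unfolding quotient_def by auto
    have lam: "lam \<noteq> 0"
    proof
      assume "lam = 0"
      thus False using lam\<Lambda> x spirals_nonzero[OF p0, of "{x}"] by auto
    qed
    have \<Lambda>_eq: "\<Lambda> = spirals p {lam}" using spirals_single_eq[OF p0, of lam x] lam\<Lambda> x by simp
    have gen: "lam \<notin> spirals p {z}" if "1 \<le> t" "t \<le> T" "z \<noteq> 0" "poly (tp t) z = 0" for t z
    proof
      assume "lam \<in> spirals p {z}"
      hence "\<Lambda> = spiral_rel lq N `` {z}"
        using spirals_single_eq[OF p0, of lam z] spiral_class[OF N p_def that(3)] \<Lambda>_eq by simp
      moreover have "z \<in> Z" using that by (auto simp: Z_def)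
      ultimately show False using \<Lambda> by (auto simp: \<Sigma>_def)
    qed
    note R = level_singularities[OF tp0 lam]
    obtain \<phi> V \<rho> L' M' where sol: "solves_level p lam (level_singularities lam (tp T)) I (level_coeff p T cf dg) dg
        (level_shift T dg ex) (level_poly p T B) (level_seq p T (fps_nth h)) 0 \<phi> V \<rho> L' M'"
      and germ: "meromorphic_germ_eq (\<lambda>z. \<Sum>n. level_seq p T (fps_nth h) n * z ^ n) \<phi>"
    proof -
      have "\<exists>\<phi> V \<rho> L' M'. solves_level p lam (level_singularities lam (tp T)) I (level_coeff p T cf dg) dg
          (level_shift T dg ex) (level_poly p T B) (level_seq p T (fps_nth h)) 0 \<phi> V \<rho> L' M' \<and>
          meromorphic_germ_eq (\<lambda>z. \<Sum>n. level_seq p T (fps_nth h) n * z ^ n) \<phi>"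
        by (rule initial_level[OF p lam R(1-3) top _ LM recT]) (rule R(4))
      thus ?thesis using that by blast
    qed
    have "(\<lambda>z. \<Sum>n. level_seq p T (fps_nth h) n * z ^ n) = eval_fps (q_borels lq \<kappa>s h)"
      by (simp add: eval_fps_def fun_eq_iff borel)
    with germ have germ': "meromorphic_germ_eq (eval_fps (q_borels lq \<kappa>s h)) \<phi>" by simp
    obtain \<phi>' V' \<rho>' L'' M'' where def: "q_laplaces_defined lq lam (replicate T (real N, N)) (eval_fps (q_borels lq \<kappa>s h))"
      and sol': "solves_level p lam (level_singularities lam (tp 0)) I cf dg ex B (fps_nth h) (0 + T) \<phi>' V' \<rho>' L'' M''"
      and germ'': "meromorphic_germ_eq (q_laplaces lq lam (replicate T (real N, N)) (eval_fps (q_borels lq \<kappa>s h))) \<phi>'"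
    proof -
      have "q_laplaces_defined lq lam (replicate T (real N, N)) (eval_fps (q_borels lq \<kappa>s h)) \<and>
         (\<exists>\<phi>' V' \<rho>' L' M'. solves_level p lam (level_singularities lam (tp 0)) I cf dg ex B (fps_nth h) (0 + T) \<phi>' V' \<rho>' L' M' \<and>
            meromorphic_germ_eq (q_laplaces lq lam (replicate T (real N, N)) (eval_fps (q_borels lq \<kappa>s h))) \<phi>')"
        by (rule level_chain[OF N p_def p lam top _ _ order_refl sol germ']) (use degc gen in blast)+
      thus ?thesis using that by blast
    qed
    have sum_eq: "q_borel_sum lq \<kappa>s N N lam h = q_laplaces lq lam (replicate T (real N, N)) (eval_fps (q_borels lq \<kappa>s h))"
      by (simp add: q_borel_sum_def stages)
    have sol0: "solves_level p lam (level_singularities lam (tp 0)) I cf dg ex B (fps_nth h) T \<phi>' V' \<rho>' L'' M''"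
      using sol' by simp
    note fin = level_0_solution[OF N p_def p lam R(1-3) T sol0]
    have "\<phi>' meromorphic_on - {0}" using sol' by (simp add: solves_level_def)
    hence 1: "q_borel_sum lq \<kappa>s N N lam h \<in> meromorphic_germs"
      using meromorphic_germ_eq_imp_germ[OF germ''] by (simp add: sum_eq)
    have 2: "q_borel_summable lq \<kappa>s N N lam h"
      unfolding q_borel_summable_def stages using conv def by blast
    have 3: "meromorphic_germ_eq (remove_sings \<phi>') (q_borel_sum lq \<kappa>s N N lam h)"
      unfolding sum_eq by (rule meromorphic_germ_eq_trans[OF fin(2) germ''])
    have 4: "qdiff_meromorphic_solution q m a b (remove_sings \<phi>')"
      unfolding qdiff_meromorphic_solution_def
    proof -
      have "\<forall>\<^sub>\<approx>z\<in>- {0}. z \<notin> {z. poly Dn z = 0}"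
        by (intro eventually_not_in_cosparse finite_imp_sparse poly_roots_finite Dn)
      with fin(3) show "\<forall>\<^sub>\<approx>z\<in>- {0}. (\<Sum>i\<le>m. ratfun_eval (a i) z * remove_sings \<phi>' (q ^ i * z)) = ratfun_eval b z"
      proof eventually_elim
        case (elim z)
        thus ?case using Aev[of z "\<lambda>i. remove_sings \<phi>' (q ^ i * z)"] by (simp add: qop_A)
      qed
    qed
    have "real N / real T \<in> \<rat>" "real N / real T > 0" using N T by auto
    hence 5: "\<exists>\<mu>. \<mu> \<in> \<rat> \<and> \<mu> > 0 \<and> q_asymptotic lq lam \<mu> N (remove_sings \<phi>') h"
      using fin(4) by blast
    show ?thesis using 1 2 3 4 5 fin(1,5) by blast
  qed
  have k1: "\<kappa>s \<noteq> []" by (simp add: \<kappa>s_def T_def)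
  have k2: "\<forall>\<kappa>\<in>set \<kappa>s. \<kappa> \<in> \<rat> \<and> \<kappa> > 0" using N by (simp add: \<kappa>s_def)
  have k3: "\<forall>\<kappa>\<in>set (butlast \<kappa>s). \<exists>j::nat. j > 0 \<and> real N = \<kappa> * real j"
  proof
    fix \<kappa> assume "\<kappa> \<in> set (butlast \<kappa>s)"
    hence "\<kappa> \<in> set \<kappa>s" by (rule in_set_butlastD)
    hence "\<kappa> = real N" by (auto simp: \<kappa>s_def)
    thus "\<exists>j::nat. j > 0 \<and> real N = \<kappa> * real j" by (intro exI[of _ 1]) simp
  qed
  have k4: "\<exists>j::nat. j > 0 \<and> real N = last \<kappa>s * real j"
    by (intro exI[of _ 1]) (simp add: \<kappa>s_def T_def last_replicate)
  have k5: "finite \<Sigma>" using Zfin by (simp add: \<Sigma>_def)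
  show ?thesis
    by (intro exI[of _ \<kappa>s] exI[of _ N] exI[of _ \<Sigma>] conjI ballI k1 N dvd_refl k4 k5 \<Sigma>sub
         bspec[OF k2, THEN conjunct1] bspec[OF k2, THEN conjunct2] bspec[OF k3])
       (use main in blast)+
qed

end
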